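(* Let $\mathcal{G}_P$ be the parallelogram bar-joint framework of a regular multigrid parallelogram tiling $P$ of $\mathbb{R}^2$ and let $\underline{a}$ be a basis for $\mathbb{R}^2$. Then \[ {\bf L}_{\rm lim}(\mathcal{G}_P,\underline{a})={\bf L}_{\rm slip}(\mathcal{G}_P,\underline{a})=RF(P)^{\underline{a}}. \]
   Context: Frameworks. A bar-joint framework $\mathcal{G}=(G,p)$ in $\mathbb{R}^2$ is a countable simple graph $G=(V,E)$ with a placement $p:V\to\mathbb{R}^2$ by distinct points (joints). It is a Delone framework if its set of joints is a Delone set (uniformly discrete and relatively dense) and the bar lengths $|p(v)-p(w)|$, $vw\in E$, are uniformly bounded. A velocity field is a map $u:p(V)\to\mathbb{C}^2$; it is an infinitesimal flex if $\langle u(p(v))-u(p(w)),p(v)-p(w)\rangle=0$ for all $vw\in E$. A line figure is a set of lines through the origin (identified with its union). Phase fields. Let $\underline{\bf t}=\{{\bf t_1},{\bf t_2}\}$ be a basis of $\mathbb{R}^2$ and $C_k=\{s_1{\bf t_1}+s_2{\bf t_2}:k_i\le s_i<k_i+1\}$, $k\in\mathbb{Z}^2$, its cells. For $\omega=(\omega_1,\omega_2)\in\mathbb{T}^2$ ($\mathbb{T}$ the unit circle), the phase field $\phi_{\omega,\underline{\bf t}}:\mathbb{R}^2\to\mathbb{T}$ takes the value $\omega_1^{k_1}\omega_2^{k_2}$ on $C_k$. For a matrix $B=(b_{l,m})_{0\le l\le L-1,\,0\le m\le M-1}$ of vectors in $\mathbb{C}^2$ (a unit cell velocity vector matrix, of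 some size $L\times M$), $\phi_{\omega,\underline{\bf t}}\otimes B$ is the velocity field on $\mathbb{R}^2$ which takes the value $b_{l,m}$ on the $(l,m)$ subcell $\{s_1{\bf t_1}+s_2{\bf t_2}: l/L\le s_1<(l+1)/L,\ m/M\le s_2<(m+1)/M\}$ of $C_{(0,0)}$ and the value $\omega_1^{k_1}\omega_2^{k_2}b_{l,m}$ on the translate of this subcell by $k_1{\bf t_1}+k_2{\bf t_2}$. For a scalar function $\phi$ on $\mathbb{R}^2$ and a velocity field $u$, the modulation $\phi\cdot u$ is the pointwise product. $\tau_b$ denotes the constant velocity field with value $b$. Closeness. Velocity fields $u,z$ on the set $J$ of joints are mostly $\epsilon$-close if there is $N_0$ such that for all $N\ge N_0$ and every translate $S$ of the square $[-N,N]^2$, $|\{p\in J\cap S:\|u(p)-z(p)\|_2>\epsilon\}|<\epsilon|J\cap S|$. Periodic slippage lines. A line $H=\mathbb{R}{\bf t_1}$ is a periodic slippage line for a Delone framework $\mathcal{G}$ if there are a nonzero $b\in\mathbb{R}^2$ and a vector ${\bf t_2}$, with $\{{\bf t_1},{\bf t_2}\}$ a basis, such that for every $\epsilon>0$ there are an infinitesimal flex $u$ of $\mathcal{G}$ and a positive integer $M$ with: (i) $\phi_{(1,\lambda),\{{\bf t_1},M{\bf t_2}\}}\cdot u$ is an infinitesimal flex for all $\lambda\in\mathbb{T}$; (ii) $\phi_{(1,\lambda),\{{\bf t_1},M{\bf t_2}\}}\cdot u$ is mostly $\epsilon$-close to the restriction to the joints of $\phi_{(1,\lambda),\{{\bf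 t_1},M{\bf t_2}\}}\cdot\tau_b$ for all $\lambda\in\mathbb{T}$. $PSF(\mathcal{G})$ is the union of the periodic slippage lines. Periodic localisation lines. A line $H=\mathbb{R}{\bf t_1}$ is a periodic localisation line for a Delone framework $\mathcal{G}$ if there is a basis $\{{\bf t_1},{\bf t_2}\}$ such that for every $\epsilon>0$ there are a nonzero infinitesimal flex $u$, a phase factor $\lambda_1\in\mathbb{T}$ and positive integers $M_1,M_2$ with: (i) $\phi_{(\lambda_1,\lambda),\{M_1{\bf t_1},M_2{\bf t_2}\}}\cdot u$ is an infinitesimal flex for all $\lambda\in\mathbb{T}$; (ii) for some unit cell velocity vector matrix $B$, $\phi_{(\lambda_1,\lambda),\{M_1{\bf t_1},M_2{\bf t_2}\}}\cdot u$ is mostly $\epsilon$-close to the restriction to the joints of $\phi_{(\lambda_1,\lambda),\{M_1{\bf t_1},M_2{\bf t_2}\}}\otimes B$ for all $\lambda\in\mathbb{T}$. $PLLF(\mathcal{G})$ is the union of the periodic localisation lines. Reciprocal figures and spectra. For a basis $\underline{a}=\{a_1,a_2\}$ of $\mathbb{R}^2$ and a line $H=\mathbb{R}(\alpha a_1+\beta a_2)$, the reciprocal line is $H^{\underline{a}}=\mathbb{R}(\beta,-\alpha)$ in the reciprocal space $\mathbb{R}^2_{\bf k}$ (a copy of $\mathbb{R}^2$ with standard basis). For a line figure $F$, $F^{\underline{a}}$ is the union of the lines $H^{\underline{a}}$, $H$ a line of $F$. The slippage spectrum is ${\bf L}_{\rm slip}(\mathcal{G},\underline{a})=PSF(\mathcal{G})^{\underline{a}}$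 and the limit spectrum is ${\bf L}_{\rm lim}(\mathcal{G},\underline{a})=PLLF(\mathcal{G})^{\underline{a}}$. Multigrid tilings (de Bruijn, Beenker). A multigrid is a union of $r\ge2$ component grids, the $j$th consisting of the parallel lines $\{x:\langle x,n_j\rangle+\gamma_j=ks_j\}$, $k\in\mathbb{Z}$, with unit normals $n_j$ pairwise non-parallel, spacings $s_j>0$ and shifts $\gamma_j\in\mathbb{R}$. It is regular if no point lies on more than two of the lines. The associated parallelogram tiling $P$ is the dual tiling: fix edge vectors $d_j=\ell_jn_j$, $\ell_j>0$; each connected component of the complement of the multigrid gives a vertex $\sum_jK_j(x)d_j$, where $x$ is any point of the component and $K_j(x)=\lceil(\langle x,n_j\rangle+\gamma_j)/s_j\rceil$; components sharing a boundary segment on a line of the $j$th grid give vertices joined by an edge (a translate of $d_j$); and each intersection point of two grid lines gives a parallelogram tile. $\mathcal{G}_P$ is the bar-joint framework (a Delone framework) whose joints are the vertices of $P$ and whose bars are the edges of $P$. A ribbon of $P$ is a two-way infinite path of tiles, consecutive tiles sharing an edge, all the shared edges being translates of one another (these correspond to the lines of the multigrid). Each ribbon lies within a bounded distance of a unique line $H$ through the origin, and the ribbon figure $RF(P)$ is the union of the lines $H$ obtained in this way. *)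

theory Defs
  imports "HOL-Analysis.Analysis"
begin

section \<open>Bar-joint frameworks in the plane\<close>

record 'v framework =
  verts :: "'v set"
  bars :: "'v set set"
  place :: "'v \<Rightarrow> real^2"

definition bar_joint_framework :: "'v framework \<Rightarrow> bool" where
  "bar_joint_framework G \<longleftrightarrow>
     countable (verts G) \<and>
     (\<forall>e\<in>bars G. \<exists>v\<in>verts G. \<exists>w\<in>verts G. v \<noteq> w \<and> e = {v, w}) \<and>
     inj_on (place G) (verts G)"

definition joints :: "'v framework \<Rightarrow> (real^2) set" where
  "joints G = place G ` verts G"

definition relatively_dense :: "(real^2) set \<Rightarrow> bool" where
  "relatively_dense J \<longleftrightarrow> (\<exists>R. \<forall>x. \<exists>y\<in>J. dist x y \<le> R)"

definition Delone_set :: "(real^2) set \<Rightarrow> bool" where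
  "Delone_set J \<longleftrightarrow> uniform_discrete J \<and> relatively_dense J"

definition Delone_framework :: "'v framework \<Rightarrow> bool" where
  "Delone_framework G \<longleftrightarrow>
     bar_joint_framework G \<and> Delone_set (joints G) \<and>
     (\<exists>R. \<forall>v w. {v, w} \<in> bars G \<longrightarrow> norm (place G v - place G w) \<le> R)"

text \<open>Velocity fields are total functions on the plane of which only the values at the
  joints are ever used.\<close>

type_synonym velocity_field = "real^2 \<Rightarrow> complex^2"

definition infinitesimal_flex :: "'v framework \<Rightarrow> velocity_field \<Rightarrow> bool" where
  "infinitesimal_flex G u \<longleftrightarrow>
     (\<forall>v w. {v, w} \<in> bars G \<longrightarrow>
        (\<Sum>i\<in>UNIV. (u (place G v) - u (place G w)) $ i
                     * complex_of_real ((place G v - place G w) $ i)) = 0)"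

section \<open>Phase fields\<close>

definition plane_basis :: "real^2 \<Rightarrow> real^2 \<Rightarrow> bool" where
  "plane_basis t1 t2 \<longleftrightarrow> independent {t1, t2} \<and> span {t1, t2} = UNIV"

definition lattice_cell :: "real^2 \<Rightarrow> real^2 \<Rightarrow> int \<Rightarrow> int \<Rightarrow> (real^2) set" where
  "lattice_cell t1 t2 k1 k2 =
     {s1 *\<^sub>R t1 + s2 *\<^sub>R t2 | s1 s2.
        of_int k1 \<le> s1 \<and> s1 < of_int k1 + 1 \<and> of_int k2 \<le> s2 \<and> s2 < of_int k2 + 1}"

definition phase_field ::
    "complex \<Rightarrow> complex \<Rightarrow> real^2 \<Rightarrow> real^2 \<Rightarrow> real^2 \<Rightarrow> complex" where
  "phase_field \<omega>1 \<omega>2 t1 t2 x =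
     (THE z. \<exists>k1 k2. x \<in> lattice_cell t1 t2 k1 k2 \<and> z = \<omega>1 powi k1 * \<omega>2 powi k2)"

definition unit_subcell ::
    "real^2 \<Rightarrow> real^2 \<Rightarrow> nat \<Rightarrow> nat \<Rightarrow> nat \<Rightarrow> nat \<Rightarrow> (real^2) set" where
  "unit_subcell t1 t2 L M l m =
     {s1 *\<^sub>R t1 + s2 *\<^sub>R t2 | s1 s2.
        real l / real L \<le> s1 \<and> s1 < (real l + 1) / real L \<and>
        real m / real M \<le> s2 \<and> s2 < (real m + 1) / real M}"

text \<open>The field \<open>\<phi> \<otimes> B\<close>, for a unit cell velocity vector matrix \<open>B\<close> of size \<open>L \<times> M\<close>:
  the entries \<open>B l m\<close> with \<open>l < L\<close> and \<open>m < M\<close> are used.\<close>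

definition phase_tensor ::
    "complex \<Rightarrow> complex \<Rightarrow> real^2 \<Rightarrow> real^2 \<Rightarrow> nat \<Rightarrow> nat \<Rightarrow> (nat \<Rightarrow> nat \<Rightarrow> complex^2)
      \<Rightarrow> velocity_field" where
  "phase_tensor \<omega>1 \<omega>2 t1 t2 L M B x =
     (THE z. \<exists>k1 k2 l m. l < L \<and> m < M \<and>
        x \<in> (+) (of_int k1 *\<^sub>R t1 + of_int k2 *\<^sub>R t2) ` unit_subcell t1 t2 L M l m \<and>
        z = (\<omega>1 powi k1 * \<omega>2 powi k2) *s B l m)"

definition modulation :: "(real^2 \<Rightarrow> complex) \<Rightarrow> velocity_field \<Rightarrow> velocity_field" where
  "modulation \<phi> u = (\<lambda>x. \<phi> x *s u x)"

definition const_velocity :: "real^2 \<Rightarrow> velocity_field" where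
  "const_velocity b = (\<lambda>x. \<chi> i. complex_of_real (b $ i))"

definition mostly_close ::
    "(real^2) set \<Rightarrow> real \<Rightarrow> velocity_field \<Rightarrow> velocity_field \<Rightarrow> bool" where
  "mostly_close J \<epsilon> u z \<longleftrightarrow>
     (\<exists>N0::real. \<forall>N\<ge>N0. \<forall>c. let S = (+) c ` cbox (vec (- N)) (vec N) in
        real (card {x \<in> J \<inter> S. norm (u x - z x) > \<epsilon>}) < \<epsilon> * real (card (J \<inter> S)))"

section \<open>Line figures, slippage and localisation\<close>

definition origin_line :: "(real^2) set \<Rightarrow> bool" where
  "origin_line H \<longleftrightarrow> (\<exists>v. v \<noteq> 0 \<and> H = span {v})"

definition periodic_slippage_line :: "'v framework \<Rightarrow> (real^2) set \<Rightarrow> bool" where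
  "periodic_slippage_line G H \<longleftrightarrow>
     Delone_framework G \<and>
     (\<exists>t1 t2 b. H = span {t1} \<and> plane_basis t1 t2 \<and> b \<noteq> 0 \<and>
        (\<forall>\<epsilon>>0. \<exists>u. \<exists>M::nat. infinitesimal_flex G u \<and> M > 0 \<and>
           (\<forall>\<omega>\<in>sphere 0 1.
              infinitesimal_flex G (modulation (phase_field 1 \<omega> t1 (real M *\<^sub>R t2)) u)) \<and>
           (\<forall>\<omega>\<in>sphere 0 1.
              mostly_close (joints G) \<epsilon>
                (modulation (phase_field 1 \<omega> t1 (real M *\<^sub>R t2)) u)
                (modulation (phase_field 1 \<omega> t1 (real M *\<^sub>R t2)) (const_velocity b)))))"

definition PSF :: "'v framework \<Rightarrow> (real^2) set" where
  "PSF G = \<Union> {H. periodic_slippage_line G H}"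

definition periodic_localisation_line :: "'v framework \<Rightarrow> (real^2) set \<Rightarrow> bool" where
  "periodic_localisation_line G H \<longleftrightarrow>
     Delone_framework G \<and>
     (\<exists>t1 t2. H = span {t1} \<and> plane_basis t1 t2 \<and>
        (\<forall>\<epsilon>>0. \<exists>u. \<exists>\<omega>1\<in>sphere 0 1. \<exists>M1 M2 :: nat.
           infinitesimal_flex G u \<and> (\<exists>x\<in>joints G. u x \<noteq> 0) \<and> M1 > 0 \<and> M2 > 0 \<and>
           (\<forall>\<omega>\<in>sphere 0 1.
              infinitesimal_flex G
                (modulation (phase_field \<omega>1 \<omega> (real M1 *\<^sub>R t1) (real M2 *\<^sub>R t2)) u)) \<and>
           (\<exists>L M B. L > 0 \<and> M > 0 \<and>
             (\<forall>\<omega>\<in>sphere 0 1.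
                mostly_close (joints G) \<epsilon>
                  (modulation (phase_field \<omega>1 \<omega> (real M1 *\<^sub>R t1) (real M2 *\<^sub>R t2)) u)
                  (phase_tensor \<omega>1 \<omega> (real M1 *\<^sub>R t1) (real M2 *\<^sub>R t2) L M B)))))"

definition PLLF :: "'v framework \<Rightarrow> (real^2) set" where
  "PLLF G = \<Union> {H. periodic_localisation_line G H}"

definition reciprocal_line :: "real^2 \<Rightarrow> real^2 \<Rightarrow> (real^2) set \<Rightarrow> (real^2) set" where
  "reciprocal_line a1 a2 H =
     (THE K. \<exists>\<alpha> \<beta>. H = span {\<alpha> *\<^sub>R a1 + \<beta> *\<^sub>R a2} \<and> K = span {vector [\<beta>, - \<alpha>]})"

text \<open>A line figure is given by its union \<open>F\<close>; its lines are the lines through the origin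
  contained in \<open>F\<close>.\<close>

definition reciprocal_figure :: "real^2 \<Rightarrow> real^2 \<Rightarrow> (real^2) set \<Rightarrow> (real^2) set" where
  "reciprocal_figure a1 a2 F = \<Union> {reciprocal_line a1 a2 H | H. origin_line H \<and> H \<subseteq> F}"

definition slippage_spectrum :: "'v framework \<Rightarrow> real^2 \<Rightarrow> real^2 \<Rightarrow> (real^2) set" where
  "slippage_spectrum G a1 a2 = reciprocal_figure a1 a2 (PSF G)"

definition limit_spectrum :: "'v framework \<Rightarrow> real^2 \<Rightarrow> real^2 \<Rightarrow> (real^2) set" where
  "limit_spectrum G a1 a2 = reciprocal_figure a1 a2 (PLLF G)"

section \<open>Multigrid parallelogram tilings\<close>

text \<open>The component grids are indexed by \<open>j < grid_count \<Gamma>\<close>; the values of the other fields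
  at larger indices are irrelevant.\<close>

record multigrid =
  grid_count :: nat
  normal :: "nat \<Rightarrow> real^2"
  spacing :: "nat \<Rightarrow> real"
  shift :: "nat \<Rightarrow> real"

definition is_multigrid :: "multigrid \<Rightarrow> bool" where
  "is_multigrid \<Gamma> \<longleftrightarrow>
     grid_count \<Gamma> \<ge> 2 \<and>
     (\<forall>j<grid_count \<Gamma>. norm (normal \<Gamma> j) = 1 \<and> spacing \<Gamma> j > 0) \<and>
     (\<forall>i<grid_count \<Gamma>. \<forall>j<grid_count \<Gamma>. i \<noteq> j \<longrightarrow> span {normal \<Gamma> i} \<noteq> span {normal \<Gamma> j})"

definition grid_line :: "multigrid \<Rightarrow> nat \<Rightarrow> int \<Rightarrow> (real^2) set" where
  "grid_line \<Gamma> j k = {x. x \<bullet> normal \<Gamma> j + shift \<Gamma> j = of_int k * spacing \<Gamma> j}"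

definition grid_lines :: "multigrid \<Rightarrow> (real^2) set set" where
  "grid_lines \<Gamma> = {grid_line \<Gamma> j k | j k. j < grid_count \<Gamma>}"

definition regular_multigrid :: "multigrid \<Rightarrow> bool" where
  "regular_multigrid \<Gamma> \<longleftrightarrow>
     is_multigrid \<Gamma> \<and>
     \<not> (\<exists>x. \<exists>A\<in>grid_lines \<Gamma>. \<exists>B\<in>grid_lines \<Gamma>. \<exists>C\<in>grid_lines \<Gamma>.
           distinct [A, B, C] \<and> x \<in> A \<and> x \<in> B \<and> x \<in> C)"

definition grid_regions :: "multigrid \<Rightarrow> (real^2) set set" where
  "grid_regions \<Gamma> = components (- \<Union> (grid_lines \<Gamma>))"

text \<open>\<open>dual_point \<Gamma> len x\<close>, where \<open>len j\<close> is the length of the edge vector \<open>d\<^sub>j\<close>, is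
  \<open>\<Sum>\<^sub>j K\<^sub>j(x) d\<^sub>j\<close>; it is constant on each region.\<close>

definition dual_point :: "multigrid \<Rightarrow> (nat \<Rightarrow> real) \<Rightarrow> real^2 \<Rightarrow> real^2" where
  "dual_point \<Gamma> len x =
     (\<Sum>j<grid_count \<Gamma>.
        of_int \<lceil>(x \<bullet> normal \<Gamma> j + shift \<Gamma> j) / spacing \<Gamma> j\<rceil> *\<^sub>R (len j *\<^sub>R normal \<Gamma> j))"

definition tiling_vertices :: "multigrid \<Rightarrow> (nat \<Rightarrow> real) \<Rightarrow> (real^2) set" where
  "tiling_vertices \<Gamma> len = {dual_point \<Gamma> len x | x C. C \<in> grid_regions \<Gamma> \<and> x \<in> C}"

definition adjacent_regions :: "multigrid \<Rightarrow> (real^2) set \<Rightarrow> (real^2) set \<Rightarrow> bool" where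
  "adjacent_regions \<Gamma> C D \<longleftrightarrow>
     C \<in> grid_regions \<Gamma> \<and> D \<in> grid_regions \<Gamma> \<and> C \<noteq> D \<and>
     (\<exists>A\<in>grid_lines \<Gamma>. \<exists>a b. a \<noteq> b \<and> closed_segment a b \<subseteq> A \<inter> closure C \<inter> closure D)"

definition tiling_edges :: "multigrid \<Rightarrow> (nat \<Rightarrow> real) \<Rightarrow> (real^2) set set" where
  "tiling_edges \<Gamma> len =
     {{dual_point \<Gamma> len x, dual_point \<Gamma> len y} | x y C D. adjacent_regions \<Gamma> C D \<and> x \<in> C \<and> y \<in> D}"

text \<open>The tile of an intersection point \<open>x\<close> is the parallelogram whose corners are the
  vertices of the regions that meet at \<open>x\<close>.\<close>

definition tile_at :: "multigrid \<Rightarrow> (nat \<Rightarrow> real) \<Rightarrow> real^2 \<Rightarrow> (real^2) set" where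
  "tile_at \<Gamma> len x =
     convex hull {dual_point \<Gamma> len y | y C. C \<in> grid_regions \<Gamma> \<and> x \<in> closure C \<and> y \<in> C}"

definition tiling_tiles :: "multigrid \<Rightarrow> (nat \<Rightarrow> real) \<Rightarrow> (real^2) set set" where
  "tiling_tiles \<Gamma> len =
     {tile_at \<Gamma> len x | x A B. A \<in> grid_lines \<Gamma> \<and> B \<in> grid_lines \<Gamma> \<and> A \<noteq> B \<and> x \<in> A \<inter> B}"

definition tiling_framework :: "multigrid \<Rightarrow> (nat \<Rightarrow> real) \<Rightarrow> (real^2) framework" where
  "tiling_framework \<Gamma> len =
     \<lparr>verts = tiling_vertices \<Gamma> len, bars = tiling_edges \<Gamma> len, place = id\<rparr>"

text \<open>In a ribbon \<open>T\<close> of a family of tiles \<open>P\<close>, the set \<open>e i\<close> is the edge shared by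
  \<open>T i\<close> and \<open>T (i + 1)\<close>. Being a path, a ribbon does not revisit tiles.\<close>

definition ribbon :: "(real^2) set set \<Rightarrow> (int \<Rightarrow> (real^2) set) \<Rightarrow> bool" where
  "ribbon P T \<longleftrightarrow>
     range T \<subseteq> P \<and> inj T \<and>
     (\<exists>e. (\<forall>i. e i edge_of T i \<and> e i edge_of T (i + 1)) \<and>
          (\<forall>i j. \<exists>c. e j = (+) c ` e i))"

definition ribbon_figure :: "(real^2) set set \<Rightarrow> (real^2) set" where
  "ribbon_figure P =
     \<Union> {H. origin_line H \<and> (\<exists>T. ribbon P T \<and> (\<exists>R. \<forall>x\<in>\<Union> (range T). infdist x H \<le> R))}"

end

theory Submission
  imports Defs
begin

text \<open>
  The dual map \<open>dp\<close> sends a point \<open>x\<close> of the multigrid plane to \<open>\<Sum>\<^sub>j \<lceil>level j x\<rceil> d\<^sub>j\<close> and stays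
  within a bounded distance of the positive definite linear map
  \<open>A x = \<Sum>\<^sub>j (len j / spacing j) (x \<bullet> n\<^sub>j) n\<^sub>j\<close>. The ribbon of a line of the \<open>j\<close>th grid
  therefore follows the line spanned by \<open>A (perp n\<^sub>j)\<close>, and the three figures of the theorem are all
  shown to be the union of these lines.

  Across a tile the jump of an infinitesimal flex over two opposite edges is the same, so the
  jump of a flex is constant along each ribbon. If modulating \<open>u\<close> by all phases in the
  \<open>t\<^sub>2\<close>-direction yields flexes, then, comparing powers of the phase, the part of the modulated
  field supported in a single strip parallel to \<open>t\<^sub>1\<close> is a flex. When \<open>t\<^sub>1\<close> is not a ribbon
  direction, every ribbon leaves the strip, so all jumps of this flex vanish and it is zero;
  hence every localisation line is a ribbon line.
  Conversely, the velocity \<open>perp n\<^sub>j\<close> may be prescribed independently between any two consecutive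
  ribbons of the \<open>j\<close>th grid, which makes each ribbon line a slippage line.
\<close>

section \<open>Planar linear algebra\<close>

text \<open>The figures are compared by a cycle of inclusions: ribbon lines are slippage lines,
  slippage lines are localisation lines, and localisation lines are ribbon lines. Points replace
  regions throughout. The ceilings make \<open>dp\<close> meaningful on the grid lines as well,
  where it returns the vertex of the incident region on the lower side of every line through the
  point. An edge is thus named by one point \<open>x\<close> on a line of the \<open>j\<close>th
  grid, with ends \<open>dp x\<close> and \<open>dp x + edge_vec j\<close>, and a tile by one
  crossing; local facts reduce to comparing ceilings at \<open>x\<close> and at nearby points.
  Walking along a grid line changes \<open>dp\<close> only at crossings, and regularity lets each
  crossing involve just one other grid, so each change is one edge vector, up to sign, across one
  parallelogram. The obstacle is that the phase cells are cut by straight lines in the plane of the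
  tiling, while grid lines are straight only in the multigrid plane. The bounded distance from
  \<open>dp\<close> to a linear bijection links the two: whatever grows linearly along
  \<open>A (perp n\<^sub>j)\<close> also grows along the ribbon, and straight cuts can be matched
  with grid levels up to a bounded error.\<close>

definition perp :: "real^2 \<Rightarrow> real^2" where
  "perp v = vector [- v$2, v$1]"

lemma perp_nth [simp]: "perp v $ 1 = - v$2" "perp v $ 2 = v$1"
  by (simp_all add: perp_def)

lemma inner_2: "x \<bullet> y = x$1 * y$1 + x$2 * y$2" for x y :: "real^2"
  by (simp add: inner_vec_def sum_2)

lemma vec2_eq_iff: "x = y \<longleftrightarrow> x$1 = y$1 \<and> x$2 = y$2" for x y :: "'a^2"
  by (simp add: vec_eq_iff forall_2)

lemma perp_inner_swap: "perp u \<bullet> v = - (perp v \<bullet> u)"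
  by (simp add: inner_2)

lemma perp_inner_self [simp]: "perp u \<bullet> u = 0" "u \<bullet> perp u = 0"
  by (simp_all add: inner_2)

lemma perp_inner_perp [simp]: "perp u \<bullet> perp v = u \<bullet> v"
  by (simp add: inner_2)

lemma norm_perp [simp]: "norm (perp u) = norm u"
  by (simp add: norm_eq_sqrt_inner)

lemma perp_eq_0_iff [simp]: "perp u = 0 \<longleftrightarrow> u = 0"
  by (metis norm_eq_zero norm_perp)

lemma perp_0 [simp]: "perp 0 = 0"
  by simp

lemma perp_minus [simp]: "perp (- v) = - perp v"
  by (simp add: vec2_eq_iff)

text \<open>Cramer's rule: \<open>perp u \<bullet> v\<close> is the determinant of \<open>u\<close>
  and \<open>v\<close>, and pairing with \<open>perp v\<close> or \<open>perp u\<close> kills one of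
  the two components.\<close>

lemma perp_decomposition:
  assumes "perp u \<bullet> v \<noteq> 0"
  shows "p = (perp v \<bullet> p / (perp v \<bullet> u)) *\<^sub>R u + (perp u \<bullet> p / (perp u \<bullet> v)) *\<^sub>R v"
proof -
  have D: "u$1 * v$2 - u$2 * v$1 \<noteq> 0" using assms by (simp add: inner_2 algebra_simps)
  have e: "perp v \<bullet> u = - (u$1 * v$2 - u$2 * v$1)" "perp u \<bullet> v = u$1 * v$2 - u$2 * v$1"
    by (simp_all add: inner_2 algebra_simps)
  define X Y D where "X = perp v \<bullet> p" and "Y = perp u \<bullet> p" and "D = u$1 * v$2 - u$2 * v$1"
  have "D * p$1 = - X * u$1 + Y * v$1" "D * p$2 = - X * u$2 + Y * v$2"
    by (simp_all add: X_def Y_def D_def inner_2 algebra_simps)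
  then have "p$1 = X / (- D) * u$1 + Y / D * v$1" "p$2 = X / (- D) * u$2 + Y / D * v$2"
    using D unfolding D_def[symmetric] by (simp_all add: field_simps)
  then show ?thesis unfolding e X_def Y_def D_def by (simp add: vec2_eq_iff)
qed

lemma perp_coordinates_unique:
  assumes "perp u \<bullet> v \<noteq> 0" "a *\<^sub>R u + b *\<^sub>R v = a' *\<^sub>R u + b' *\<^sub>R v"
  shows "a = a'" "b = b'"
proof -
  have "perp v \<bullet> u \<noteq> 0" using assms(1) by (subst perp_inner_swap) simp
  moreover have "perp v \<bullet> (a *\<^sub>R u + b *\<^sub>R v) = perp v \<bullet> (a' *\<^sub>R u + b' *\<^sub>R v)"
    "perp u \<bullet> (a *\<^sub>R u + b *\<^sub>R v) = perp u \<bullet> (a' *\<^sub>R u + b' *\<^sub>R v)"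
    using assms(2) by simp_all
  ultimately show "a = a'" "b = b'" using assms(1) by (simp_all add: inner_add_right)
qed

lemma orthogonal_to_basis_imp_0:
  assumes "perp u \<bullet> v \<noteq> 0" "x \<bullet> u = 0" "x \<bullet> v = 0"
  shows "x = 0"
proof -
  have "x \<bullet> x = 0"
    by (subst (2) perp_decomposition[OF assms(1), of x]) (simp add: inner_add_right assms(2,3))
  then show ?thesis by simp
qed

lemma in_span_singleton_iff_perp:
  assumes "u \<noteq> 0"
  shows "v \<in> span {u} \<longleftrightarrow> perp u \<bullet> v = 0"
proof
  assume "v \<in> span {u}"
  then show "perp u \<bullet> v = 0" by (auto simp: span_singleton)
next
  assume 0: "perp u \<bullet> v = 0"
  have "perp u \<bullet> perp u \<noteq> 0" using assms by simp
  from perp_decomposition[OF this, of v] 0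
  have "v = (perp (perp u) \<bullet> v / (perp (perp u) \<bullet> u)) *\<^sub>R u" by simp
  then show "v \<in> span {u}" by (metis span_base span_mul singletonI)
qed

lemma span_singleton_eq_iff_perp:
  assumes "u \<noteq> 0" "v \<noteq> 0"
  shows "span {u} = span {v} \<longleftrightarrow> perp u \<bullet> v = 0"
proof
  assume "span {u} = span {v}"
  then show "perp u \<bullet> v = 0"
    using in_span_singleton_iff_perp[OF assms(1), of v] by (simp add: span_base)
next
  assume 0: "perp u \<bullet> v = 0"
  have "v \<in> span {u}" using in_span_singleton_iff_perp[OF assms(1)] 0 by simp
  moreover have "u \<in> span {v}"
    using in_span_singleton_iff_perp[OF assms(2)] 0 perp_inner_swap[of v u] by simp
  ultimately show "span {u} = span {v}"
    by (simp add: span_minimal subset_antisym)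
qed

text \<open>If the determinant vanishes, the span shrinks to the line of \<open>u\<close>, which
  misses \<open>perp u\<close>; otherwise Cramer's rule writes every point in \<open>u\<close> and
  \<open>v\<close>.\<close>

lemma plane_basis_iff_perp: "plane_basis u v \<longleftrightarrow> perp u \<bullet> v \<noteq> 0"
proof
  assume b: "plane_basis u v"
  show "perp u \<bullet> v \<noteq> 0"
  proof
    assume 0: "perp u \<bullet> v = 0"
    have sp: "span {u, v} = UNIV" and ind: "independent {u, v}"
      using b by (auto simp: plane_basis_def)
    have u: "u \<noteq> 0" using ind by (metis dependent_zero insertI1)
    have "v \<in> span {u}" using 0 u by (simp add: in_span_singleton_iff_perp)
    then have "span {u, v} = span {u}"
      by (metis insert_commute span_redundant)
    then have "perp u \<in> span {u}" using sp by simp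
    then show False using u in_span_singleton_iff_perp[OF u, of "perp u"] by simp
  qed
next
  assume n0: "perp u \<bullet> v \<noteq> 0"
  then have "u \<noteq> 0" "v \<noteq> 0" "u \<noteq> v" by auto
  then have "independent {u, v}"
    using n0 in_span_singleton_iff_perp[of v u] perp_inner_swap[of u v]
    by (simp add: independent_insert)
  moreover have "p \<in> span {u, v}" for p
    by (subst perp_decomposition[OF n0]) (intro span_add span_mul span_base; simp)
  ultimately show "plane_basis u v" unfolding plane_basis_def by blast
qed

text \<open>The pairing of the flex condition, between complex velocities and real directions. It is
  complex linear in the velocity, so phase factors can be pulled out of it.\<close>

definition cdot :: "complex^2 \<Rightarrow> real^2 \<Rightarrow> complex" where
  "cdot z v = (\<Sum>i\<in>UNIV. z $ i * complex_of_real (v $ i))"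

lemma cdot_eq: "cdot z v = z$1 * of_real (v$1) + z$2 * of_real (v$2)"
  by (simp add: cdot_def sum_2)

lemma cdot_simps [simp]:
  "cdot 0 v = 0" "cdot (a - b) v = cdot a v - cdot b v" "cdot (c *s a) v = c * cdot a v"
  "cdot z (- v) = - cdot z v" "cdot z (c' *\<^sub>R v) = of_real c' * cdot z v"
  by (simp_all add: cdot_eq algebra_simps)

lemma cdot_eq_0_imp:
  assumes "perp u \<bullet> v \<noteq> 0" "cdot z u = 0" "cdot z v = 0"
  shows "z = 0"
proof -
  have D: "complex_of_real (u$1 * v$2 - u$2 * v$1) \<noteq> 0"
    using assms by (simp only: of_real_eq_0_iff) (simp add: inner_2 algebra_simps)
  have "z$1 * complex_of_real (u$1 * v$2 - u$2 * v$1) = cdot z u * of_real (v$2) - cdot z v * of_real (u$2)"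
    "z$2 * complex_of_real (u$1 * v$2 - u$2 * v$1) = cdot z v * of_real (u$1) - cdot z u * of_real (v$1)"
    by (simp_all add: cdot_eq algebra_simps)
  then have "z$1 = 0" "z$2 = 0" using D assms by (simp_all only: mult_eq_0_iff) simp_all
  then show ?thesis by (simp add: vec2_eq_iff)
qed

text \<open>An endpoint of the closed unit interval below \<open>k\<close> may itself have ceiling
  \<open>k - 1\<close>, but the midpoint of two different points of it cannot. Hence the midpoint of
  a segment shared by two regions serves as base point of their edge.\<close>

lemma ceiling_midpoint:
  fixes a b :: real
  assumes "a \<noteq> b" "of_int k - 1 \<le> a" "a \<le> of_int k" "of_int k - 1 \<le> b" "b \<le> of_int k"
  shows "\<lceil>(a + b) / 2\<rceil> = k"
  using assms by (cases "a < b") (simp_all add: ceiling_eq_iff)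

section \<open>Phase fields\<close>

lemma in_lattice_cell_iff:
  assumes "perp t1 \<bullet> t2 \<noteq> 0"
  shows "p \<in> lattice_cell t1 t2 k1 k2 \<longleftrightarrow>
    k1 = \<lfloor>perp t2 \<bullet> p / (perp t2 \<bullet> t1)\<rfloor> \<and> k2 = \<lfloor>perp t1 \<bullet> p / (perp t1 \<bullet> t2)\<rfloor>"
proof
  assume "p \<in> lattice_cell t1 t2 k1 k2"
  then obtain s1 s2 where p: "p = s1 *\<^sub>R t1 + s2 *\<^sub>R t2"
    and k: "of_int k1 \<le> s1" "s1 < of_int k1 + 1" "of_int k2 \<le> s2" "s2 < of_int k2 + 1"
    unfolding lattice_cell_def by blast
  have "(perp t2 \<bullet> p / (perp t2 \<bullet> t1)) *\<^sub>R t1 + (perp t1 \<bullet> p / (perp t1 \<bullet> t2)) *\<^sub>R t2 = s1 *\<^sub>R t1 + s2 *\<^sub>R t2"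
    using perp_decomposition[OF assms, of p] p by simp
  from perp_coordinates_unique[OF assms this] k
  have "\<lfloor>perp t2 \<bullet> p / (perp t2 \<bullet> t1)\<rfloor> = k1" "\<lfloor>perp t1 \<bullet> p / (perp t1 \<bullet> t2)\<rfloor> = k2"
    by (auto simp: floor_eq_iff)
  then show "k1 = \<lfloor>perp t2 \<bullet> p / (perp t2 \<bullet> t1)\<rfloor> \<and> k2 = \<lfloor>perp t1 \<bullet> p / (perp t1 \<bullet> t2)\<rfloor>"
    by simp
next
  assume k: "k1 = \<lfloor>perp t2 \<bullet> p / (perp t2 \<bullet> t1)\<rfloor> \<and> k2 = \<lfloor>perp t1 \<bullet> p / (perp t1 \<bullet> t2)\<rfloor>"
  show "p \<in> lattice_cell t1 t2 k1 k2"
    unfolding lattice_cell_def mem_Collect_eq k[THEN conjunct1] k[THEN conjunct2]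
    by (intro exI conjI, rule perp_decomposition[OF assms]) linarith+
qed

lemma phase_field_eq:
  assumes "perp t1 \<bullet> t2 \<noteq> 0"
  shows "phase_field \<omega>1 \<omega>2 t1 t2 p =
    \<omega>1 powi \<lfloor>perp t2 \<bullet> p / (perp t2 \<bullet> t1)\<rfloor> * \<omega>2 powi \<lfloor>perp t1 \<bullet> p / (perp t1 \<bullet> t2)\<rfloor>"
  by (simp add: phase_field_def in_lattice_cell_iff[OF assms] ex_simps)

text \<open>Distinct powers are linearly independent on the unit circle: \<open>\<omega> = 1\<close>
  gives \<open>X = Y\<close>, and a phase whose power \<open>a - b\<close> is -1 gives
  \<open>X = - Y\<close>.\<close>

lemma phase_polynomial_eq_0:
  fixes X Y :: complex
  assumes eq: "\<And>\<omega>. norm \<omega> = 1 \<Longrightarrow> \<omega> powi a * X = \<omega> powi b * Y" and "a \<noteq> b"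
  shows "X = 0" "Y = 0"
proof -
  have XY: "X = Y" using eq[of 1] by simp
  let ?w = "cis (pi / of_int (a - b))"
  have "?w powi (a - b) = -1" using \<open>a \<noteq> b\<close> by (simp only: cis_power_int) simp
  moreover have "?w powi a = ?w powi (a - b) * ?w powi b"
    by (subst power_int_add[symmetric]) auto
  ultimately have "- (?w powi b * X) = ?w powi b * X" using eq[of ?w] XY by simp
  then have "?w powi b * X = 0" by (simp add: neg_eq_iff_add_eq_0)
  then show "X = 0" by simp
  then show "Y = 0" using XY by simp
qed

section \<open>Delone sets and mostly close fields\<close>

lemma mem_square_iff:
  "x \<in> (+) c ` cbox (vec (- N)) (vec N) \<longleftrightarrow> \<bar>x$1 - c$1\<bar> \<le> N \<and> \<bar>x$2 - c$2\<bar> \<le> N" for x c :: "real^2"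
proof -
  have "x \<in> (+) c ` cbox (vec (- N)) (vec N) \<longleftrightarrow> x - c \<in> cbox (vec (- N)) (vec N)"
    by (auto simp: image_iff algebra_simps intro: bexI[of _ "x - c"])
  then show ?thesis by (auto simp: mem_box_cart forall_2)
qed

lemma dist_square_le:
  fixes x c :: "real^2"
  assumes "x \<in> (+) c ` cbox (vec (- N)) (vec N)"
  shows "norm (x - c) \<le> 2 * N"
  using assms norm_le_l1_cart[of "x - c"] by (simp add: mem_square_iff sum_2)

text \<open>Take a square lattice of mesh \<open>3 * R\<close> around \<open>c\<close> and move each
  of its points to a point of \<open>J\<close> within \<open>R\<close>. The images stay distinct, as
  each coordinate moves by at most \<open>R\<close>, and they stay in the square if they start at
  distance at least \<open>R\<close> from its boundary.\<close>

lemma card_Delone_square_ge: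
  assumes "relatively_dense J" and "uniform_discrete J"
  obtains a N0 where "a > 0"
    "\<And>N c. N \<ge> N0 \<Longrightarrow> a * N\<^sup>2 \<le> real (card (J \<inter> (+) c ` cbox (vec (- N)) (vec N)))"
proof -
  obtain R0 where R0: "\<forall>x. \<exists>y\<in>J. dist x y \<le> R0" using assms by (auto simp: relatively_dense_def)
  define R where "R = \<bar>R0\<bar> + 1"
  have R: "R > 0" by (simp add: R_def)
  have "\<forall>x. \<exists>y. y \<in> J \<and> dist x y \<le> R"
    using R0 unfolding R_def by (metis abs_ge_self add_increasing2 order_trans zero_le_one)
  then obtain g where g: "\<And>x. g x \<in> J" "\<And>x. dist x (g x) \<le> R" by metis
  \<comment> \<open>For \<open>N \<ge> 2 * R\<close> the margin costs at most half of
    \<open>N\<close>, so at least \<open>N / (6 * R)\<close> lattice points fit in each direction;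
    squaring gives the factor 36.\<close>
  show ?thesis
  proof (rule that[of "1 / (36 * R\<^sup>2)" "2 * R"])
    show "1 / (36 * R\<^sup>2) > 0" using R by simp
    fix N and c :: "real^2" assume N: "2 * R \<le> N"
    let ?S = "J \<inter> (+) c ` cbox (vec (- N)) (vec N)"
    have "bounded ?S" by (intro bounded_Int disjI2 bounded_translation bounded_cbox)
    moreover have "uniform_discrete ?S" using assms(2) unfolding uniform_discrete_def by blast
    ultimately have fin: "finite ?S" using uniform_discrete_finite_iff by blast
    define n where "n = \<lfloor>(N - R) / (3 * R)\<rfloor>"
    have n0: "n \<ge> 0" using N R by (simp add: n_def)
    define q where "q ab = c + (3 * R) *\<^sub>R vector [real_of_int (fst ab), real_of_int (snd ab)]" for ab :: "int \<times> int"
    let ?I = "{-n..n} \<times> {-n..n}"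
    have "of_int n \<le> (N - R) / (3 * R)" unfolding n_def by linarith
    then have nR: "3 * R * of_int n \<le> N - R" using R by (simp add: field_simps)
    have comp: "\<bar>g x $ i - x $ i\<bar> \<le> R" for x i
      using component_le_norm_cart[of "g x - x" i] g(2)[of x] by (simp add: dist_norm norm_minus_commute)
    have bnd: "\<bar>3 * R * real_of_int k\<bar> \<le> N - R" if "k \<in> {-n..n}" for k
    proof -
      have "\<bar>real_of_int k\<bar> \<le> of_int n" using that by auto
      then have "3 * R * \<bar>real_of_int k\<bar> \<le> 3 * R * of_int n" using R by (intro mult_left_mono) auto
      moreover have "\<bar>3 * R * real_of_int k\<bar> = 3 * R * \<bar>real_of_int k\<bar>" using R by (simp add: abs_mult)
      ultimately show ?thesis using nR by linarith
    qed
    have "inj_on (g \<circ> q) ?I"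
    proof (rule inj_onI)
      fix x y assume xy: "(g \<circ> q) x = (g \<circ> q) y"
      have eq: "k = l" if "\<bar>3 * R * real_of_int k - 3 * R * real_of_int l\<bar> \<le> 2 * R" for k l
      proof (rule ccontr)
        assume "k \<noteq> l"
        then have "1 \<le> \<bar>real_of_int (k - l)\<bar>" by linarith
        then have "3 * R * 1 \<le> 3 * R * \<bar>real_of_int (k - l)\<bar>" using R by (intro mult_left_mono) auto
        also have "\<dots> = \<bar>3 * R * real_of_int k - 3 * R * real_of_int l\<bar>"
          using R by (simp add: abs_mult right_diff_distrib[symmetric])
        finally show False using that R by simp
      qed
      have "\<bar>q x $ i - q y $ i\<bar> \<le> 2 * R" for i
        using comp[of "q x" i] comp[of "q y" i] xy by simp
      from this[of 1] this[of 2] have "fst x = fst y" "snd x = snd y"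
        by (auto intro!: eq simp: q_def)
      then show "x = y" by (simp add: prod_eq_iff)
    qed
    moreover have "(g \<circ> q) ` ?I \<subseteq> ?S"
    proof (rule image_subsetI)
      fix x assume x: "x \<in> ?I"
      have "q x $ 1 = c $ 1 + 3 * R * real_of_int (fst x)" "q x $ 2 = c $ 2 + 3 * R * real_of_int (snd x)"
        by (simp_all add: q_def)
      moreover have "fst x \<in> {-n..n}" "snd x \<in> {-n..n}" using x by auto
      ultimately have "\<bar>g (q x) $ 1 - c $ 1\<bar> \<le> N" "\<bar>g (q x) $ 2 - c $ 2\<bar> \<le> N"
        using comp[of "q x" 1] comp[of "q x" 2] bnd[of "fst x"] bnd[of "snd x"] by linarith+
      then show "(g \<circ> q) x \<in> ?S" by (simp add: g(1) mem_square_iff)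
    qed
    ultimately have "card ?I \<le> card ?S" using fin by (rule card_inj_on_le)
    then have I: "real (card ?I) \<le> real (card ?S)" by (rule of_nat_mono)
    have "N / (6 * R) \<le> (N - R) / (3 * R)" using N R by (simp add: field_simps)
    also have "\<dots> \<le> of_int n + 1" unfolding n_def by linarith
    finally have "N / (6 * R) \<le> 2 * of_int n + 1" using n0 by linarith
    then have "(N / (6 * R))\<^sup>2 \<le> (2 * of_int n + 1)\<^sup>2" using N R by (intro power_mono) auto
    also have "\<dots> = real (card ?I)" using n0 by (simp add: card_cartesian_product power2_eq_square)
    also note I
    finally show "1 / (36 * R\<^sup>2) * N\<^sup>2 \<le> real (card ?S)"
      by (simp add: power_divide power_mult_distrib)
  qed
qed

section \<open>Counting the points of a Delone set in sparse bands\<close>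

lemma perp_pythagoras: "(w \<bullet> z)\<^sup>2 + (perp w \<bullet> z)\<^sup>2 = (norm w)\<^sup>2 * (norm z)\<^sup>2"
  unfolding power2_norm_eq_inner inner_2 by (simp add: power2_eq_square algebra_simps)

lemma abs_floor_diff_le: "\<bar>x - y\<bar> \<le> z \<Longrightarrow> \<bar>\<lfloor>x\<rfloor> - \<lfloor>y\<rfloor>\<bar> \<le> \<lceil>z\<rceil> + 1" for x y z :: real
  by linarith

text \<open>Bands of fixed width around the lines \<open>w \<bullet> x = m M\<close> carry a fraction \<open>O(1 / M)\<close> of a
  Delone set: cut the bands into small boxes, each containing at most one point.\<close>

lemma Delone_sparse_bands:
  assumes "Delone_set J" and w: "w \<noteq> 0" and W: "W \<ge> 0" and \<epsilon>: "\<epsilon> > 0"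
  obtains M :: nat and N0 where "M > 0"
    "\<And>N c. N \<ge> N0 \<Longrightarrow>
      real (card {x \<in> J \<inter> (+) c ` cbox (vec (- N)) (vec N). \<exists>m::int. \<bar>w \<bullet> x - of_int m * real M\<bar> \<le> W})
        < \<epsilon> * real (card (J \<inter> (+) c ` cbox (vec (- N)) (vec N)))"
proof -
  obtain e where e: "e > 0" "\<And>x y. x \<in> J \<Longrightarrow> y \<in> J \<Longrightarrow> dist x y < e \<Longrightarrow> x = y"
    using assms(1) unfolding Delone_set_def uniform_discrete_def by blast
  obtain a N1 where a: "a > 0"
    "\<And>N c. N \<ge> N1 \<Longrightarrow> a * N\<^sup>2 \<le> real (card (J \<inter> (+) c ` cbox (vec (- N)) (vec N)))"
    using card_Delone_square_ge assms(1) unfolding Delone_set_def by metis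
  \<comment> \<open>Small boxes are cut in the coordinates \<open>w \<bullet> x\<close> and
    \<open>perp w \<bullet> x\<close>, which stretch lengths by \<open>norm w\<close>. With this
    side \<open>h\<close> two points in one box are closer than \<open>e\<close>, because
    \<open>2 * h\<^sup>2\<close> is at most \<open>(norm w * e)\<^sup>2\<close>.\<close>
  define h where "h = e * norm w / 2"
  \<comment> \<open>A point of the square is within \<open>2 * N\<close> of \<open>c\<close>, so
    both coordinates vary by at most \<open>\<kappa> * N\<close> over the square.\<close>
  define \<kappa> where "\<kappa> = 2 * norm w"
  define B where "B = \<lceil>W / h\<rceil> + 1"
  \<comment> \<open>The product of three counts: bands meeting the square, at most
    \<open>(2 * \<kappa> + 7) * N / M\<close>; boxes across one band, at most
    \<open>2 * B + 1\<close>; boxes along it, at most \<open>(2 * \<kappa> / h + 5) * N\<close>.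
    Then \<open>M\<close> is chosen to bring \<open>C / M\<close> below \<open>\<epsilon>\<close>
    times the lower density \<open>a\<close>.\<close>
  define C where "C = (2 * \<kappa> + 7) * ((2 * of_int B + 1) * (2 * \<kappa> / h + 5))"
  have h: "h > 0" using e w by (simp add: h_def)
  have \<kappa>: "\<kappa> > 0" using w by (simp add: \<kappa>_def)
  have "W / h \<ge> 0" using W h by simp
  then have B: "B \<ge> 0" unfolding B_def by linarith
  have C: "C > 0" unfolding C_def using \<kappa> h B by (intro mult_pos_pos add_pos_pos add_nonneg_pos) auto
  obtain M :: nat where M: "C / (\<epsilon> * a) < real M" using reals_Archimedean2 by blast
  have "0 < C / (\<epsilon> * a)" using C \<epsilon> a by simp
  then have M0: "real M > 0" using M by linarith
  define N0 where "N0 = max (max N1 1) (max (real M) W)"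
  show ?thesis
  proof (rule that[of M N0])
    show "M > 0" using M0 by simp
    fix N c assume "N0 \<le> N"
    then have N: "N1 \<le> N" "1 \<le> N" "real M \<le> N" "W \<le> N" by (auto simp: N0_def)
    let ?S = "J \<inter> (+) c ` cbox (vec (- N)) (vec N)"
    let ?T = "{x \<in> ?S. \<exists>m::int. \<bar>w \<bullet> x - of_int m * real M\<bar> \<le> W}"
    define m where "m x = (SOME m::int. \<bar>w \<bullet> x - of_int m * real M\<bar> \<le> W)" for x
    have m: "\<bar>w \<bullet> x - of_int (m x) * real M\<bar> \<le> W" if "x \<in> ?T" for x
      unfolding m_def by (rule someI_ex) (use that in blast)
    \<comment> \<open>The code of a point: its band, the box across that band counted from the
      centre line of the band, and the box along it. The subtracted floors make the three ranges
      independent of the position of the square.\<close>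
    define F where "F x = (m x - \<lfloor>w \<bullet> c / real M\<rfloor>, \<lfloor>w \<bullet> x / h\<rfloor> - \<lfloor>of_int (m x) * real M / h\<rfloor>,
        \<lfloor>perp w \<bullet> x / h\<rfloor> - \<lfloor>perp w \<bullet> c / h\<rfloor>)" for x
    define Q where "Q = \<lceil>(W + \<kappa> * N) / real M\<rceil> + 1"
    define D where "D = \<lceil>\<kappa> * N / h\<rceil> + 1"
    have "0 \<le> (W + \<kappa> * N) / real M" "0 \<le> \<kappa> * N / h" using W \<kappa> N h M0 by simp_all
    then have QD: "Q \<ge> 0" "D \<ge> 0" unfolding Q_def D_def by linarith+
    have "inj_on F ?T"
    proof (rule inj_onI)
      fix x y assume xy: "x \<in> ?T" "y \<in> ?T" "F x = F y"
      then have "\<lfloor>w \<bullet> x / h\<rfloor> = \<lfloor>w \<bullet> y / h\<rfloor>" "\<lfloor>perp w \<bullet> x / h\<rfloor> = \<lfloor>perp w \<bullet> y / h\<rfloor>"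
        by (auto simp: F_def)
      then have "\<bar>w \<bullet> x / h - w \<bullet> y / h\<bar> < 1" "\<bar>perp w \<bullet> x / h - perp w \<bullet> y / h\<bar> < 1"
        by linarith+
      moreover have "w \<bullet> x / h - w \<bullet> y / h = w \<bullet> (x - y) / h"
        "perp w \<bullet> x / h - perp w \<bullet> y / h = perp w \<bullet> (x - y) / h"
        by (simp_all add: inner_diff_right diff_divide_distrib)
      ultimately have "\<bar>w \<bullet> (x - y)\<bar> < h" "\<bar>perp w \<bullet> (x - y)\<bar> < h" using h by (simp_all add: field_simps)
      moreover have "z\<^sup>2 < h\<^sup>2" if "\<bar>z\<bar> < h" for z using power_strict_mono[OF that, of 2] by simp
      ultimately have "(w \<bullet> (x - y))\<^sup>2 < h\<^sup>2" "(perp w \<bullet> (x - y))\<^sup>2 < h\<^sup>2" by blast+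
      then have "(norm w)\<^sup>2 * (norm (x - y))\<^sup>2 < 2 * h\<^sup>2" using perp_pythagoras[of w "x - y"] by linarith
      also have "2 * h\<^sup>2 \<le> (norm w)\<^sup>2 * e\<^sup>2" by (simp add: h_def power_mult_distrib power_divide)
      finally have "(norm (x - y))\<^sup>2 < e\<^sup>2" using w by simp
      then have "norm (x - y) < e" using e(1) by (meson less_imp_le power_less_imp_less_base)
      then show "x = y" using e(2)[of x y] xy by (simp add: dist_norm)
    qed
    moreover have "F ` ?T \<subseteq> {-Q..Q} \<times> {-B..B} \<times> {-D..D}"
    proof (rule image_subsetI)
      fix x assume x: "x \<in> ?T"
      have nx: "norm (x - c) \<le> 2 * N" using x by (intro dist_square_le) auto
      have "\<bar>w \<bullet> (x - c)\<bar> \<le> norm w * norm (x - c)" by (rule Cauchy_Schwarz_ineq2)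
      also have "\<dots> \<le> \<kappa> * N" using mult_left_mono[OF nx, of "norm w"] by (simp add: \<kappa>_def)
      finally have 1: "\<bar>w \<bullet> x - w \<bullet> c\<bar> \<le> \<kappa> * N" by (simp add: inner_diff_right)
      have "\<bar>perp w \<bullet> (x - c)\<bar> \<le> norm (perp w) * norm (x - c)" by (rule Cauchy_Schwarz_ineq2)
      also have "\<dots> \<le> \<kappa> * N" using mult_left_mono[OF nx, of "norm w"] by (simp add: \<kappa>_def)
      finally have 2: "\<bar>perp w \<bullet> x - perp w \<bullet> c\<bar> \<le> \<kappa> * N" by (simp add: inner_diff_right)
      have "\<bar>of_int (m x) * real M - w \<bullet> c\<bar> \<le> W + \<kappa> * N" using m[OF x] 1 by linarith
      then have "\<bar>of_int (m x) * real M - w \<bullet> c\<bar> / real M \<le> (W + \<kappa> * N) / real M"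
        using M0 by (intro divide_right_mono) auto
      moreover have "\<bar>of_int (m x) * real M - w \<bullet> c\<bar> / real M = \<bar>(of_int (m x) * real M - w \<bullet> c) / real M\<bar>" using M0 by simp
      moreover have "(of_int (m x) * real M - w \<bullet> c) / real M = of_int (m x) - w \<bullet> c / real M"
        using M0 by (simp add: field_simps)
      ultimately have "\<bar>of_int (m x) - w \<bullet> c / real M\<bar> \<le> (W + \<kappa> * N) / real M" by simp
      from abs_floor_diff_le[OF this] have f1: "\<bar>m x - \<lfloor>w \<bullet> c / real M\<rfloor>\<bar> \<le> Q" by (simp add: Q_def)
      have "\<bar>w \<bullet> x / h - of_int (m x) * real M / h\<bar> \<le> W / h"
        using divide_right_mono[OF m[OF x], of h] h by (simp flip: diff_divide_distrib)
      from abs_floor_diff_le[OF this] have f2: "\<bar>\<lfloor>w \<bullet> x / h\<rfloor> - \<lfloor>of_int (m x) * real M / h\<rfloor>\<bar> \<le> B" by (simp add: B_def)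
      have "\<bar>perp w \<bullet> x / h - perp w \<bullet> c / h\<bar> \<le> \<kappa> * N / h"
        using divide_right_mono[OF 2, of h] h by (simp flip: diff_divide_distrib)
      from abs_floor_diff_le[OF this] have f3: "\<bar>\<lfloor>perp w \<bullet> x / h\<rfloor> - \<lfloor>perp w \<bullet> c / h\<rfloor>\<bar> \<le> D" by (simp add: D_def)
      show "F x \<in> {-Q..Q} \<times> {-B..B} \<times> {-D..D}"
        using f1 f2 f3 by (auto simp: F_def)
    qed
    ultimately have "card ?T \<le> card ({-Q..Q} \<times> {-B..B} \<times> {-D..D})"
      by (intro card_inj_on_le) auto
    then have "real (card ?T) \<le> real (card ({-Q..Q} \<times> {-B..B} \<times> {-D..D}))" by (rule of_nat_mono)
    also have "\<dots> = (2 * of_int Q + 1) * ((2 * of_int B + 1) * (2 * of_int D + 1))"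
      using QD B by (simp add: card_cartesian_product)
    also have "\<dots> \<le> ((2 * \<kappa> + 7) * (N / real M)) * ((2 * of_int B + 1) * ((2 * \<kappa> / h + 5) * N))"
    proof (intro mult_mono)
      define X where "X = N / real M"
      have "of_int Q \<le> (W + \<kappa> * N) / real M + 2" unfolding Q_def by linarith
      also have "(W + \<kappa> * N) / real M \<le> (N + \<kappa> * N) / real M" using N M0 by (intro divide_right_mono) auto
      also have "(N + \<kappa> * N) / real M = (1 + \<kappa>) * X" by (simp add: X_def algebra_simps add_divide_distrib)
      finally have "of_int Q \<le> (1 + \<kappa>) * X + 2" by simp
      moreover have "1 \<le> X" using N M0 by (simp add: X_def)
      ultimately have "2 * of_int Q + 1 \<le> (2 * \<kappa> + 7) * X" by (simp add: algebra_simps)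
      then show "2 * of_int Q + 1 \<le> (2 * \<kappa> + 7) * (N / real M)" by (simp only: X_def)
      have "of_int D \<le> \<kappa> * N / h + 2" unfolding D_def by linarith
      moreover have "(2 * \<kappa> / h + 5) * N = 2 * (\<kappa> * N / h) + 5 * N" by (simp add: algebra_simps)
      ultimately show "2 * of_int D + 1 \<le> (2 * \<kappa> / h + 5) * N" using N by linarith
    qed (use QD B N M0 \<kappa> in auto)
    also have "\<dots> = C / real M * N\<^sup>2" by (simp add: C_def power2_eq_square)
    also have "\<dots> < (\<epsilon> * a) * N\<^sup>2"
    proof (rule mult_strict_right_mono)
      show "C / real M < \<epsilon> * a" using M M0 \<epsilon> a by (simp add: field_simps)
    qed (use N in simp)
    also have "\<dots> \<le> \<epsilon> * real (card ?S)" using mult_left_mono[OF a(2)[OF N(1), of c], of \<epsilon>] \<epsilon> by (simp add: mult.assoc)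
    finally show "real (card ?T) < \<epsilon> * real (card ?S)" .
  qed
qed

text \<open>The bridge between the two comparison fields: a modulated constant field, as in
  slippage, is the tensor field of a 1 by 1 matrix, as in localisation, since the only subcell is
  the whole cell.\<close>

lemma phase_tensor_constant:
  assumes basis: "perp t1 \<bullet> t2 \<noteq> 0"
  shows "phase_tensor \<omega>1 \<omega> t1 t2 1 1 (\<lambda>_ _. \<beta>) = modulation (phase_field \<omega>1 \<omega> t1 t2) (\<lambda>_. \<beta>)"
proof
  fix x
  have "(+) (of_int k1 *\<^sub>R t1 + of_int k2 *\<^sub>R t2) ` unit_subcell t1 t2 1 1 0 0 = lattice_cell t1 t2 k1 k2" for k1 k2
  proof
    show "(+) (of_int k1 *\<^sub>R t1 + of_int k2 *\<^sub>R t2) ` unit_subcell t1 t2 1 1 0 0 \<subseteq> lattice_cell t1 t2 k1 k2"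
    proof (rule image_subsetI)
      fix y assume "y \<in> unit_subcell t1 t2 1 1 0 0"
      then obtain s1 s2 where "y = s1 *\<^sub>R t1 + s2 *\<^sub>R t2" "0 \<le> s1" "s1 < 1" "0 \<le> s2" "s2 < 1"
        by (auto simp: unit_subcell_def)
      then show "of_int k1 *\<^sub>R t1 + of_int k2 *\<^sub>R t2 + y \<in> lattice_cell t1 t2 k1 k2"
        unfolding lattice_cell_def mem_Collect_eq
        by (intro exI[of _ "of_int k1 + s1"] exI[of _ "of_int k2 + s2"]) (simp add: algebra_simps)
    qed
    show "lattice_cell t1 t2 k1 k2 \<subseteq> (+) (of_int k1 *\<^sub>R t1 + of_int k2 *\<^sub>R t2) ` unit_subcell t1 t2 1 1 0 0"
    proof
      fix y assume "y \<in> lattice_cell t1 t2 k1 k2"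
      then obtain s1 s2 where y: "y = s1 *\<^sub>R t1 + s2 *\<^sub>R t2" "of_int k1 \<le> s1" "s1 < of_int k1 + 1"
        "of_int k2 \<le> s2" "s2 < of_int k2 + 1"
        unfolding lattice_cell_def by blast
      show "y \<in> (+) (of_int k1 *\<^sub>R t1 + of_int k2 *\<^sub>R t2) ` unit_subcell t1 t2 1 1 0 0"
      proof (rule image_eqI)
        show "y = of_int k1 *\<^sub>R t1 + of_int k2 *\<^sub>R t2 + ((s1 - of_int k1) *\<^sub>R t1 + (s2 - of_int k2) *\<^sub>R t2)"
          using y by (simp add: algebra_simps)
        show "(s1 - of_int k1) *\<^sub>R t1 + (s2 - of_int k2) *\<^sub>R t2 \<in> unit_subcell t1 t2 1 1 0 0"
          unfolding unit_subcell_def mem_Collect_eq using y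
          by (intro exI[of _ "s1 - of_int k1"] exI[of _ "s2 - of_int k2"]) auto
      qed
    qed
  qed
  then show "phase_tensor \<omega>1 \<omega> t1 t2 1 1 (\<lambda>_ _. \<beta>) x = modulation (phase_field \<omega>1 \<omega> t1 t2) (\<lambda>_. \<beta>) x"
    by (simp add: phase_tensor_def modulation_def phase_field_eq[OF basis] in_lattice_cell_iff[OF basis])
qed

lemma mostly_close_mono:
  assumes "mostly_close J \<delta> u z" "\<delta> \<le> \<epsilon>"
  shows "mostly_close J \<epsilon> u z"
proof -
  obtain N0 where N0: "\<And>N c. N \<ge> N0 \<Longrightarrow>
      real (card {x \<in> J \<inter> (+) c ` cbox (vec (- N)) (vec N). norm (u x - z x) > \<delta>})
        < \<delta> * real (card (J \<inter> (+) c ` cbox (vec (- N)) (vec N)))"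
    using assms(1) unfolding mostly_close_def Let_def by blast
  show ?thesis unfolding mostly_close_def Let_def
  proof (intro exI[of _ N0] allI impI)
    fix N c assume N: "N0 \<le> N"
    let ?S = "J \<inter> (+) c ` cbox (vec (- N)) (vec N)"
    \<comment> \<open>An infinite set has \<open>card\<close> 0, so the strict bound in the
      hypothesis also yields the finiteness that monotonicity of \<open>card\<close>
      requires.\<close>
    have "card ?S \<noteq> 0"
    proof
      assume "card ?S = 0"
      then show False using N0[OF N, of c] by simp
    qed
    then have "finite ?S" by (rule card_ge_0_finite[OF neq0_conv[THEN iffD1]])
    have "card {x \<in> ?S. norm (u x - z x) > \<epsilon>} \<le> card {x \<in> ?S. norm (u x - z x) > \<delta>}"
      using assms(2) by (intro card_mono finite_subset[OF _ \<open>finite ?S\<close>]) auto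
    moreover have "\<delta> * real (card ?S) \<le> \<epsilon> * real (card ?S)" using assms(2) by (intro mult_right_mono) auto
    ultimately show "real (card {x \<in> ?S. norm (u x - z x) > \<epsilon>}) < \<epsilon> * real (card ?S)"
      using N0[OF N, of c] by linarith
  qed
qed

text \<open>The slippage flex is reused with first phase 1, first period 1 and a 1 by 1 matrix. It
  remains to see that it is not zero at all joints: a zero field would miss the constant field by
  \<open>norm \<beta>\<close> at every joint.\<close>

lemma slippage_imp_localisation:
  assumes "periodic_slippage_line G H"
  shows "periodic_localisation_line G H"
proof -
  obtain t1 t2 b where H: "Delone_framework G" "H = span {t1}" "plane_basis t1 t2" "b \<noteq> 0"
    and slip: "\<And>\<epsilon>. \<epsilon> > 0 \<Longrightarrow> \<exists>u. \<exists>M::nat. infinitesimal_flex G u \<and> M > 0 \<and>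
           (\<forall>\<omega>\<in>sphere 0 1.
              infinitesimal_flex G (modulation (phase_field 1 \<omega> t1 (real M *\<^sub>R t2)) u)) \<and>
           (\<forall>\<omega>\<in>sphere 0 1.
              mostly_close (joints G) \<epsilon>
                (modulation (phase_field 1 \<omega> t1 (real M *\<^sub>R t2)) u)
                (modulation (phase_field 1 \<omega> t1 (real M *\<^sub>R t2)) (const_velocity b)))"
    using assms unfolding periodic_slippage_line_def by blast
  define \<beta> where "\<beta> = const_velocity b 0"
  have \<beta>: "const_velocity b = (\<lambda>_. \<beta>)" by (simp add: \<beta>_def const_velocity_def)
  have \<beta>0: "\<beta> \<noteq> 0" using H(4) by (auto simp: \<beta>_def const_velocity_def vec_eq_iff)
  show ?thesis unfolding periodic_localisation_line_def
  proof (rule conjI[OF H(1)], rule exI[of _ t1], rule exI[of _ t2], intro conjI allI impI)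
    fix \<epsilon> :: real assume "\<epsilon> > 0"
    \<comment> \<open>Below \<open>norm \<beta>\<close>, so that a zero flex is bad at every joint,
      and at most 1, so that the set of all joints in a square is too large to be the exceptional
      set.\<close>
    define \<delta> where "\<delta> = min \<epsilon> (min 1 (norm \<beta> / 2))"
    have \<delta>: "\<delta> > 0" "\<delta> \<le> \<epsilon>" "\<delta> \<le> 1" "\<delta> < norm \<beta>" using \<open>\<epsilon> > 0\<close> \<beta>0 by (auto simp: \<delta>_def min_def)
    obtain u and M :: nat where u: "infinitesimal_flex G u" "M > 0"
      and flex: "\<And>\<omega>. \<omega> \<in> sphere 0 1 \<Longrightarrow> infinitesimal_flex G (modulation (phase_field 1 \<omega> t1 (real M *\<^sub>R t2)) u)"
      and close: "\<And>\<omega>. \<omega> \<in> sphere 0 1 \<Longrightarrow> mostly_close (joints G) \<delta>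
                (modulation (phase_field 1 \<omega> t1 (real M *\<^sub>R t2)) u)
                (modulation (phase_field 1 \<omega> t1 (real M *\<^sub>R t2)) (\<lambda>_. \<beta>))"
      using slip[OF \<delta>(1)] unfolding \<beta> by blast
    have basis: "perp t1 \<bullet> (real M *\<^sub>R t2) \<noteq> 0" using H(3) u(2) by (simp add: plane_basis_iff_perp)
    have nz: "\<exists>x\<in>joints G. u x \<noteq> 0"
    proof (rule ccontr)
      assume "\<not> (\<exists>x\<in>joints G. u x \<noteq> 0)"
      then have z: "x \<in> joints G \<Longrightarrow> u x = 0" for x by blast
      obtain N0 where "\<And>N c. N \<ge> N0 \<Longrightarrow> real (card {x \<in> joints G \<inter> (+) c ` cbox (vec (- N)) (vec N).
          norm (modulation (phase_field 1 1 t1 (real M *\<^sub>R t2)) u x - modulation (phase_field 1 1 t1 (real M *\<^sub>R t2)) (\<lambda>_. \<beta>) x) > \<delta>})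
          < \<delta> * real (card (joints G \<inter> (+) c ` cbox (vec (- N)) (vec N)))"
        using close[of 1] unfolding mostly_close_def Let_def by auto
      note N0 = this[OF order_refl, of 0]
      have "{x \<in> joints G \<inter> (+) 0 ` cbox (vec (- N0)) (vec N0).
          norm (modulation (phase_field 1 1 t1 (real M *\<^sub>R t2)) u x - modulation (phase_field 1 1 t1 (real M *\<^sub>R t2)) (\<lambda>_. \<beta>) x) > \<delta>}
          = joints G \<inter> (+) 0 ` cbox (vec (- N0)) (vec N0)"
        using z \<delta>(4) by (auto simp: modulation_def phase_field_eq[OF basis])
      then have "real (card (joints G \<inter> (+) 0 ` cbox (vec (- N0)) (vec N0))) < \<delta> * real (card (joints G \<inter> (+) 0 ` cbox (vec (- N0)) (vec N0)))"
        using N0 by (simp only:)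
      moreover have "\<delta> * real (card (joints G \<inter> (+) 0 ` cbox (vec (- N0)) (vec N0))) \<le> 1 * real (card (joints G \<inter> (+) 0 ` cbox (vec (- N0)) (vec N0)))"
        using \<delta>(3) by (intro mult_right_mono) auto
      ultimately show False by simp
    qed
    have tensor: "mostly_close (joints G) \<epsilon> (modulation (phase_field 1 \<omega> t1 (real M *\<^sub>R t2)) u)
        (phase_tensor 1 \<omega> t1 (real M *\<^sub>R t2) 1 1 (\<lambda>_ _. \<beta>))" if "\<omega> \<in> sphere 0 1" for \<omega>
      unfolding phase_tensor_constant[OF basis] using mostly_close_mono[OF close[OF that] \<delta>(2)] .
    show "\<exists>u. \<exists>\<omega>1\<in>sphere 0 1. \<exists>M1 M2 :: nat.
           infinitesimal_flex G u \<and> (\<exists>x\<in>joints G. u x \<noteq> 0) \<and> M1 > 0 \<and> M2 > 0 \<and>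
           (\<forall>\<omega>\<in>sphere 0 1.
              infinitesimal_flex G
                (modulation (phase_field \<omega>1 \<omega> (real M1 *\<^sub>R t1) (real M2 *\<^sub>R t2)) u)) \<and>
           (\<exists>L M B. L > 0 \<and> M > 0 \<and>
             (\<forall>\<omega>\<in>sphere 0 1.
                mostly_close (joints G) \<epsilon>
                  (modulation (phase_field \<omega>1 \<omega> (real M1 *\<^sub>R t1) (real M2 *\<^sub>R t2)) u)
                  (phase_tensor \<omega>1 \<omega> (real M1 *\<^sub>R t1) (real M2 *\<^sub>R t2) L M B)))"
    proof (rule exI[of _ u], rule bexI[of _ 1], rule exI[of _ 1], rule exI[of _ M], intro conjI)
      show "\<exists>L Ma B. L > 0 \<and> Ma > 0 \<and> (\<forall>\<omega>\<in>sphere 0 1.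
          mostly_close (joints G) \<epsilon>
            (modulation (phase_field 1 \<omega> (real 1 *\<^sub>R t1) (real M *\<^sub>R t2)) u)
            (phase_tensor 1 \<omega> (real 1 *\<^sub>R t1) (real M *\<^sub>R t2) L Ma B))"
        by (rule exI[of _ 1], rule exI[of _ 1], rule exI[of _ "\<lambda>_ _. \<beta>"]) (use tensor in simp)
    qed (use u nz flex in simp_all)
  qed (use H in auto)
qed

section \<open>Discrete sets of reals and parallelograms\<close>

text \<open>Along a line transversal to a grid the level of the grid is an affine function of the
  parameter, and crossings are its integral values. Together with the next two lemmas: crossings are
  unbounded both ways and locally finite.\<close>

lemma ex_gt_affine_in_Ints:
  fixes \<alpha> \<beta> a :: real
  assumes "\<beta> \<noteq> 0"
  shows "\<exists>t>a. \<alpha> + \<beta> * t \<in> \<int>"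
proof (cases "\<beta> > 0")
  case True
  let ?k = "\<lfloor>\<alpha> + \<beta> * a\<rfloor> + 1"
  have "\<alpha> + \<beta> * a < of_int ?k" by linarith
  then have "a < (of_int ?k - \<alpha>) / \<beta>" using True by (simp add: field_simps)
  moreover have "\<alpha> + \<beta> * ((of_int ?k - \<alpha>) / \<beta>) = of_int ?k" using True by simp
  ultimately show ?thesis by (metis Ints_of_int)
next
  case False
  let ?k = "\<lceil>\<alpha> + \<beta> * a\<rceil> - 1"
  have "of_int ?k < \<alpha> + \<beta> * a" by linarith
  then have "a < (of_int ?k - \<alpha>) / \<beta>" using False assms by (simp add: field_simps)
  moreover have "\<alpha> + \<beta> * ((of_int ?k - \<alpha>) / \<beta>) = of_int ?k" using assms by simp
  ultimately show ?thesis by (metis Ints_of_int)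
qed

lemma ex_lt_affine_in_Ints:
  fixes \<alpha> \<beta> a :: real
  assumes "\<beta> \<noteq> 0"
  shows "\<exists>t<a. \<alpha> + \<beta> * t \<in> \<int>"
proof -
  obtain t where "t > - a" "\<alpha> + (- \<beta>) * t \<in> \<int>" using ex_gt_affine_in_Ints[of "- \<beta>" "- a" \<alpha>] assms by auto
  then show ?thesis by (intro exI[of _ "- t"]) auto
qed

lemma finite_affine_in_Ints:
  fixes \<alpha> \<beta> a b :: real
  assumes "\<beta> \<noteq> 0"
  shows "finite {t \<in> {a..b}. \<alpha> + \<beta> * t \<in> \<int>}"
proof -
  define U where "U = \<bar>\<alpha>\<bar> + \<bar>\<beta>\<bar> * (\<bar>a\<bar> + \<bar>b\<bar>)"
  have "{t \<in> {a..b}. \<alpha> + \<beta> * t \<in> \<int>} \<subseteq> (\<lambda>x. (x - \<alpha>) / \<beta>) ` {x \<in> \<int>. - U \<le> x \<and> x \<le> U}"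
  proof
    fix t assume t: "t \<in> {t \<in> {a..b}. \<alpha> + \<beta> * t \<in> \<int>}"
    then have "\<bar>t\<bar> \<le> \<bar>a\<bar> + \<bar>b\<bar>" by auto
    then have "\<bar>\<beta>\<bar> * \<bar>t\<bar> \<le> \<bar>\<beta>\<bar> * (\<bar>a\<bar> + \<bar>b\<bar>)" by (intro mult_left_mono) auto
    then have "\<bar>\<beta> * t\<bar> \<le> \<bar>\<beta>\<bar> * (\<bar>a\<bar> + \<bar>b\<bar>)" by (simp add: abs_mult)
    then have "- U \<le> \<alpha> + \<beta> * t \<and> \<alpha> + \<beta> * t \<le> U" unfolding U_def by linarith
    moreover have "t = (\<alpha> + \<beta> * t - \<alpha>) / \<beta>" using assms by simp
    ultimately show "t \<in> (\<lambda>x. (x - \<alpha>) / \<beta>) ` {x \<in> \<int>. - U \<le> x \<and> x \<le> U}"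
      using t by (intro image_eqI[of _ _ "\<alpha> + \<beta> * t"]) auto
  qed
  moreover have "finite {x \<in> \<int>. - U \<le> x \<and> x \<le> U}" by (rule finite_int_segment)
  ultimately show ?thesis by (meson finite_imageI finite_subset)
qed

text \<open>Local finiteness gives every real a next and a previous element of \<open>X\<close>;
  iterating from one element in both directions produces the enumeration.\<close>

lemma locally_finite_enumeration:
  fixes X :: "real set"
  assumes fin: "\<And>a b. finite (X \<inter> {a..b})"
    and up: "\<And>a. \<exists>x>a. x \<in> X" and down: "\<And>a. \<exists>x<a. x \<in> X"
  obtains \<theta> :: "int \<Rightarrow> real" where "\<And>n. \<theta> n \<in> X" "\<And>n. \<theta> n < \<theta> (n + 1)"
    "\<And>n. X \<inter> {\<theta> n<..<\<theta> (n + 1)} = {}"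
proof -
  have "\<exists>y. y \<in> X \<and> x < y \<and> X \<inter> {x<..<y} = {}" for x
  proof -
    obtain b where b: "b > x" "b \<in> X" using up by blast
    let ?F = "X \<inter> {x<..b}"
    have f: "finite ?F" by (rule finite_subset[OF _ fin[of x b]]) auto
    have ne: "?F \<noteq> {}" using b by auto
    have "Min ?F \<in> ?F" using f ne by (rule Min_in)
    moreover have "z \<notin> {x<..<Min ?F}" if "z \<in> X" for z
    proof
      assume z: "z \<in> {x<..<Min ?F}"
      then have "z \<in> ?F" using that \<open>Min ?F \<in> ?F\<close> by auto
      then have "Min ?F \<le> z" using f by (rule Min_le[rotated])
      then show False using z by auto
    qed
    ultimately show ?thesis by (intro exI[of _ "Min ?F"]) auto
  qed
  then obtain su where su: "\<And>x. su x \<in> X" "\<And>x. x < su x" "\<And>x. X \<inter> {x<..<su x} = {}" by metis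
  have "\<exists>y. y \<in> X \<and> y < x \<and> X \<inter> {y<..<x} = {}" for x
  proof -
    obtain b where b: "b < x" "b \<in> X" using down by blast
    let ?F = "X \<inter> {b..<x}"
    have f: "finite ?F" by (rule finite_subset[OF _ fin[of b x]]) auto
    have ne: "?F \<noteq> {}" using b by auto
    have "Max ?F \<in> ?F" using f ne by (rule Max_in)
    moreover have "z \<notin> {Max ?F<..<x}" if "z \<in> X" for z
    proof
      assume z: "z \<in> {Max ?F<..<x}"
      then have "z \<in> ?F" using that \<open>Max ?F \<in> ?F\<close> by auto
      then have "z \<le> Max ?F" using f by (rule Max_ge[rotated])
      then show False using z by auto
    qed
    ultimately show ?thesis by (intro exI[of _ "Max ?F"]) auto
  qed
  then obtain pr where pr: "\<And>x. pr x \<in> X" "\<And>x. pr x < x" "\<And>x. X \<inter> {pr x<..<x} = {}" by metis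
  obtain x0 where x0: "x0 \<in> X" using up by blast
  define \<theta> where "\<theta> n = (if 0 \<le> n then (su ^^ nat n) x0 else (pr ^^ nat (- n)) x0)" for n :: int
  \<comment> \<open>Each gap is handled by one map alone, the successor from \<open>x0\<close>
    rightwards and the predecessor leftwards, so the two maps need not be compared.\<close>
  have step: "\<theta> (n + 1) = su (\<theta> n) \<or> \<theta> n = pr (\<theta> (n + 1))" for n
  proof (cases "0 \<le> n")
    case True
    then have "nat (n + 1) = Suc (nat n)" by simp
    then show ?thesis using True by (simp add: \<theta>_def)
  next
    case False
    then have "nat (- n) = Suc (nat (- (n + 1)))" by simp
    moreover have "\<theta> (n + 1) = (pr ^^ nat (- (n + 1))) x0" using False by (auto simp: \<theta>_def)
    ultimately show ?thesis using False by (simp add: \<theta>_def)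
  qed
  have "(su ^^ k) x0 \<in> X" "(pr ^^ k) x0 \<in> X" for k
    using x0 su pr by (induction k) auto
  then have "\<theta> n \<in> X" for n by (simp add: \<theta>_def)
  moreover have "\<theta> n < \<theta> (n + 1)" "X \<inter> {\<theta> n<..<\<theta> (n + 1)} = {}" for n
    using step[of n] su pr by metis+
  ultimately show ?thesis using that by blast
qed

section \<open>Parallelograms and their edges\<close>

definition parallelogram :: "real^2 \<Rightarrow> real^2 \<Rightarrow> real^2 \<Rightarrow> (real^2) set" where
  "parallelogram p a b = convex hull {p, p + a, p + b, p + a + b}"

text \<open>A change of base vertex: it carries facts about the side at \<open>p\<close> to the
  opposite side, and lets a ribbon traverse a tile against an edge vector.\<close>

lemma parallelogram_shift: "parallelogram (p + b) a (- b) = parallelogram p a b"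
proof -
  have "{p + b, p + b + a, p + b + - b, p + b + a + - b} = {p, p + a, p + b, p + a + b}" by (auto simp: algebra_simps)
  then show ?thesis by (simp only: parallelogram_def)
qed

text \<open>The functional \<open>perp a\<close> is constant on the line through one side and takes
  another value on the opposite side. So the affine hull of the side misses the hull of the other
  vertices, which makes it a face.\<close>

lemma edge_of_parallelogram:
  assumes ab: "perp a \<bullet> b \<noteq> 0"
  shows "closed_segment p (p + a) edge_of parallelogram p a b"
    and "closed_segment (p + b) (p + b + a) edge_of parallelogram p a b"
proof -
  have *: "closed_segment p (p + a) edge_of parallelogram p a b" if ab: "perp a \<bullet> b \<noteq> 0" for p b
  proof -
    let ?S = "{p, p + a, p + b, p + a + b}"
    have "affine hull {p, p + a} \<subseteq> {x. perp a \<bullet> x = perp a \<bullet> p}"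
      by (rule hull_minimal) (auto simp: affine_hyperplane inner_add_right)
    moreover have "convex hull (?S - {p, p + a}) \<subseteq> {x. perp a \<bullet> x = perp a \<bullet> p + perp a \<bullet> b}"
      by (rule hull_minimal) (auto simp: convex_hyperplane inner_add_right)
    ultimately have "affine hull {p, p + a} \<inter> convex hull (?S - {p, p + a}) = {}" using ab by fastforce
    then have "convex hull {p, p + a} face_of convex hull ?S"
      by (intro face_of_convex_hulls) auto
    moreover have "a \<noteq> 0" using ab by auto
    ultimately show ?thesis
      by (simp add: edge_of_def parallelogram_def segment_convex_hull aff_dim_convex_hull aff_dim_2)
  qed
  show "closed_segment p (p + a) edge_of parallelogram p a b" using *[OF ab] .
  show "closed_segment (p + b) (p + b + a) edge_of parallelogram p a b"
    using *[of "- b" "p + b"] ab by (simp add: parallelogram_shift)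
qed

text \<open>A face is the hull of the vertices spanning it. The diagonals share their midpoint, so a
  face containing the ends of one diagonal contains those of the other, hence all four vertices, and
  is not collinear. An edge is therefore spanned by the ends of a side.\<close>

lemma edge_of_parallelogramD:
  assumes e: "e edge_of parallelogram p a b" and ab: "perp a \<bullet> b \<noteq> 0"
  shows "e \<in> {closed_segment p (p + a), closed_segment (p + b) (p + b + a),
    closed_segment p (p + b), closed_segment (p + a) (p + a + b)}"
proof -
  let ?S = "{p, p + a, p + b, p + a + b}"
  have face: "e face_of convex hull ?S" and dim: "aff_dim e = 1"
    using e by (auto simp: edge_of_def parallelogram_def)
  obtain c where c: "c \<subseteq> ?S" "e = convex hull c"
    by (rule face_of_convex_hull_subset[OF _ face]) (simp_all add: finite_imp_compact)
  have ce: "c \<subseteq> e" unfolding c(2) by (rule hull_subset)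
  have opp: "x' \<in> e \<and> y' \<in> e" if "x \<in> e" "y \<in> e" "x' \<in> ?S" "y' \<in> ?S" "x' \<noteq> y'" "x + y = x' + y'" for x y x' y'
  proof -
    have "midpoint x y \<in> e"
      using face_of_imp_convex[OF face] that(1,2) by (meson convex_contains_segment midpoint_in_closed_segment subsetD)
    moreover have "midpoint x y = midpoint x' y'" using that(6) by (simp add: midpoint_def)
    ultimately have "midpoint x' y' \<in> e" by simp
    moreover have "midpoint x' y' \<in> open_segment x' y'" using that(5) by simp
    moreover have "x' \<in> convex hull ?S" "y' \<in> convex hull ?S" using that(3,4) by (simp_all add: hull_inc)
    ultimately show ?thesis using face_ofD[OF face] by blast
  qed
  have not_all: False if pe: "p \<in> e" "p + a \<in> e" "p + b \<in> e"
  proof -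
    have "collinear e" using dim by (simp add: collinear_aff_dim)
    then obtain u where u: "\<And>x y. x \<in> e \<Longrightarrow> y \<in> e \<Longrightarrow> \<exists>c. x - y = c *\<^sub>R u" unfolding collinear_def by blast
    obtain c1 c2 where "p + a - p = c1 *\<^sub>R u" "p + b - p = c2 *\<^sub>R u" using u pe by meson
    then have "a = c1 *\<^sub>R u" "b = c2 *\<^sub>R u" by simp_all
    then have "perp a \<bullet> b = 0" by (simp add: inner_2)
    then show False using ab by simp
  qed
  have a0: "a \<noteq> 0" "b \<noteq> 0" "a \<noteq> b" "a + b \<noteq> 0" using ab by (auto simp: add_eq_0_iff)
  have "\<not> (p \<in> e \<and> p + a + b \<in> e)"
    using opp[of p "p + a + b" "p + a" "p + b"] not_all a0 by (auto simp: algebra_simps)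
  moreover have "\<not> (p + a \<in> e \<and> p + b \<in> e)"
    using opp[of "p + a" "p + b" p "p + a + b"] not_all a0 by (auto simp: algebra_simps)
  ultimately have "c \<subseteq> {p, p + a} \<or> c \<subseteq> {p + b, p + b + a} \<or> c \<subseteq> {p, p + b} \<or> c \<subseteq> {p + a, p + a + b}"
    using c(1) ce by (auto simp: algebra_simps)
  moreover have "e = closed_segment x y" if "c \<subseteq> {x, y}" for x y
  proof -
    have "aff_dim c = 1" using dim c(2) by (simp add: aff_dim_convex_hull)
    then have "c \<noteq> {}" "c \<noteq> {x}" "c \<noteq> {y}" by auto
    then have "c = {x, y}" using that by blast
    then show ?thesis using c(2) by (simp add: segment_convex_hull)
  qed
  ultimately show ?thesis by blast
qed

section \<open>The dual map of a multigrid\<close>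

locale multigrid_tiling =
  fixes \<Gamma> :: multigrid and len :: "nat \<Rightarrow> real"
  assumes regular: "regular_multigrid \<Gamma>"
    and len_pos: "\<forall>j<grid_count \<Gamma>. len j > 0"
begin

abbreviation "r \<equiv> grid_count \<Gamma>"
abbreviation "nrm \<equiv> normal \<Gamma>"
abbreviation "dp \<equiv> dual_point \<Gamma> len"

definition level :: "nat \<Rightarrow> real^2 \<Rightarrow> real" where
  "level j x = (x \<bullet> nrm j + shift \<Gamma> j) / spacing \<Gamma> j"

definition on_grid :: "nat \<Rightarrow> real^2 \<Rightarrow> bool" where
  "on_grid j x \<longleftrightarrow> level j x \<in> \<int>"

definition edge_vec :: "nat \<Rightarrow> real^2" where
  "edge_vec j = len j *\<^sub>R nrm j"

lemma multigrid: "is_multigrid \<Gamma>"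
  using regular by (simp add: regular_multigrid_def)

lemma two_grids: "2 \<le> r"
  using multigrid by (simp add: is_multigrid_def)

lemma spacing_pos: "j < r \<Longrightarrow> 0 < spacing \<Gamma> j"
  using multigrid by (simp add: is_multigrid_def)

lemma norm_normal [simp]: "j < r \<Longrightarrow> norm (nrm j) = 1"
  using multigrid by (simp add: is_multigrid_def)

lemma normal_nonzero: "j < r \<Longrightarrow> nrm j \<noteq> 0"
  by (metis norm_normal norm_zero zero_neq_one)

lemma normals_not_parallel: "i < r \<Longrightarrow> j < r \<Longrightarrow> i \<noteq> j \<Longrightarrow> perp (nrm i) \<bullet> nrm j \<noteq> 0"
  using multigrid normal_nonzero span_singleton_eq_iff_perp[of "nrm i" "nrm j"]
  by (simp add: is_multigrid_def)

lemma edge_vecs_not_parallel: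
  "i < r \<Longrightarrow> j < r \<Longrightarrow> i \<noteq> j \<Longrightarrow> perp (edge_vec i) \<bullet> edge_vec j \<noteq> 0"
proof -
  assume a: "i < r" "j < r" "i \<noteq> j"
  have "perp (edge_vec i) \<bullet> edge_vec j = len i * len j * (perp (nrm i) \<bullet> nrm j)"
    by (simp add: edge_vec_def inner_2 algebra_simps)
  then show ?thesis using a normals_not_parallel len_pos by auto
qed

lemma edge_vec_nonzero: "j < r \<Longrightarrow> edge_vec j \<noteq> 0"
  using len_pos normal_nonzero by (auto simp: edge_vec_def)

lemma dp_eq: "dp x = (\<Sum>j<r. of_int \<lceil>level j x\<rceil> *\<^sub>R edge_vec j)"
  by (simp add: dual_point_def level_def edge_vec_def)

lemma in_grid_line_iff: "j < r \<Longrightarrow> x \<in> grid_line \<Gamma> j k \<longleftrightarrow> level j x = of_int k"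
  using spacing_pos[of j] by (auto simp: grid_line_def level_def field_simps)

lemma on_grid_iff: "j < r \<Longrightarrow> on_grid j x \<longleftrightarrow> (\<exists>k. x \<in> grid_line \<Gamma> j k)"
  by (auto simp: on_grid_def in_grid_line_iff Ints_def)

lemma level_add: "level j (x + v) = level j x + (v \<bullet> nrm j) / spacing \<Gamma> j"
  by (simp add: level_def inner_add_left add_divide_distrib)

lemma level_diff: "level j y = level j x + ((y - x) \<bullet> nrm j) / spacing \<Gamma> j"
  using level_add[of j x "y - x"] by simp

text \<open>Regularity is a condition on three distinct lines as sets; this turns distinct grid
  indices into distinct sets. Moving by \<open>perp (nrm i)\<close> stays on the first line but
  changes the level of the other grid.\<close>

lemma grid_lines_distinct:
  assumes "i < r" "j < r" "i \<noteq> j" "x \<in> grid_line \<Gamma> i k"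
  shows "grid_line \<Gamma> i k \<noteq> grid_line \<Gamma> j l"
proof
  assume eq: "grid_line \<Gamma> i k = grid_line \<Gamma> j l"
  have "x + perp (nrm i) \<in> grid_line \<Gamma> i k"
    using assms by (simp add: in_grid_line_iff level_add)
  then have "level j (x + perp (nrm i)) = of_int l" "level j x = of_int l"
    using eq assms in_grid_line_iff[OF assms(2)] by auto
  then have "perp (nrm i) \<bullet> nrm j = 0"
    using spacing_pos[OF assms(2)] by (simp add: level_add)
  then show False using normals_not_parallel assms by blast
qed

lemma at_most_two_grids:
  assumes "i < r" "j < r" "l < r" "on_grid i x" "on_grid j x" "on_grid l x" "i \<noteq> j"
  shows "l = i \<or> l = j"
proof (rule ccontr)
  assume n: "\<not> (l = i \<or> l = j)"
  from assms obtain a b c where x: "x \<in> grid_line \<Gamma> i a" "x \<in> grid_line \<Gamma> j b" "x \<in> grid_line \<Gamma> l c"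
    by (auto simp: on_grid_iff)
  have "distinct [grid_line \<Gamma> i a, grid_line \<Gamma> j b, grid_line \<Gamma> l c]"
    using grid_lines_distinct x assms n by auto
  moreover have "grid_line \<Gamma> i a \<in> grid_lines \<Gamma>" "grid_line \<Gamma> j b \<in> grid_lines \<Gamma>"
    "grid_line \<Gamma> l c \<in> grid_lines \<Gamma>"
    using assms by (auto simp: grid_lines_def)
  ultimately show False using regular x unfolding regular_multigrid_def by blast
qed

text \<open>The ceiling is left-continuous: leaving an integer level upwards raises it at once,
  staying or going down does not. So near \<open>x\<close> only the grids through \<open>x\<close>
  matter, and for them only the side on which \<open>y\<close> lies.\<close>

lemma near_point:
  "\<forall>\<^sub>F y in nhds x. \<forall>j<r.
     \<lceil>level j y\<rceil> = \<lceil>level j x\<rceil> + (if on_grid j x \<and> (y - x) \<bullet> nrm j > 0 then 1 else 0) \<and>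
     (on_grid j y \<longleftrightarrow> on_grid j x \<and> (y - x) \<bullet> nrm j = 0)"
proof -
  have "\<forall>\<^sub>F y in nhds x. \<forall>j\<in>{..<r}.
     \<lceil>level j y\<rceil> = \<lceil>level j x\<rceil> + (if on_grid j x \<and> (y - x) \<bullet> nrm j > 0 then 1 else 0) \<and>
     (on_grid j y \<longleftrightarrow> on_grid j x \<and> (y - x) \<bullet> nrm j = 0)"
  proof (intro eventually_ball_finite ballI, simp)
    fix j assume "j \<in> {..<r}"
    then have j: "j < r" by simp
    have lim: "(level j \<longlongrightarrow> level j x) (nhds x)"
      unfolding level_def using spacing_pos[OF j] by (auto intro!: tendsto_intros filterlim_ident)
    show "\<forall>\<^sub>F y in nhds x. \<lceil>level j y\<rceil> = \<lceil>level j x\<rceil> + (if on_grid j x \<and> (y - x) \<bullet> nrm j > 0 then 1 else 0) \<and>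
     (on_grid j y \<longleftrightarrow> on_grid j x \<and> (y - x) \<bullet> nrm j = 0)"
    proof (cases "on_grid j x")
      case True
      then obtain k where k: "level j x = of_int k" by (auto simp: on_grid_def Ints_def)
      have "\<forall>\<^sub>F y in nhds x. level j y < of_int k + 1"
        "\<forall>\<^sub>F y in nhds x. level j y > of_int k - 1"
        using order_tendstoD[OF lim] k by auto
      then show ?thesis
      proof eventually_elim
        case (elim y)
        have sg: "(y - x) \<bullet> nrm j > 0 \<longleftrightarrow> level j y > of_int k" "(y - x) \<bullet> nrm j = 0 \<longleftrightarrow> level j y = of_int k"
          using level_diff[of j y x] k spacing_pos[OF j] by (auto simp: zero_less_divide_iff)
        have "\<lceil>level j y\<rceil> = k + (if level j y > of_int k then 1 else 0)"
          using elim by (auto simp: ceiling_eq_iff)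
        moreover have "level j y \<in> \<int> \<longleftrightarrow> level j y = of_int k"
        proof
          assume "level j y \<in> \<int>"
          then obtain m where m: "level j y = of_int m" by (auto simp: Ints_def)
          then have "m < k + 1" "m > k - 1" using elim by linarith+
          then show "level j y = of_int k" using m by simp
        qed simp
        ultimately show ?case using True k sg by (auto simp: on_grid_def)
      qed
    next
      case False
      have "level j x < of_int \<lceil>level j x\<rceil>" "level j x > of_int \<lceil>level j x\<rceil> - 1"
        using False ceiling_correct[of "level j x"] unfolding on_grid_def
        by (metis Ints_of_int less_eq_real_def, linarith)
      then have "\<forall>\<^sub>F y in nhds x. level j y < of_int \<lceil>level j x\<rceil>"
        "\<forall>\<^sub>F y in nhds x. level j y > of_int \<lceil>level j x\<rceil> - 1"
        using order_tendstoD[OF lim] by auto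
      then show ?thesis
      proof eventually_elim
        case (elim y)
        have "\<lceil>level j y\<rceil> = \<lceil>level j x\<rceil>" using elim by (simp add: ceiling_eq_iff)
        moreover have "level j y \<notin> \<int>"
        proof
          assume "level j y \<in> \<int>"
          then obtain m where m: "level j y = of_int m" by (auto simp: Ints_def)
          then have "m < \<lceil>level j x\<rceil>" "m > \<lceil>level j x\<rceil> - 1" using elim by linarith+
          then show False by simp
        qed
        ultimately show ?case using False by (simp add: on_grid_def)
      qed
    qed
  qed
  then show ?thesis unfolding Ball_def lessThan_iff .
qed

lemma dp_shift:
  assumes "\<forall>j<r. \<lceil>level j y\<rceil> = \<lceil>level j x\<rceil> + (if j \<in> S then 1 else 0)" "S \<subseteq> {..<r}"
  shows "dp y = dp x + sum edge_vec S"
proof -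
  have "dp y = (\<Sum>j<r. of_int \<lceil>level j x\<rceil> *\<^sub>R edge_vec j + (if j \<in> S then edge_vec j else 0))"
    unfolding dp_eq using assms(1) by (intro sum.cong) (auto simp: scaleR_add_left)
  also have "\<dots> = dp x + (\<Sum>j\<in>{..<r}. if j \<in> S then edge_vec j else 0)"
    by (simp add: sum.distrib dp_eq)
  also have "(\<Sum>j\<in>{..<r}. if j \<in> S then edge_vec j else 0) = sum edge_vec S"
    using assms(2) by (simp add: sum.If_cases Int_absorb1)
  finally show ?thesis .
qed

lemma dp_near_point:
  "\<forall>\<^sub>F y in nhds x. dp y = dp x + sum edge_vec {j. j < r \<and> on_grid j x \<and> (y - x) \<bullet> nrm j > 0}"
  using near_point[of x] by eventually_elim (rule dp_shift, auto)

lemma dp_near_line: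
  "\<forall>\<^sub>F t in nhds (0::real). dp (x + t *\<^sub>R v) = dp x + sum edge_vec {j. j < r \<and> on_grid j x \<and> t * (v \<bullet> nrm j) > 0}"
proof -
  have "((\<lambda>t. x + t *\<^sub>R v) \<longlongrightarrow> x + 0 *\<^sub>R v) (nhds (0::real))"
    by (intro tendsto_intros filterlim_ident)
  then have "filterlim (\<lambda>t. x + t *\<^sub>R v) (nhds x) (nhds (0::real))" by simp
  from eventually_compose_filterlim[OF dp_near_point this] show ?thesis by simp
qed

text \<open>The inner product with \<open>edge_vec j\<close> is a positive multiple of the change of
  level, and ceilings are monotone in the level.\<close>

lemma level_mono_term:
  assumes "j < r"
  shows "(of_int \<lceil>level j y\<rceil> - of_int \<lceil>level j x\<rceil>) * ((y - x) \<bullet> edge_vec j) \<ge> 0"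
    and "\<lceil>level j y\<rceil> \<noteq> \<lceil>level j x\<rceil> \<Longrightarrow>
      (of_int \<lceil>level j y\<rceil> - of_int \<lceil>level j x\<rceil>) * ((y - x) \<bullet> edge_vec j) > 0"
proof -
  have e: "(y - x) \<bullet> edge_vec j = (len j * spacing \<Gamma> j) * (level j y - level j x)"
    using level_diff[of j y x] spacing_pos[OF assms] by (simp add: edge_vec_def)
  have p: "len j * spacing \<Gamma> j > 0" using len_pos spacing_pos assms by simp
  show 2: "(of_int \<lceil>level j y\<rceil> - of_int \<lceil>level j x\<rceil>) * ((y - x) \<bullet> edge_vec j) > 0"
    if "\<lceil>level j y\<rceil> \<noteq> \<lceil>level j x\<rceil>"
  proof (cases "\<lceil>level j x\<rceil> < \<lceil>level j y\<rceil>")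
    case True
    then have "level j x < level j y" by (meson ceiling_mono linorder_not_le)
    then show ?thesis using True p unfolding e by simp
  next
    case False
    then have f: "\<lceil>level j y\<rceil> < \<lceil>level j x\<rceil>" using that by simp
    then have "level j y < level j x" by (meson ceiling_mono linorder_not_le)
    then have "len j * spacing \<Gamma> j * (level j y - level j x) < 0"
      using p by (intro mult_pos_neg) auto
    then show ?thesis using f unfolding e by (intro mult_neg_neg) auto
  qed
  show "(of_int \<lceil>level j y\<rceil> - of_int \<lceil>level j x\<rceil>) * ((y - x) \<bullet> edge_vec j) \<ge> 0"
    using 2 by fastforce
qed

text \<open>The dual map is monotone: \<open>(dp y - dp x) \<bullet> (y - x)\<close> is a sum of nonnegative terms, with a
  positive term for every grid that separates \<open>x\<close> from \<open>y\<close>.\<close>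

lemma dp_eq_imp_level_eq:
  assumes "dp x = dp y" "j < r"
  shows "\<lceil>level j x\<rceil> = \<lceil>level j y\<rceil>"
proof (rule ccontr)
  assume n: "\<lceil>level j x\<rceil> \<noteq> \<lceil>level j y\<rceil>"
  have "0 = (y - x) \<bullet> (dp y - dp x)" using assms by simp
  also have "dp y - dp x = (\<Sum>j<r. (of_int \<lceil>level j y\<rceil> - of_int \<lceil>level j x\<rceil>) *\<^sub>R edge_vec j)"
    unfolding dp_eq sum_subtractf[symmetric] by (simp add: scaleR_diff_left)
  also have "(y - x) \<bullet> \<dots> = (\<Sum>j<r. (of_int \<lceil>level j y\<rceil> - of_int \<lceil>level j x\<rceil>) * ((y - x) \<bullet> edge_vec j))"
    by (simp add: inner_sum_right)
  also have "\<dots> > 0"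
    using level_mono_term n assms(2) by (intro sum_pos2[where i=j]) auto
  finally show False by simp
qed

text \<open>The map \<open>A\<close>, the linear part of \<open>dp\<close>: rounding and shifts are
  dropped. It is the frame operator of the normals with weights
  \<open>len j / spacing \<Gamma> j\<close>.\<close>

definition frame_op :: "real^2 \<Rightarrow> real^2" where
  "frame_op x = (\<Sum>j<r. (len j / spacing \<Gamma> j * (x \<bullet> nrm j)) *\<^sub>R nrm j)"

lemma linear_frame_op: "linear frame_op"
  unfolding frame_op_def
  by (intro linearI)
    (simp_all add: inner_add_left sum.distrib[symmetric] scaleR_sum_right algebra_simps)

lemma frame_op_scaleR: "frame_op (c *\<^sub>R x) = c *\<^sub>R frame_op x"
  by (rule linear_scale[OF linear_frame_op])

lemma frame_op_add: "frame_op (x + y) = frame_op x + frame_op y"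
  by (rule linear_add[OF linear_frame_op])

text \<open>The quadratic form of \<open>frame_op\<close> is a positively weighted sum of squares.
  Where it vanishes, \<open>x\<close> is orthogonal to all normals, and two of them already span the
  plane.\<close>

lemma inj_frame_op: "inj frame_op"
proof (subst linear_injective_0[OF linear_frame_op], intro allI impI)
  fix x assume 0: "frame_op x = 0"
  have "0 = x \<bullet> frame_op x" using 0 by simp
  also have "\<dots> = (\<Sum>j<r. len j / spacing \<Gamma> j * (x \<bullet> nrm j)\<^sup>2)"
    by (simp add: frame_op_def inner_sum_right power2_eq_square mult.assoc)
  finally have "(\<Sum>j<r. len j / spacing \<Gamma> j * (x \<bullet> nrm j)\<^sup>2) = 0" by simp
  moreover have pos: "j < r \<Longrightarrow> len j / spacing \<Gamma> j > 0" for j using len_pos spacing_pos by simp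
  moreover have "0 \<le> len j / spacing \<Gamma> j * (x \<bullet> nrm j)\<^sup>2" if "j < r" for j
    using pos[OF that] by (intro mult_nonneg_nonneg) auto
  ultimately have z: "\<forall>j\<in>{..<r}. len j / spacing \<Gamma> j * (x \<bullet> nrm j)\<^sup>2 = 0"
    by (subst (asm) sum_nonneg_eq_0_iff) auto
  have z': "x \<bullet> nrm j = 0" if "j < r" for j
    using bspec[OF z, of j] pos[OF that] that by auto
  have "x \<bullet> nrm 0 = 0" "x \<bullet> nrm 1 = 0" using z' two_grids by auto
  moreover have "perp (nrm 0) \<bullet> nrm 1 \<noteq> 0" using normals_not_parallel two_grids by auto
  ultimately show "x = 0" using orthogonal_to_basis_imp_0 by blast
qed

lemma surj_frame_op: "surj frame_op"
  by (rule linear_inj_imp_surj[OF linear_frame_op inj_frame_op])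

lemma frame_op_eq_0_iff: "frame_op x = 0 \<longleftrightarrow> x = 0"
  using inj_frame_op linear_frame_op by (metis linear_0 injD)

lemma dp_near_frame_op: obtains E where "E > 0" "\<And>x. norm (dp x - frame_op x) \<le> E"
proof
  \<comment> \<open>Per grid, rounding costs at most 1 and the dropped shift at most its absolute
    value over the spacing. The final summand 1 makes the bound positive.\<close>
  let ?E = "(\<Sum>j<r. (1 + \<bar>shift \<Gamma> j\<bar> / spacing \<Gamma> j) * len j) + 1"
  show "?E > 0"
    using len_pos spacing_pos
    by (intro add_nonneg_pos sum_nonneg mult_nonneg_nonneg add_nonneg_nonneg divide_nonneg_nonneg)
      (auto intro: less_imp_le)
  fix x
  have "dp x - frame_op x = (\<Sum>j<r. (of_int \<lceil>level j x\<rceil> - (x \<bullet> nrm j) / spacing \<Gamma> j) *\<^sub>R edge_vec j)"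
    unfolding dp_eq frame_op_def sum_subtractf[symmetric]
    by (intro sum.cong) (simp_all add: edge_vec_def algebra_simps)
  also have "norm \<dots> \<le> (\<Sum>j<r. (1 + \<bar>shift \<Gamma> j\<bar> / spacing \<Gamma> j) * len j)"
  proof (rule sum_norm_le)
    fix j assume "j \<in> {..<r}"
    then have j: "j < r" by simp
    have "\<bar>of_int \<lceil>level j x\<rceil> - (x \<bullet> nrm j) / spacing \<Gamma> j\<bar>
        = \<bar>(of_int \<lceil>level j x\<rceil> - level j x) + shift \<Gamma> j / spacing \<Gamma> j\<bar>"
      by (simp add: level_def add_divide_distrib)
    also have "\<dots> \<le> 1 + \<bar>shift \<Gamma> j\<bar> / spacing \<Gamma> j"
    proof -
      have "\<bar>of_int \<lceil>level j x\<rceil> - level j x\<bar> \<le> 1" by linarith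
      moreover have "\<bar>shift \<Gamma> j / spacing \<Gamma> j\<bar> = \<bar>shift \<Gamma> j\<bar> / spacing \<Gamma> j" using spacing_pos[OF j] by simp
      ultimately show ?thesis by linarith
    qed
    finally show "norm ((of_int \<lceil>level j x\<rceil> - (x \<bullet> nrm j) / spacing \<Gamma> j) *\<^sub>R edge_vec j)
        \<le> (1 + \<bar>shift \<Gamma> j\<bar> / spacing \<Gamma> j) * len j"
      using j len_pos by (simp add: edge_vec_def abs_mult mult_right_mono less_imp_le)
  qed
  finally show "norm (dp x - frame_op x) \<le> ?E" by simp
qed

section \<open>Regions, vertices, edges and tiles\<close>

definition generic :: "real^2 \<Rightarrow> bool" where
  "generic x \<longleftrightarrow> (\<forall>j<r. \<not> on_grid j x)"

text \<open>For generic \<open>x\<close> this is the region of \<open>x\<close>. Describing it by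
  ceilings presents it as an intersection of open strips, which gives convexity.\<close>

definition cell :: "real^2 \<Rightarrow> (real^2) set" where
  "cell x = {y. generic y \<and> (\<forall>j<r. \<lceil>level j y\<rceil> = \<lceil>level j x\<rceil>)}"

lemma complement_grid_lines: "- \<Union> (grid_lines \<Gamma>) = Collect generic"
  unfolding grid_lines_def generic_def using on_grid_iff by blast

lemma in_cell_iff:
  "y \<in> cell x \<longleftrightarrow> (\<forall>j<r. of_int \<lceil>level j x\<rceil> - 1 < level j y \<and> level j y < of_int \<lceil>level j x\<rceil>)"
proof -
  have "\<not> on_grid j y \<and> \<lceil>level j y\<rceil> = k \<longleftrightarrow> of_int k - 1 < level j y \<and> level j y < of_int k" for j k
    unfolding on_grid_def
  proof (intro iffI conjI)
    assume a: "level j y \<notin> \<int> \<and> \<lceil>level j y\<rceil> = k"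
    then show "of_int k - 1 < level j y" by linarith
    have "level j y \<noteq> of_int k" using a by (metis Ints_of_int)
    then show "level j y < of_int k" using a by linarith
  next
    assume a: "of_int k - 1 < level j y \<and> level j y < of_int k"
    then show "\<lceil>level j y\<rceil> = k" by linarith
    show "level j y \<notin> \<int>"
    proof
      assume "level j y \<in> \<int>"
      then obtain m where "level j y = of_int m" by (auto simp: Ints_def)
      then have "k - 1 < m" "m < k" using conjunct1[OF a] conjunct2[OF a] by linarith+
      then show False by simp
    qed
  qed
  then show ?thesis unfolding cell_def generic_def by blast
qed

lemma level_convex_comb: "level j ((1 - t) *\<^sub>R x + t *\<^sub>R y) = (1 - t) * level j x + t * level j y"
proof -
  have "(1 - t) *\<^sub>R x + t *\<^sub>R y = x + t *\<^sub>R (y - x)" by (simp add: algebra_simps)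
  moreover have "level j (x + t *\<^sub>R (y - x)) = level j x + t * (level j y - level j x)"
    using level_diff[of j y x] by (simp only: level_add inner_scaleR_left) simp
  ultimately show ?thesis by (simp add: algebra_simps)
qed

lemma convex_cell: "convex (cell x)"
  unfolding convex_alt
proof (intro ballI allI impI)
  fix y z and t :: real
  assume a: "y \<in> cell x" "z \<in> cell x" "0 \<le> t \<and> t \<le> 1"
  show "(1 - t) *\<^sub>R y + t *\<^sub>R z \<in> cell x"
    unfolding in_cell_iff level_convex_comb
  proof (intro allI impI)
    fix j assume "j < r"
    then have "level j y \<in> {of_int \<lceil>level j x\<rceil> - 1 <..< of_int \<lceil>level j x\<rceil>}"
      "level j z \<in> {of_int \<lceil>level j x\<rceil> - 1 <..< of_int \<lceil>level j x\<rceil>}"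
      using a by (auto simp: in_cell_iff)
    then have "(1 - t) *\<^sub>R level j y + t *\<^sub>R level j z \<in> {of_int \<lceil>level j x\<rceil> - 1 <..< of_int \<lceil>level j x\<rceil>}"
      using a convex_real_interval(8)[unfolded convex_alt] by blast
    then show "of_int \<lceil>level j x\<rceil> - 1 < (1 - t) * level j y + t * level j z \<and>
      (1 - t) * level j y + t * level j z < of_int \<lceil>level j x\<rceil>" by simp
  qed
qed

lemma generic_in_cell: "generic x \<Longrightarrow> x \<in> cell x"
  by (simp add: cell_def)

lemma cell_cong: "(\<And>j. j < r \<Longrightarrow> \<lceil>level j x\<rceil> = \<lceil>level j y\<rceil>) \<Longrightarrow> cell x = cell y"
  by (auto simp: cell_def)

lemma in_cell_cell: "y \<in> cell x \<Longrightarrow> cell y = cell x"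
  by (rule cell_cong) (simp add: cell_def)

text \<open>A cell is convex, hence connected. Conversely the ceilings are locally constant at
  generic points, so they are constant on every connected set of generic points.\<close>

lemma component_eq_cell:
  assumes "generic x"
  shows "connected_component_set (Collect generic) x = cell x"
proof
  show "cell x \<subseteq> connected_component_set (Collect generic) x"
    using assms convex_connected[OF convex_cell]
    by (intro connected_component_maximal generic_in_cell) (auto simp: cell_def)
  show "connected_component_set (Collect generic) x \<subseteq> cell x"
  proof
    fix y assume "y \<in> connected_component_set (Collect generic) x"
    then obtain T where T: "connected T" "T \<subseteq> Collect generic" "x \<in> T" "y \<in> T"
      by (auto simp: connected_component_def)
    have "\<lceil>level j x\<rceil> = \<lceil>level j y\<rceil>" if "j < r" for j
    proof (rule connected_local_const[OF T(1,3,4)], intro ballI)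
      fix a assume "a \<in> T"
      then have "generic a" using T by auto
      have "\<forall>\<^sub>F b in nhds a. \<lceil>level j a\<rceil> = \<lceil>level j b\<rceil>"
        using near_point[of a] by eventually_elim (use \<open>generic a\<close> that in \<open>auto simp: generic_def\<close>)
      then show "\<forall>\<^sub>F b in at a within T. \<lceil>level j a\<rceil> = \<lceil>level j b\<rceil>"
        by (simp add: eventually_at_filter eventually_mono)
    qed
    then show "y \<in> cell x" using T by (auto simp: cell_def)
  qed
qed

lemma grid_regions_eq: "grid_regions \<Gamma> = cell ` Collect generic"
  unfolding grid_regions_def complement_grid_lines components_def
  using component_eq_cell by auto

lemma region_cell: "C \<in> grid_regions \<Gamma> \<Longrightarrow> x \<in> C \<Longrightarrow> generic x \<and> C = cell x"
  using in_cell_cell by (auto simp: grid_regions_eq cell_def)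

lemma cell_region: "generic x \<Longrightarrow> cell x \<in> grid_regions \<Gamma>"
  by (auto simp: grid_regions_eq)

lemma continuous_level: "continuous_on S (level j)"
  unfolding level_def by (cases "spacing \<Gamma> j = 0") (auto intro!: continuous_intros)

text \<open>The closed strips form a closed set containing the cell. Conversely, on the segment from
  \<open>z\<close> to the interior point \<open>y\<close> every point other than \<open>z\<close>
  satisfies the strict inequalities, so \<open>z\<close> is a limit of points of the cell.\<close>

lemma in_closure_cell_iff:
  assumes "generic y"
  shows "z \<in> closure (cell y) \<longleftrightarrow>
    (\<forall>j<r. of_int \<lceil>level j y\<rceil> - 1 \<le> level j z \<and> level j z \<le> of_int \<lceil>level j y\<rceil>)"
proof
  assume z: "z \<in> closure (cell y)"
  have "closed {z. \<forall>j<r. of_int \<lceil>level j y\<rceil> - 1 \<le> level j z \<and> level j z \<le> of_int \<lceil>level j y\<rceil>}"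
    by (intro closed_Collect_all closed_Collect_imp closed_Collect_conj closed_Collect_le
        continuous_level continuous_on_const open_Collect_const)
  moreover have "cell y \<subseteq> {z. \<forall>j<r. of_int \<lceil>level j y\<rceil> - 1 \<le> level j z \<and> level j z \<le> of_int \<lceil>level j y\<rceil>}"
    by (auto simp: in_cell_iff less_imp_le)
  ultimately show "\<forall>j<r. of_int \<lceil>level j y\<rceil> - 1 \<le> level j z \<and> level j z \<le> of_int \<lceil>level j y\<rceil>"
    using closure_minimal z by blast
next
  assume z: "\<forall>j<r. of_int \<lceil>level j y\<rceil> - 1 \<le> level j z \<and> level j z \<le> of_int \<lceil>level j y\<rceil>"
  have y: "y \<in> cell y" using assms by (rule generic_in_cell)
  show "z \<in> closure (cell y)"
  proof (rule Lim_in_closed_set[of _ "\<lambda>t. (1 - t) *\<^sub>R z + t *\<^sub>R y" "at_right (0::real)"])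
    show "((\<lambda>t. (1 - t) *\<^sub>R z + t *\<^sub>R y) \<longlongrightarrow> z) (at_right 0)"
      by (rule tendsto_eq_intros refl | simp)+
    have "(1 - t) *\<^sub>R z + t *\<^sub>R y \<in> closure (cell y)" if t: "0 < t" "t < 1" for t
    proof (rule subsetD[OF closure_subset], unfold in_cell_iff level_convex_comb, intro allI impI)
      fix j assume j: "j < r"
      let ?k = "of_int \<lceil>level j y\<rceil>"
      have "(1 - t) * (?k - 1) \<le> (1 - t) * level j z" "(1 - t) * level j z \<le> (1 - t) * ?k"
        using z j t by (auto intro!: mult_left_mono)
      moreover have "t * (?k - 1) < t * level j y" "t * level j y < t * ?k"
        using y j t by (auto simp: in_cell_iff intro!: mult_strict_left_mono)
      ultimately show "?k - 1 < (1 - t) * level j z + t * level j y \<and> (1 - t) * level j z + t * level j y < ?k"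
        by (simp add: algebra_simps)
    qed
    then show "\<forall>\<^sub>F t in at_right 0. (1 - t) *\<^sub>R z + t *\<^sub>R y \<in> closure (cell y)"
      by (intro eventually_at_rightI[of 0 1]) auto
  qed simp_all
qed

text \<open>By regularity at most two grids pass through \<open>x\<close>, and their normals are
  independent, so the prescribed inner products form a solvable linear system.\<close>

lemma direction_with_signs: "\<exists>v. \<forall>j<r. on_grid j x \<longrightarrow> v \<bullet> nrm j = \<sigma> j"
proof (cases "\<exists>i l. i < r \<and> l < r \<and> i \<noteq> l \<and> on_grid i x \<and> on_grid l x")
  case True
  then obtain i l where il: "i < r" "l < r" "i \<noteq> l" "on_grid i x" "on_grid l x" by blast
  let ?v = "(\<sigma> i / (perp (nrm l) \<bullet> nrm i)) *\<^sub>R perp (nrm l) + (\<sigma> l / (perp (nrm i) \<bullet> nrm l)) *\<^sub>R perp (nrm i)"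
  have "?v \<bullet> nrm i = \<sigma> i" "?v \<bullet> nrm l = \<sigma> l"
    using il normals_not_parallel by (simp_all add: inner_add_left)
  then show ?thesis using at_most_two_grids[OF il(1,2) _ il(4,5) _ il(3)] by blast
next
  case False
  show ?thesis
  proof (cases "\<exists>i<r. on_grid i x")
    case True
    then obtain i where i: "i < r" "on_grid i x" by blast
    then have "(\<sigma> i *\<^sub>R nrm i) \<bullet> nrm i = \<sigma> i" by (simp add: dot_square_norm)
    then show ?thesis using False i by metis
  qed auto
qed

text \<open>The regions meeting at \<open>x\<close> correspond to the choices of a side for each
  grid through \<open>x\<close>, with \<open>S\<close> the grids passed upwards. They are reached by
  a short move in a direction with these signs.\<close>

lemma region_at_corner:
  assumes "S \<subseteq> {j. j < r \<and> on_grid j x}"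
  obtains y where "generic y" "x \<in> closure (cell y)"
    "\<forall>j<r. \<lceil>level j y\<rceil> = \<lceil>level j x\<rceil> + (if j \<in> S then 1 else 0)" "dp y = dp x + sum edge_vec S"
proof -
  obtain v where v: "\<forall>j<r. on_grid j x \<longrightarrow> v \<bullet> nrm j = (if j \<in> S then 1 else -1)"
    using direction_with_signs[of x "\<lambda>j. if j \<in> S then 1 else -1"] by blast
  have "((\<lambda>t. x + t *\<^sub>R v) \<longlongrightarrow> x + 0 *\<^sub>R v) (at_right (0::real))"
    by (intro tendsto_intros)
  then have "filterlim (\<lambda>t. x + t *\<^sub>R v) (nhds x) (at_right (0::real))" by simp
  from eventually_compose_filterlim[OF near_point this]
  have "\<forall>\<^sub>F t in at_right (0::real). \<forall>j<r.
     \<lceil>level j (x + t *\<^sub>R v)\<rceil> = \<lceil>level j x\<rceil> + (if on_grid j x \<and> t * (v \<bullet> nrm j) > 0 then 1 else 0) \<and>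
     (on_grid j (x + t *\<^sub>R v) \<longleftrightarrow> on_grid j x \<and> t * (v \<bullet> nrm j) = 0)" by simp
  moreover have "\<forall>\<^sub>F t in at_right (0::real). t > 0" by (simp add: eventually_at_right_less)
  ultimately have "\<forall>\<^sub>F t in at_right (0::real). t > 0 \<and> (\<forall>j<r.
     \<lceil>level j (x + t *\<^sub>R v)\<rceil> = \<lceil>level j x\<rceil> + (if on_grid j x \<and> t * (v \<bullet> nrm j) > 0 then 1 else 0) \<and>
     (on_grid j (x + t *\<^sub>R v) \<longleftrightarrow> on_grid j x \<and> t * (v \<bullet> nrm j) = 0))"
    by eventually_elim simp
  from eventually_happens'[OF trivial_limit_at_right_real this]
  obtain t where t: "t > 0" and *: "\<forall>j<r.
     \<lceil>level j (x + t *\<^sub>R v)\<rceil> = \<lceil>level j x\<rceil> + (if on_grid j x \<and> t * (v \<bullet> nrm j) > 0 then 1 else 0) \<and>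
     (on_grid j (x + t *\<^sub>R v) \<longleftrightarrow> on_grid j x \<and> t * (v \<bullet> nrm j) = 0)" by blast
  let ?y = "x + t *\<^sub>R v"
  have g: "generic ?y" unfolding generic_def using * v t by (auto split: if_splits)
  have K: "\<lceil>level j ?y\<rceil> = \<lceil>level j x\<rceil> + (if j \<in> S then 1 else 0)" if "j < r" for j
    using * v t assms that by (auto simp: zero_less_mult_iff split: if_splits)
  have "x \<in> closure (cell ?y)"
    unfolding in_closure_cell_iff[OF g]
  proof (intro allI impI)
    fix j assume j: "j < r"
    show "of_int \<lceil>level j ?y\<rceil> - 1 \<le> level j x \<and> level j x \<le> of_int \<lceil>level j ?y\<rceil>"
    proof (cases "j \<in> S")
      case True
      then have "level j x \<in> \<int>" using assms by (auto simp: on_grid_def)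
      then have "of_int \<lceil>level j x\<rceil> = level j x" by (auto simp: Ints_def)
      then have "real_of_int \<lceil>level j ?y\<rceil> = level j x + 1" using K[OF j] True by simp
      then show ?thesis by simp
    next
      case False
      show ?thesis unfolding K[OF j] using False by simp
    qed
  qed
  moreover have "dp ?y = dp x + sum edge_vec S"
    using K assms by (intro dp_shift) auto
  ultimately show ?thesis using that g K by blast
qed

text \<open>Points on grid lines give no new vertices: the corner region with \<open>S = {}\<close>
  has the same value of \<open>dp\<close>.\<close>

lemma tiling_vertices_eq: "tiling_vertices \<Gamma> len = range dp"
proof
  show "range dp \<subseteq> tiling_vertices \<Gamma> len"
  proof
    fix p assume "p \<in> range dp"
    then obtain x where x: "p = dp x" by blast
    obtain y where "generic y" "dp y = dp x" by (rule region_at_corner[of "{}" x]) auto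
    then show "p \<in> tiling_vertices \<Gamma> len"
      unfolding tiling_vertices_def x using cell_region[of y] generic_in_cell[of y] by (intro CollectI exI[of _ y] exI[of _ "cell y"]) simp
  qed
qed (auto simp: tiling_vertices_def)

lemma dp_plus_edge_vec:
  assumes "j < r" "on_grid j x"
  shows "dp x + edge_vec j \<in> range dp"
  using assms by (rule_tac region_at_corner[of "{j}" x]) (auto, metis rangeI)

text \<open>The midpoint \<open>z\<close> of a shared segment serves as base point. The ends differ
  in the level of every grid other than \<open>j\<close>, so there \<open>z\<close> is strictly
  inside the common strip and both regions have its ceiling. They can only differ in grid
  \<open>j\<close>, by lying on the two sides of level \<open>k\<close>.\<close>

lemma tiling_edges_subset:
  assumes "e \<in> tiling_edges \<Gamma> len"
  obtains z j where "j < r" "on_grid j z" "e = {dp z, dp z + edge_vec j}"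
proof -
  from assms obtain y y' C D where e: "e = {dp y, dp y'}" and CD: "adjacent_regions \<Gamma> C D" "y \<in> C" "y' \<in> D"
    unfolding tiling_edges_def by blast
  have C: "generic y" "C = cell y" and D: "generic y'" "D = cell y'"
    using CD region_cell unfolding adjacent_regions_def by blast+
  obtain A a b where A: "A \<in> grid_lines \<Gamma>" "a \<noteq> b" "closed_segment a b \<subseteq> A \<inter> closure C \<inter> closure D" and ne: "C \<noteq> D"
    using CD(1) unfolding adjacent_regions_def by blast
  obtain j k where j: "j < r" "A = grid_line \<Gamma> j k" using A unfolding grid_lines_def by blast
  define z where "z = midpoint a b"
  have ab: "a \<in> A \<inter> closure C \<inter> closure D" "b \<in> A \<inter> closure C \<inter> closure D"
    "z \<in> A \<inter> closure C \<inter> closure D"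
    using A(3) unfolding z_def by (auto simp: subset_iff)
  have lz: "level i z = (level i a + level i b) / 2" for i
    using level_convex_comb[of i "1/2" a b] unfolding z_def midpoint_def
    by (simp add: scaleR_add_right)
  have lj: "level j a = of_int k" "level j b = of_int k" "level j z = of_int k"
    using ab j by (auto simp: in_grid_line_iff)
  have K: "\<lceil>level i y\<rceil> = \<lceil>level i z\<rceil> \<and> \<lceil>level i y'\<rceil> = \<lceil>level i z\<rceil>" if i: "i < r" "i \<noteq> j" for i
  proof -
    have "level i a \<noteq> level i b"
    proof
      assume "level i a = level i b"
      then have "(a - b) \<bullet> nrm i = 0" using level_diff[of i a b] spacing_pos[OF i(1)] by simp
      moreover have "(a - b) \<bullet> nrm j = 0" using level_diff[of j a b] spacing_pos[OF j(1)] lj by simp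
      ultimately have "a - b = 0"
        using orthogonal_to_basis_imp_0 normals_not_parallel[OF i(1) j(1) i(2)] by blast
      then show False using A(2) by simp
    qed
    moreover have "of_int \<lceil>level i y\<rceil> - 1 \<le> level i a" "level i a \<le> of_int \<lceil>level i y\<rceil>"
      "of_int \<lceil>level i y\<rceil> - 1 \<le> level i b" "level i b \<le> of_int \<lceil>level i y\<rceil>"
      "of_int \<lceil>level i y'\<rceil> - 1 \<le> level i a" "level i a \<le> of_int \<lceil>level i y'\<rceil>"
      "of_int \<lceil>level i y'\<rceil> - 1 \<le> level i b" "level i b \<le> of_int \<lceil>level i y'\<rceil>"
      using ab in_closure_cell_iff[OF C(1)] in_closure_cell_iff[OF D(1)] C D i by auto
    ultimately show ?thesis unfolding lz using ceiling_midpoint by metis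
  qed
  have kz: "\<lceil>level j z\<rceil> = k" using lj by simp
  have "of_int \<lceil>level j y\<rceil> - 1 \<le> real_of_int k \<and> real_of_int k \<le> of_int \<lceil>level j y\<rceil>"
    "of_int \<lceil>level j y'\<rceil> - 1 \<le> real_of_int k \<and> real_of_int k \<le> of_int \<lceil>level j y'\<rceil>"
    using ab in_closure_cell_iff[OF C(1), of z] in_closure_cell_iff[OF D(1), of z] C D j lj by auto
  then have kk: "\<lceil>level j y\<rceil> = k \<or> \<lceil>level j y\<rceil> = k + 1" "\<lceil>level j y'\<rceil> = k \<or> \<lceil>level j y'\<rceil> = k + 1"
    by linarith+
  have "\<lceil>level j y\<rceil> \<noteq> \<lceil>level j y'\<rceil>"
  proof
    assume "\<lceil>level j y\<rceil> = \<lceil>level j y'\<rceil>"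
    then have "cell y = cell y'" using K by (intro cell_cong) metis
    then show False using ne C D by simp
  qed
  then consider "\<lceil>level j y\<rceil> = k" "\<lceil>level j y'\<rceil> = k + 1" | "\<lceil>level j y\<rceil> = k + 1" "\<lceil>level j y'\<rceil> = k"
    using kk by auto
  then have "e = {dp z, dp z + edge_vec j}"
  proof cases
    case 1
    have "dp y = dp z + sum edge_vec {}" using K kz 1 by (intro dp_shift) auto
    moreover have "dp y' = dp z + sum edge_vec {j}" using K kz 1 j by (intro dp_shift) auto
    ultimately show ?thesis using e by simp
  next
    case 2
    have "dp y' = dp z + sum edge_vec {}" using K kz 2 by (intro dp_shift) auto
    moreover have "dp y = dp z + sum edge_vec {j}" using K kz 2 j by (intro dp_shift) auto
    ultimately show ?thesis using e by auto
  qed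
  moreover have "on_grid j z" using lj by (simp add: on_grid_def)
  ultimately show ?thesis using that j by blast
qed

text \<open>The regions below and above the line must share a whole segment, even if
  \<open>x\<close> is a crossing. At most one other grid passes through \<open>x\<close>, so one of
  the two directions along the line does not go up in it; left-continuity then preserves all
  ceilings along a short segment.\<close>

lemma edge_in_tiling_edges:
  assumes j: "j < r" "on_grid j x"
  shows "{dp x, dp x + edge_vec j} \<in> tiling_edges \<Gamma> len"
proof -
  obtain w where w: "w \<noteq> 0" "w \<bullet> nrm j = 0" "\<forall>i<r. on_grid i x \<longrightarrow> w \<bullet> nrm i \<le> 0"
  proof (cases "\<exists>i<r. i \<noteq> j \<and> on_grid i x \<and> perp (nrm j) \<bullet> nrm i > 0")
    case True
    then obtain i where i: "i < r" "i \<noteq> j" "on_grid i x" "perp (nrm j) \<bullet> nrm i > 0" by blast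
    show ?thesis
    proof (rule that[of "- perp (nrm j)"])
      show "\<forall>l<r. on_grid l x \<longrightarrow> - perp (nrm j) \<bullet> nrm l \<le> 0"
        using at_most_two_grids[OF i(1) j(1) _ i(3) j(2) _ i(2)] i(4) by force
    qed (use j normal_nonzero in auto)
  next
    case False
    show ?thesis
    proof (rule that[of "perp (nrm j)"])
      show "\<forall>l<r. on_grid l x \<longrightarrow> perp (nrm j) \<bullet> nrm l \<le> 0"
        using False by (metis linorder_not_less order_refl perp_inner_self(1))
    qed (use j normal_nonzero in auto)
  qed
  obtain y where y: "generic y" "\<forall>i<r. \<lceil>level i y\<rceil> = \<lceil>level i x\<rceil>" "dp y = dp x"
    by (rule region_at_corner[of "{}" x]) auto
  obtain y' where y': "generic y'" "\<forall>i<r. \<lceil>level i y'\<rceil> = \<lceil>level i x\<rceil> + (if i \<in> {j} then 1 else 0)"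
      "dp y' = dp x + edge_vec j"
    using j by (rule_tac region_at_corner[of "{j}" x]) auto
  have "((\<lambda>t. x + t *\<^sub>R w) \<longlongrightarrow> x + 0 *\<^sub>R w) (at_right (0::real))"
    by (intro tendsto_intros)
  then have "filterlim (\<lambda>t. x + t *\<^sub>R w) (nhds x) (at_right (0::real))" by simp
  from eventually_compose_filterlim[OF near_point this]
  have "\<forall>\<^sub>F t in at_right (0::real). \<forall>i<r. \<lceil>level i (x + t *\<^sub>R w)\<rceil> = \<lceil>level i x\<rceil> +
       (if on_grid i x \<and> t * (w \<bullet> nrm i) > 0 then 1 else 0)" by (simp add: eventually_mono)
  then obtain \<epsilon> :: real where \<epsilon>: "\<epsilon> > 0" and K: "\<And>t i. 0 < t \<Longrightarrow> t < \<epsilon> \<Longrightarrow> i < r \<Longrightarrow>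
      \<lceil>level i (x + t *\<^sub>R w)\<rceil> = \<lceil>level i x\<rceil>"
    unfolding eventually_at_right_field using w(3)
    by (auto simp: zero_less_mult_iff not_less split: if_splits) (metis not_le)
  have lj: "level j (x + t *\<^sub>R w) = level j x" for t using w by (simp add: level_add)
  have kj: "of_int \<lceil>level j x\<rceil> = level j x" using j by (auto simp: on_grid_def Ints_def)
  have cl: "x + t *\<^sub>R w \<in> closure (cell y) \<inter> closure (cell y')" if t: "0 \<le> t" "t < \<epsilon>" for t
  proof -
    have Kt: "\<lceil>level i (x + t *\<^sub>R w)\<rceil> = \<lceil>level i x\<rceil>" if "i < r" for i
      using K[of t i] t that by (cases "t = 0") auto
    have "x + t *\<^sub>R w \<in> closure (cell y)"
      unfolding in_closure_cell_iff[OF y(1)]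
    proof (intro allI impI)
      fix i assume "i < r"
      then show "of_int \<lceil>level i y\<rceil> - 1 \<le> level i (x + t *\<^sub>R w) \<and> level i (x + t *\<^sub>R w) \<le> of_int \<lceil>level i y\<rceil>"
        using Kt[of i] y(2) by (metis ceiling_correct less_imp_le)
    qed
    moreover have "x + t *\<^sub>R w \<in> closure (cell y')"
      unfolding in_closure_cell_iff[OF y'(1)]
    proof (intro allI impI)
      fix i assume i: "i < r"
      show "of_int \<lceil>level i y'\<rceil> - 1 \<le> level i (x + t *\<^sub>R w) \<and> level i (x + t *\<^sub>R w) \<le> of_int \<lceil>level i y'\<rceil>"
      proof (cases "i = j")
        case True
        then have "real_of_int \<lceil>level i y'\<rceil> = level i (x + t *\<^sub>R w) + 1" using y'(2) i lj kj by simp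
        then show ?thesis by simp
      next
        case False
        then have "\<lceil>level i y'\<rceil> = \<lceil>level i (x + t *\<^sub>R w)\<rceil>" using Kt y'(2) i by simp
        then show ?thesis by (metis ceiling_correct less_imp_le)
      qed
    qed
    ultimately show ?thesis by blast
  qed
  obtain k where k: "level j x = of_int k" using j by (auto simp: on_grid_def Ints_def)
  let ?b = "x + (\<epsilon>/2) *\<^sub>R w"
  have "closed_segment x ?b \<subseteq> grid_line \<Gamma> j k \<inter> closure (cell y) \<inter> closure (cell y')"
  proof
    fix z assume "z \<in> closed_segment x ?b"
    then obtain u where u: "0 \<le> u" "u \<le> 1" "z = (1 - u) *\<^sub>R x + u *\<^sub>R ?b"
      by (auto simp: in_segment)
    then have z: "z = x + (u * \<epsilon> / 2) *\<^sub>R w" by (simp add: algebra_simps)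
    have "u * \<epsilon> / 2 \<le> 1 * \<epsilon> / 2" using u \<epsilon> by (intro divide_right_mono mult_right_mono) auto
    then have "z \<in> closure (cell y) \<inter> closure (cell y')" unfolding z using u \<epsilon> by (intro cl) auto
    moreover have "z \<in> grid_line \<Gamma> j k" using j k lj unfolding z by (simp add: in_grid_line_iff)
    ultimately show "z \<in> grid_line \<Gamma> j k \<inter> closure (cell y) \<inter> closure (cell y')" by blast
  qed
  moreover have "x \<noteq> ?b" using \<epsilon> w by simp
  moreover have "cell y \<noteq> cell y'"
  proof
    assume "cell y = cell y'"
    then have "y \<in> cell y'" using generic_in_cell y by blast
    then have "\<lceil>level j y\<rceil> = \<lceil>level j y'\<rceil>" using j by (simp add: cell_def)
    then show False using y(2) y'(2) j by simp
  qed
  moreover have "grid_line \<Gamma> j k \<in> grid_lines \<Gamma>" using j by (auto simp: grid_lines_def)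
  ultimately have "adjacent_regions \<Gamma> (cell y) (cell y')"
    unfolding adjacent_regions_def using cell_region y(1) y'(1) by blast
  moreover have "y \<in> cell y" "y' \<in> cell y'" using y y' by (auto intro: generic_in_cell)
  ultimately show ?thesis unfolding tiling_edges_def using y(3) y'(3) by (smt (verit) mem_Collect_eq)
qed

lemma flex_iff:
  "infinitesimal_flex (tiling_framework \<Gamma> len) u \<longleftrightarrow>
    (\<forall>x j. j < r \<longrightarrow> on_grid j x \<longrightarrow> cdot (u (dp x + edge_vec j) - u (dp x)) (nrm j) = 0)"
proof -
  have *: "infinitesimal_flex (tiling_framework \<Gamma> len) u \<longleftrightarrow>
    (\<forall>v w. {v, w} \<in> tiling_edges \<Gamma> len \<longrightarrow> cdot (u v - u w) (v - w) = 0)"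
    by (simp add: infinitesimal_flex_def tiling_framework_def cdot_def)
  have len: "j < r \<Longrightarrow> len j \<noteq> 0" for j using len_pos by force
  show ?thesis unfolding *
  proof (intro iffI allI impI)
    fix x j assume a: "\<forall>v w. {v, w} \<in> tiling_edges \<Gamma> len \<longrightarrow> cdot (u v - u w) (v - w) = 0"
      and j: "j < r" "on_grid j x"
    have "{dp x + edge_vec j, dp x} \<in> tiling_edges \<Gamma> len"
      using edge_in_tiling_edges[OF j] by (simp add: insert_commute)
    then have "cdot (u (dp x + edge_vec j) - u (dp x)) (dp x + edge_vec j - dp x) = 0" using a by blast
    then show "cdot (u (dp x + edge_vec j) - u (dp x)) (nrm j) = 0"
      using len j by (simp add: edge_vec_def del: cdot_simps(2))
  next
    fix v w assume a: "\<forall>x j. j < r \<longrightarrow> on_grid j x \<longrightarrow> cdot (u (dp x + edge_vec j) - u (dp x)) (nrm j) = 0"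
      and "{v, w} \<in> tiling_edges \<Gamma> len"
    then obtain z j where z: "j < r" "on_grid j z" "{v, w} = {dp z, dp z + edge_vec j}"
      using tiling_edges_subset by metis
    have 0: "cdot (u (dp z + edge_vec j)) (nrm j) - cdot (u (dp z)) (nrm j) = 0" using a z by auto
    from z(3) consider "v = dp z" "w = dp z + edge_vec j" | "w = dp z" "v = dp z + edge_vec j"
      by (auto simp: doubleton_eq_iff)
    then show "cdot (u v - u w) (v - w) = 0"
    proof cases
      case 1
      then have "v - w = - (len j *\<^sub>R nrm j)" by (simp add: edge_vec_def)
      then show ?thesis using 0 1 by (simp add: edge_vec_def)
    next
      case 2
      then have "v - w = len j *\<^sub>R nrm j" by (simp add: edge_vec_def)
      then show ?thesis using 0 2 by (simp add: edge_vec_def)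
    qed
  qed
qed

text \<open>A region touching \<open>x\<close> exceeds the ceilings at \<open>x\<close> by 0 or 1,
  and by 1 only in grids through \<open>x\<close>; so its vertex is determined by a subset of the
  two crossing grids, and every subset occurs.\<close>

lemma tile_at_eq:
  assumes "i < r" "j < r" "i \<noteq> j" "on_grid i x" "on_grid j x"
  shows "tile_at \<Gamma> len x =
    convex hull {dp x, dp x + edge_vec i, dp x + edge_vec j, dp x + edge_vec i + edge_vec j}"
proof -
  have "{dp y | y C. C \<in> grid_regions \<Gamma> \<and> x \<in> closure C \<and> y \<in> C} =
     {dp x + sum edge_vec S | S. S \<subseteq> {i, j}}" (is "?L = ?R")
  proof
    show "?R \<subseteq> ?L"
    proof clarify
      fix S assume "S \<subseteq> {i, j}"
      then have "S \<subseteq> {l. l < r \<and> on_grid l x}" using assms by blast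
      then obtain y where "generic y" "x \<in> closure (cell y)" "dp y = dp x + sum edge_vec S"
        by (rule region_at_corner)
      then show "\<exists>y C. dp x + sum edge_vec S = dp y \<and> C \<in> grid_regions \<Gamma> \<and> x \<in> closure C \<and> y \<in> C"
        using cell_region generic_in_cell by metis
    qed
    show "?L \<subseteq> ?R"
    proof clarify
      fix y C assume C: "C \<in> grid_regions \<Gamma>" "x \<in> closure C" "y \<in> C"
      then have y: "generic y" "C = cell y" using region_cell by blast+
      let ?S = "{l. l < r \<and> \<lceil>level l y\<rceil> = \<lceil>level l x\<rceil> + 1}"
      have b: "of_int \<lceil>level l y\<rceil> - 1 \<le> level l x" "level l x \<le> of_int \<lceil>level l y\<rceil>" if "l < r" for l
        using C(2) y in_closure_cell_iff[OF y(1)] that by auto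
      have K: "\<lceil>level l y\<rceil> = \<lceil>level l x\<rceil> + (if l \<in> ?S then 1 else 0)" if l: "l < r" for l
        using b[OF l] l by auto linarith
      have "?S \<subseteq> {i, j}"
      proof
        fix l assume "l \<in> ?S"
        then have l: "l < r" "\<lceil>level l y\<rceil> = \<lceil>level l x\<rceil> + 1" by auto
        then have "level l x = of_int \<lceil>level l x\<rceil>" using b[OF l(1)] by linarith
        then have "on_grid l x" unfolding on_grid_def by (metis Ints_of_int)
        then show "l \<in> {i, j}" using at_most_two_grids assms l by blast
      qed
      moreover have "dp y = dp x + sum edge_vec ?S" using K by (intro dp_shift) auto
      ultimately show "\<exists>S. dp y = dp x + sum edge_vec S \<and> S \<subseteq> {i, j}" by blast
    qed
  qed
  also have "?R = (\<lambda>S. dp x + sum edge_vec S) ` Pow {i, j}" by auto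
  also have "\<dots> = {dp x, dp x + edge_vec i, dp x + edge_vec j, dp x + edge_vec i + edge_vec j}"
    using assms(3) by (auto simp: Pow_insert algebra_simps)
  finally show ?thesis by (simp add: tile_at_def)
qed

section \<open>Flexes and localisation lines\<close>

lemma joints_tiling_framework: "joints (tiling_framework \<Gamma> len) = range dp"
  by (simp add: joints_def tiling_framework_def tiling_vertices_eq)

text \<open>Integer combinations of three or more edge vectors may be dense, so discreteness uses
  the dual map: close vertices have preimages at bounded distance, because \<open>frame_op\<close>
  is bounded below. Their ceilings then differ by bounded amounts, leaving a finite set
  \<open>F\<close> of differences, whose least nonzero norm (capped at 1) separates the
  vertices.\<close>

lemma uniform_discrete_range_dp: "uniform_discrete (range dp)"
proof -
  obtain E where E: "E > 0" "\<And>x. norm (dp x - frame_op x) \<le> E" using dp_near_frame_op by blast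
  obtain B where B: "B > 0" "\<And>x. B * norm x \<le> norm (frame_op x)"
    using linear_inj_bounded_below_pos[OF linear_frame_op inj_frame_op] by metis
  define D where "D = (1 + 2 * E) / B"
  define Q where "Q = \<lceil>\<Sum>j<r. D / spacing \<Gamma> j + 1\<rceil>"
  have D: "D \<ge> 0" using E B by (simp add: D_def)
  define F where "F = (\<lambda>m. \<Sum>j<r. real_of_int (m j) *\<^sub>R edge_vec j) ` (PiE {..<r} (\<lambda>_. {-Q..Q}))"
  have fin: "finite F" unfolding F_def by (intro finite_imageI finite_PiE) auto
  have diff: "dp x - dp y \<in> F" if "dist (dp x) (dp y) < 1" for x y
  proof -
    have "norm (frame_op (x - y)) \<le> norm (dp x - dp y) + norm (dp x - frame_op x) + norm (dp y - frame_op y)"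
    proof -
      have "frame_op (x - y) = (dp x - dp y) - (dp x - frame_op x) + (dp y - frame_op y)"
        by (simp add: linear_diff[OF linear_frame_op])
      moreover have "norm (a - b + c) \<le> norm a + norm b + norm c" for a b c :: "real^2"
        using norm_triangle_ineq[of "a - b" c] norm_triangle_ineq4[of a b] by linarith
      ultimately show ?thesis by metis
    qed
    also have "\<dots> \<le> 1 + 2 * E" using E(2)[of x] E(2)[of y] that by (simp add: dist_norm)
    finally have "B * norm (x - y) \<le> 1 + 2 * E" using B(2)[of "x - y"] by linarith
    then have xy: "norm (x - y) \<le> D" unfolding D_def using B by (simp add: field_simps)
    have K: "\<lceil>level j x\<rceil> - \<lceil>level j y\<rceil> \<in> {-Q..Q}" if j: "j < r" for j
    proof -
      have "\<bar>(x - y) \<bullet> nrm j\<bar> \<le> norm (x - y) * norm (nrm j)" by (rule Cauchy_Schwarz_ineq2)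
      then have "\<bar>(x - y) \<bullet> nrm j\<bar> \<le> D" using xy j by simp
      then have "\<bar>level j x - level j y\<bar> \<le> D / spacing \<Gamma> j"
        using level_diff[of j x y] spacing_pos[OF j] by (simp add: divide_right_mono)
      then have "\<bar>real_of_int (\<lceil>level j x\<rceil> - \<lceil>level j y\<rceil>)\<bar> \<le> D / spacing \<Gamma> j + 1" by linarith
      also have "\<dots> \<le> (\<Sum>j<r. D / spacing \<Gamma> j + 1)"
      proof (rule member_le_sum)
        fix i assume "i \<in> {..<r} - {j}"
        then show "0 \<le> D / spacing \<Gamma> i + 1" using D spacing_pos[of i] by simp
      qed (use j in auto)
      also have "\<dots> \<le> of_int Q" unfolding Q_def by linarith
      finally show ?thesis unfolding atLeastAtMost_iff by linarith
    qed
    let ?m = "\<lambda>j\<in>{..<r}. \<lceil>level j x\<rceil> - \<lceil>level j y\<rceil>"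
    have "dp x - dp y = (\<Sum>j<r. real_of_int (?m j) *\<^sub>R edge_vec j)"
      unfolding dp_eq sum_subtractf[symmetric] by (intro sum.cong) (auto simp: scaleR_diff_left)
    moreover have "?m \<in> PiE {..<r} (\<lambda>_. {-Q..Q})"
      by (rule restrict_PiE_iff[THEN iffD2]) (use K in blast)
    ultimately show ?thesis unfolding F_def by (intro image_eqI[where x = ?m])
  qed
  define e where "e = Min (insert 1 (norm ` (F - {0})))"
  have e0: "e > 0" and e1: "e \<le> 1" unfolding e_def using fin by auto
  have "x = y" if xy: "x \<in> range dp" "y \<in> range dp" "dist x y < e" for x y
  proof (rule ccontr)
    assume "x \<noteq> y"
    then have "x - y \<in> F - {0}" using xy diff e1 by force
    then have "e \<le> norm (x - y)" unfolding e_def using fin by auto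
    then show False using xy by (simp add: dist_norm)
  qed
  then show ?thesis unfolding uniform_discrete_def using e0 by blast
qed

lemma Delone_set_range_dp: "Delone_set (range dp)"
proof -
  obtain E where E: "\<And>x. norm (dp x - frame_op x) \<le> E" using dp_near_frame_op by blast
  have "\<exists>y\<in>range dp. dist p y \<le> E" for p
  proof -
    obtain x where "p = frame_op x" using surj_frame_op by (metis surjD)
    then show ?thesis using E[of x] by (auto simp: dist_norm norm_minus_commute)
  qed
  then show ?thesis
    unfolding Delone_set_def relatively_dense_def using uniform_discrete_range_dp by blast
qed

lemma Delone_framework_tiling: "Delone_framework (tiling_framework \<Gamma> len)"
proof -
  have "range dp \<subseteq> (\<lambda>m. \<Sum>j<r. real_of_int (m j) *\<^sub>R edge_vec j) ` (PiE {..<r} (\<lambda>_. UNIV))"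
  proof
    fix p assume "p \<in> range dp"
    then obtain x where "p = dp x" by blast
    then have "p = (\<Sum>j<r. real_of_int ((\<lambda>j\<in>{..<r}. \<lceil>level j x\<rceil>) j) *\<^sub>R edge_vec j)" by (simp add: dp_eq)
    then show "p \<in> (\<lambda>m. \<Sum>j<r. real_of_int (m j) *\<^sub>R edge_vec j) ` (PiE {..<r} (\<lambda>_. UNIV))"
      by (intro image_eqI[where x = "\<lambda>j\<in>{..<r}. \<lceil>level j x\<rceil>"]) auto
  qed
  moreover have "countable (PiE {..<r} (\<lambda>_. UNIV :: int set))"
    by (rule countable_PiE) auto
  ultimately have c: "countable (range dp)" by (meson countable_image countable_subset)
  have e: "\<exists>v\<in>range dp. \<exists>w\<in>range dp. v \<noteq> w \<and> e = {v, w}" if "e \<in> tiling_edges \<Gamma> len" for e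
    using that
  proof (rule tiling_edges_subset)
    fix z j assume "j < r" "on_grid j z" "e = {dp z, dp z + edge_vec j}"
    then show ?thesis using dp_plus_edge_vec edge_vec_nonzero
      by (intro bexI[of _ "dp z"] bexI[of _ "dp z + edge_vec j"]) auto
  qed
  have len: "norm (v - w) \<le> sum len {..<r}" if "{v, w} \<in> tiling_edges \<Gamma> len" for v w
    using that
  proof (rule tiling_edges_subset)
    fix z j assume j: "j < r" "{v, w} = {dp z, dp z + edge_vec j}"
    then have "norm (v - w) = len j" using len_pos by (auto simp: doubleton_eq_iff edge_vec_def)
    also have "\<dots> \<le> sum len {..<r}" using j len_pos by (intro member_le_sum) (auto intro: less_imp_le)
    finally show ?thesis .
  qed
  show ?thesis
    unfolding Delone_framework_def bar_joint_framework_def joints_tiling_framework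
    using c e len Delone_set_range_dp
    by (auto simp: tiling_framework_def tiling_vertices_eq)
qed

section \<open>Jumps of a flex along a ribbon\<close>

lemma move_along_grid_line:
  assumes "i < r" "j < r" "i \<noteq> j" "on_grid i z" "on_grid j z"
  obtains z' where "on_grid j z'" "dp z' = dp z + edge_vec i"
proof -
  \<comment> \<open>A direction along the line of the \<open>j\<close>th grid and upwards across the
    \<open>i\<close>th: a short move reaches a base point of the opposite side of the tile.\<close>
  obtain v where v: "\<forall>l<r. on_grid l z \<longrightarrow> v \<bullet> nrm l = (if l = i then 1 else 0)"
    using direction_with_signs[of z "\<lambda>l. if l = i then 1 else 0"] by blast
  have "\<forall>\<^sub>F t in at_right (0::real). dp (z + t *\<^sub>R v) = dp z + sum edge_vec {l. l < r \<and> on_grid l z \<and> t * (v \<bullet> nrm l) > 0}"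
    using dp_near_line[of z v] by (simp add: eventually_at_filter eventually_mono)
  moreover have "\<forall>\<^sub>F t in at_right (0::real). t > 0" by (simp add: eventually_at_right_less)
  ultimately have "\<forall>\<^sub>F t in at_right (0::real). t > 0 \<and> dp (z + t *\<^sub>R v) = dp z + sum edge_vec {l. l < r \<and> on_grid l z \<and> t * (v \<bullet> nrm l) > 0}"
    by eventually_elim simp
  from eventually_happens'[OF trivial_limit_at_right_real this]
  obtain t where t: "t > 0" "dp (z + t *\<^sub>R v) = dp z + sum edge_vec {l. l < r \<and> on_grid l z \<and> t * (v \<bullet> nrm l) > 0}"
    by blast
  have "{l. l < r \<and> on_grid l z \<and> t * (v \<bullet> nrm l) > 0} = {i}"
    using v t(1) assms by (auto split: if_splits)
  moreover have "on_grid j (z + t *\<^sub>R v)" using v assms by (simp add: on_grid_def level_add)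
  ultimately show ?thesis using that t by simp
qed

text \<open>The difference \<open>?f\<close> of the two jumps is a second difference, symmetric in
  \<open>i\<close> and \<open>j\<close>. Grouped one way, the two \<open>j\<close>-edges make it
  orthogonal to \<open>nrm j\<close>; grouped the other way, the two \<open>i\<close>-edges make it
  orthogonal to \<open>nrm i\<close>. These normals are independent.\<close>

lemma flex_parallelogram:
  assumes "infinitesimal_flex (tiling_framework \<Gamma> len) U"
    and ij: "i < r" "j < r" "i \<noteq> j" "on_grid i z" "on_grid j z"
  shows "U (dp z + edge_vec i + edge_vec j) - U (dp z + edge_vec i) = U (dp z + edge_vec j) - U (dp z)"
proof -
  have flex: "cdot (U (dp x + edge_vec l) - U (dp x)) (nrm l) = 0" if "l < r" "on_grid l x" for x l
    using assms(1) that unfolding flex_iff by blast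
  obtain z1 where z1: "on_grid j z1" "dp z1 = dp z + edge_vec i"
    using move_along_grid_line[OF ij] .
  obtain z2 where z2: "on_grid i z2" "dp z2 = dp z + edge_vec j"
    using move_along_grid_line[OF ij(2,1) ij(3)[symmetric] ij(5,4)] .
  have c: "dp z + edge_vec j + edge_vec i = dp z + edge_vec i + edge_vec j" by simp
  let ?f = "(U (dp z + edge_vec i + edge_vec j) - U (dp z + edge_vec i)) - (U (dp z + edge_vec j) - U (dp z))"
  have "cdot ?f (nrm j) = 0"
    using flex[OF ij(2) z1(1)] flex[OF ij(2) ij(5)] by (simp add: z1(2))
  moreover have "cdot ?f (nrm i) = 0"
    using flex[OF ij(1) z2(1)] flex[OF ij(1) ij(4)] by (simp add: z2(2) c)
  ultimately have "?f = 0" using cdot_eq_0_imp[OF normals_not_parallel[OF ij(1-3)]] by blast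
  then show ?thesis by simp
qed

text \<open>As a function of the position on the grid line the jump is locally constant: near each
  position at most one other grid is crossed, and then the jumps before and after belong to opposite
  sides of one tile.\<close>

lemma flex_jump_constant:
  assumes flex: "infinitesimal_flex (tiling_framework \<Gamma> len) U" and j: "j < r" "on_grid j x"
  shows "U (dp x + edge_vec j) - U (dp x) =
    U (dp (x + t *\<^sub>R perp (nrm j)) + edge_vec j) - U (dp (x + t *\<^sub>R perp (nrm j)))"
proof -
  define g where "g t = U (dp (x + t *\<^sub>R perp (nrm j)) + edge_vec j) - U (dp (x + t *\<^sub>R perp (nrm j)))" for t
  have "g 0 = g t"
  proof (rule connected_local_const[of UNIV 0 t g], goal_cases)
    case 4
    show ?case
    proof
      fix a
      let ?z = "x + a *\<^sub>R perp (nrm j)"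
      have onz: "on_grid j ?z" using j by (simp add: on_grid_def level_add)
      have "((\<lambda>b. b - a) \<longlongrightarrow> a - a) (nhds a)" by (intro tendsto_intros filterlim_ident)
      then have "filterlim (\<lambda>b. b - a) (nhds 0) (nhds a)" by simp
      from eventually_compose_filterlim[OF dp_near_line[of ?z "perp (nrm j)"] this]
      have "\<forall>\<^sub>F b in nhds a. dp (?z + (b - a) *\<^sub>R perp (nrm j)) =
          dp ?z + sum edge_vec {i. i < r \<and> on_grid i ?z \<and> (b - a) * (perp (nrm j) \<bullet> nrm i) > 0}" .
      then have "\<forall>\<^sub>F b in nhds a. g a = g b"
      proof eventually_elim
        case (elim b)
        let ?S = "{i. i < r \<and> on_grid i ?z \<and> (b - a) * (perp (nrm j) \<bullet> nrm i) > 0}"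
        have eq: "?z + (b - a) *\<^sub>R perp (nrm j) = x + b *\<^sub>R perp (nrm j)" by (simp add: algebra_simps)
        show ?case
        proof (cases "?S = {}")
          case True
          have "dp (x + b *\<^sub>R perp (nrm j)) = dp ?z" using elim unfolding eq True by simp
          then show ?thesis unfolding g_def by simp
        next
          case False
          then obtain i where i: "i \<in> ?S" by blast
          then have ij: "i \<noteq> j" by auto
          have "?S \<subseteq> {i}"
          proof
            fix l assume l: "l \<in> ?S"
            then have "l \<noteq> j" by auto
            then show "l \<in> {i}" using at_most_two_grids[of i j l ?z] i l j onz ij by blast
          qed
          then have S: "?S = {i}" using i by blast
          have "dp (x + b *\<^sub>R perp (nrm j)) = dp ?z + edge_vec i" using elim unfolding eq S by simp
          then show ?thesis unfolding g_def
            using flex_parallelogram[OF flex _ j(1) ij _ onz] i by simp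
        qed
      qed
      then show "\<forall>\<^sub>F b in at a. g a = g b" by (simp add: eventually_at_filter eventually_mono)
    qed
  qed auto
  then show ?thesis by (simp add: g_def)
qed

text \<open>Nearby points have vertices that differ by at most two edge vectors. With two, the
  second edge starts at \<open>dp x + edge_vec i\<close>, and its base point comes from moving along
  the line of the other grid.\<close>

lemma flex_without_jumps_constant:
  assumes 0: "\<And>x j. j < r \<Longrightarrow> on_grid j x \<Longrightarrow> U (dp x + edge_vec j) = U (dp x)"
  shows "U (dp x) = U (dp y)"
proof (rule connected_local_const[of UNIV x y "\<lambda>x. U (dp x)"], goal_cases)
  case 4
  show ?case
  proof
    fix x
    have "\<forall>\<^sub>F y in nhds x. U (dp x) = U (dp y)"
      using dp_near_point[of x]
    proof eventually_elim
      case (elim y)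
      let ?S = "{j. j < r \<and> on_grid j x \<and> (y - x) \<bullet> nrm j > 0}"
      show ?case
      proof (cases "?S = {}")
        case True
        show ?thesis using elim unfolding True by simp
      next
        case False
        then obtain i where i: "i \<in> ?S" by blast
        show ?thesis
        proof (cases "?S = {i}")
          case True
          have "dp y = dp x + edge_vec i" using elim unfolding True by simp
          then show ?thesis using 0 i by simp
        next
          case False
          then obtain l where l: "l \<in> ?S" "l \<noteq> i" using i by blast
          then have S: "?S = {i, l}" using i at_most_two_grids[of i l _ x] by blast
          have "dp y = dp x + edge_vec i + edge_vec l" using elim l(2) unfolding S by (simp add: add.assoc)
          moreover obtain z where "on_grid l z" "dp z = dp x + edge_vec i"
            using move_along_grid_line[of i l x] i l by blast
          ultimately have "U (dp y) = U (dp x + edge_vec i)" using 0[of l z] l by simp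
          then show ?thesis using 0[of i x] i by simp
        qed
      qed
    qed
    then show "\<forall>\<^sub>F y in at x. U (dp x) = U (dp y)" by (simp add: eventually_at_filter eventually_mono)
  qed
qed auto

section \<open>Localisation forces a ribbon direction\<close>

definition ribbon_line :: "nat \<Rightarrow> (real^2) set" where
  "ribbon_line j = span {frame_op (perp (nrm j))}"

lemma localised_flex_direction:
  assumes basis: "perp T1 \<bullet> T2 \<noteq> 0" and "norm \<omega>1 = 1" and u0: "u (dp x0) \<noteq> 0"
    and flex: "\<And>\<omega>. norm \<omega> = 1 \<Longrightarrow>
      infinitesimal_flex (tiling_framework \<Gamma> len) (modulation (phase_field \<omega>1 \<omega> T1 T2) u)"
  shows "\<exists>j<r. span {T1} = ribbon_line j"
proof (rule ccontr)
  assume "\<not> (\<exists>j<r. span {T1} = ribbon_line j)"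
  then have not_line: "span {T1} \<noteq> span {frame_op (perp (nrm j))}" if "j < r" for j
    using that by (auto simp: ribbon_line_def)
  \<comment> \<open>\<open>f\<close> is the coordinate along \<open>T2\<close>, whose floor numbers
    the strips, and \<open>c\<close> is the phase contributed by the \<open>T1\<close> coordinate.
    \<open>U\<close> keeps the strip \<open>m0\<close> of a vertex where \<open>u\<close> does not
    vanish.\<close>
  define f where "f p = perp T1 \<bullet> p / (perp T1 \<bullet> T2)" for p
  define c where "c p = \<omega>1 powi \<lfloor>perp T2 \<bullet> p / (perp T2 \<bullet> T1)\<rfloor>" for p
  define m0 where "m0 = \<lfloor>f (dp x0)\<rfloor>"
  define U where "U p = (if \<lfloor>f p\<rfloor> = m0 then c p *s u p else 0)" for p
  have f_add: "f (p + q) = f p + f q" "f (a *\<^sub>R p) = a * f p" for p q a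
    by (simp_all add: f_def inner_add_right add_divide_distrib)
  have T1: "T1 \<noteq> 0" using basis by auto
  have U: "infinitesimal_flex (tiling_framework \<Gamma> len) U"
    unfolding flex_iff
  proof (intro allI impI)
    fix x j assume j: "j < r" "on_grid j x"
    define p q where "p = dp x" and "q = dp x + edge_vec j"
    have *: "\<omega> powi \<lfloor>f q\<rfloor> * (c q * cdot (u q) (nrm j)) = \<omega> powi \<lfloor>f p\<rfloor> * (c p * cdot (u p) (nrm j))"
      if "norm \<omega> = 1" for \<omega>
    proof -
      have "cdot (modulation (phase_field \<omega>1 \<omega> T1 T2) u q - modulation (phase_field \<omega>1 \<omega> T1 T2) u p) (nrm j) = 0"
        using flex[OF that] j unfolding flex_iff p_def q_def by blast
      then show ?thesis
        by (simp add: modulation_def phase_field_eq[OF basis] c_def f_def algebra_simps)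
    qed
    have "cdot (U q - U p) (nrm j) = 0"
    proof (cases "\<lfloor>f q\<rfloor> = \<lfloor>f p\<rfloor>")
      case True
      then show "cdot (U q - U p) (nrm j) = 0" using *[of 1] by (simp add: U_def)
    next
      case False
      \<comment> \<open>An edge joining two strips carries two different powers of
        \<open>\<omega>\<close>, so each end satisfies the edge condition by itself and either may
        be replaced by zero.\<close>
      have "c q * cdot (u q) (nrm j) = 0" "c p * cdot (u p) (nrm j) = 0"
        using phase_polynomial_eq_0[OF * False] by blast+
      then show "cdot (U q - U p) (nrm j) = 0" by (auto simp: U_def)
    qed
    then show "cdot (U (dp x + edge_vec j) - U (dp x)) (nrm j) = 0" by (simp only: p_def q_def)
  qed
  obtain E where E: "\<And>x. norm (dp x - frame_op x) \<le> E" using dp_near_frame_op by blast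
  define C where "C = norm (perp T1) / \<bar>perp T1 \<bullet> T2\<bar>"
  have f_le: "\<bar>f p\<bar> \<le> C * norm p" for p
    using Cauchy_Schwarz_ineq2[of "perp T1" p] unfolding f_def C_def
    by (simp add: divide_right_mono)
  have exit: "\<exists>t. \<lfloor>f (dp (x + t *\<^sub>R perp (nrm j)))\<rfloor> \<noteq> m0 \<and>
      \<lfloor>f (dp (x + t *\<^sub>R perp (nrm j)) + edge_vec j)\<rfloor> \<noteq> m0" if j: "j < r" for x j
  proof -
    define l where "l = f (frame_op (perp (nrm j)))"
    have "frame_op (perp (nrm j)) \<noteq> 0" using j normal_nonzero by (simp add: frame_op_eq_0_iff)
    \<comment> \<open>\<open>l\<close> is the speed of \<open>f\<close> along the ribbon; it is
      nonzero exactly because the ribbon direction is not parallel to \<open>T1\<close>.\<close>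
    then have l: "l \<noteq> 0" unfolding l_def f_def
      using not_line[OF j] span_singleton_eq_iff_perp[OF T1] basis by simp
    \<comment> \<open>Far enough to absorb the starting value, the distance from \<open>dp\<close>
      to \<open>frame_op\<close> and the length of the edge, so that both ends lie beyond strip
      \<open>m0\<close>.\<close>
    define t where "t = (\<bar>f (frame_op x)\<bar> + C * E + C * norm (edge_vec j) + \<bar>of_int m0\<bar> + 2) / l"
    let ?y = "x + t *\<^sub>R perp (nrm j)"
    have "f (dp ?y) = f (dp ?y - frame_op ?y) + f (frame_op ?y)" by (simp flip: f_add(1))
    moreover have "\<bar>f (dp ?y - frame_op ?y)\<bar> \<le> C * E"
      using f_le[of "dp ?y - frame_op ?y"] mult_left_mono[OF E[of ?y], of C] by (simp add: C_def)
    moreover have "f (frame_op ?y) = f (frame_op x) + t * l"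
      by (simp add: frame_op_add frame_op_scaleR f_add l_def)
    moreover have "t * l = \<bar>f (frame_op x)\<bar> + C * E + C * norm (edge_vec j) + \<bar>of_int m0\<bar> + 2"
      using l by (simp add: t_def)
    ultimately have 1: "f (dp ?y) \<ge> \<bar>of_int m0\<bar> + 2 + C * norm (edge_vec j)" by linarith
    moreover have "C * norm (edge_vec j) \<ge> 0" by (simp add: C_def)
    moreover have "f (dp ?y + edge_vec j) \<ge> \<bar>of_int m0\<bar> + 2"
      using 1 f_le[of "edge_vec j"] unfolding f_add by linarith
    ultimately have "\<lfloor>f (dp ?y)\<rfloor> > m0" "\<lfloor>f (dp ?y + edge_vec j)\<rfloor> > m0" by linarith+
    then show ?thesis by (intro exI[of _ t]) auto
  qed
  have "U (dp x + edge_vec j) = U (dp x)" if j: "j < r" "on_grid j x" for x j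
  proof -
    obtain t where "\<lfloor>f (dp (x + t *\<^sub>R perp (nrm j)))\<rfloor> \<noteq> m0"
      "\<lfloor>f (dp (x + t *\<^sub>R perp (nrm j)) + edge_vec j)\<rfloor> \<noteq> m0" using exit[OF j(1)] by blast
    then have "U (dp (x + t *\<^sub>R perp (nrm j)) + edge_vec j) - U (dp (x + t *\<^sub>R perp (nrm j))) = 0"
      by (simp add: U_def)
    then show ?thesis using flex_jump_constant[OF U j, of t] by simp
  qed
  note const = flex_without_jumps_constant[of U, OF this]
  \<comment> \<open>A constant field is zero once it is zero at one vertex; any grid line leads to a
    vertex outside the strip.\<close>
  have "0 < r" using two_grids by simp
  then obtain t where "\<lfloor>f (dp (0 + t *\<^sub>R perp (nrm 0)))\<rfloor> \<noteq> m0" using exit[of 0 0] by blast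
  then have "U (dp (0 + t *\<^sub>R perp (nrm 0))) = 0" by (simp add: U_def)
  then have "U (dp x0) = 0" using const by metis
  moreover have "c (dp x0) \<noteq> 0" unfolding c_def using \<open>norm \<omega>1 = 1\<close> by auto
  ultimately show False using u0 by (simp add: U_def m0_def vec_eq_iff)
qed

lemma periodic_localisation_line_direction:
  assumes "periodic_localisation_line (tiling_framework \<Gamma> len) H"
  shows "\<exists>j<r. H = ribbon_line j"
proof -
  obtain t1 t2 where H: "H = span {t1}" and b: "plane_basis t1 t2" and
    ex: "\<exists>u. \<exists>\<omega>1\<in>sphere 0 1. \<exists>M1 M2 :: nat.
       (\<exists>x\<in>range dp. u x \<noteq> 0) \<and> M1 > 0 \<and> M2 > 0 \<and>
       (\<forall>\<omega>\<in>sphere 0 1. infinitesimal_flex (tiling_framework \<Gamma> len)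
          (modulation (phase_field \<omega>1 \<omega> (real M1 *\<^sub>R t1) (real M2 *\<^sub>R t2)) u))"
    using assms unfolding periodic_localisation_line_def joints_tiling_framework
    by (metis zero_less_one)
  then obtain u \<omega>1 M1 M2 x where *: "\<omega>1 \<in> sphere 0 1" "u (dp x) \<noteq> 0" "M1 > (0::nat)" "M2 > (0::nat)"
    "\<forall>\<omega>\<in>sphere 0 1. infinitesimal_flex (tiling_framework \<Gamma> len)
          (modulation (phase_field \<omega>1 \<omega> (real M1 *\<^sub>R t1) (real M2 *\<^sub>R t2)) u)"
    by blast
  have "perp (real M1 *\<^sub>R t1) \<bullet> (real M2 *\<^sub>R t2) = real M1 * real M2 * (perp t1 \<bullet> t2)"
    by (simp add: inner_2 algebra_simps)
  then have "perp (real M1 *\<^sub>R t1) \<bullet> (real M2 *\<^sub>R t2) \<noteq> 0"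
    using b * by (simp add: plane_basis_iff_perp)
  then have "\<exists>j<r. span {real M1 *\<^sub>R t1} = ribbon_line j"
    using * by (intro localised_flex_direction[where u = u and ?T2.0 = "real M2 *\<^sub>R t2" and ?\<omega>1.0 = \<omega>1]) auto
  moreover have "span {real M1 *\<^sub>R t1} = span {t1}"
    using span_image_scale[of "{t1}" "\<lambda>_. real M1"] * by simp
  ultimately show ?thesis using H by simp
qed

section \<open>Slippage lines\<close>

text \<open>Such a field changes only across edges of the \<open>j\<close>th grid. These are
  parallel to \<open>nrm j\<close>, to which \<open>\<beta>\<close> is orthogonal.\<close>

lemma flex_of_level_function:
  assumes j: "j < r" and u: "\<And>x. u (dp x) = g \<lceil>level j x\<rceil> *s \<beta>" and \<beta>: "cdot \<beta> (nrm j) = 0"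
  shows "infinitesimal_flex (tiling_framework \<Gamma> len) u"
  unfolding flex_iff
proof (intro allI impI)
  fix x l assume l: "l < r" "on_grid l x"
  obtain y where y: "\<forall>i<r. \<lceil>level i y\<rceil> = \<lceil>level i x\<rceil> + (if i \<in> {l} then 1 else 0)"
    "dp y = dp x + edge_vec l"
    using l by (rule_tac region_at_corner[of "{l}" x]) auto
  show "cdot (u (dp x + edge_vec l) - u (dp x)) (nrm l) = 0"
  proof (cases "l = j")
    case True
    then show ?thesis using \<beta> unfolding y(2)[symmetric] u by simp
  next
    case False
    then have "\<lceil>level j y\<rceil> = \<lceil>level j x\<rceil>" using y(1) j by simp
    then have "u (dp y) = u (dp x)" by (simp only: u)
    then show ?thesis by (simp add: y(2))
  qed
qed

lemma frame_op_basis: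
  assumes j: "j < r"
  shows "perp (frame_op (perp (nrm j))) \<bullet> frame_op (nrm j) \<noteq> 0"
proof
  assume 0: "perp (frame_op (perp (nrm j))) \<bullet> frame_op (nrm j) = 0"
  have "frame_op (perp (nrm j)) \<noteq> 0" using j normal_nonzero by (simp add: frame_op_eq_0_iff)
  then have "frame_op (nrm j) \<in> span {frame_op (perp (nrm j))}"
    using 0 by (simp add: in_span_singleton_iff_perp)
  then obtain a where "frame_op (nrm j) = a *\<^sub>R frame_op (perp (nrm j))" by (auto simp: span_singleton)
  then have "nrm j = a *\<^sub>R perp (nrm j)" using inj_frame_op by (simp flip: frame_op_scaleR add: inj_eq)
  then have "nrm j \<bullet> nrm j = 0" by (metis inner_scaleR_left mult_zero_right perp_inner_self(1))
  then show False using j normal_nonzero by simp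
qed

text \<open>The functional that vanishes on the ribbon direction reads off, up to scale, the
  coordinate normal to the \<open>j\<close>th grid. This is what makes cuts parallel to the ribbon
  line comparable with grid levels.\<close>

lemma frame_op_coordinate:
  assumes j: "j < r"
  shows "perp (frame_op (perp (nrm j))) \<bullet> frame_op y
    = (y \<bullet> nrm j) * (perp (frame_op (perp (nrm j))) \<bullet> frame_op (nrm j))"
proof -
  have u: "perp (nrm j) \<bullet> perp (nrm j) = 1" "nrm j \<bullet> nrm j = 1" using j by (simp_all add: dot_square_norm)
  have "perp (nrm j) \<bullet> (y - (y \<bullet> nrm j) *\<^sub>R nrm j - (y \<bullet> perp (nrm j)) *\<^sub>R perp (nrm j)) = 0"
    "nrm j \<bullet> (y - (y \<bullet> nrm j) *\<^sub>R nrm j - (y \<bullet> perp (nrm j)) *\<^sub>R perp (nrm j)) = 0"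
    using u by (simp_all add: inner_diff_right inner_commute del: perp_inner_perp)
  then have "y - (y \<bullet> nrm j) *\<^sub>R nrm j - (y \<bullet> perp (nrm j)) *\<^sub>R perp (nrm j) = 0"
    using u by (intro orthogonal_to_basis_imp_0[of "nrm j" "perp (nrm j)"])
      (simp_all add: inner_commute)
  then have "y = (y \<bullet> nrm j) *\<^sub>R nrm j + (y \<bullet> perp (nrm j)) *\<^sub>R perp (nrm j)" by (simp add: algebra_simps)
  then have "frame_op y = (y \<bullet> nrm j) *\<^sub>R frame_op (nrm j) + (y \<bullet> perp (nrm j)) *\<^sub>R frame_op (perp (nrm j))"
    by (metis frame_op_add frame_op_scaleR)
  then show ?thesis by (simp add: inner_add_right)
qed

text \<open>The strips of the phase field are cut out by straight lines, while the flexes of the tiling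
  jump across ribbons, which only follow these lines up to a distance \<open>W\<close>. Hence the constant
  velocity field is set to zero between two ribbons on either side of each cut.\<close>

lemma slippage_flex:
  assumes j: "j < r" and \<epsilon>: "\<epsilon> > 0"
  defines "t1 \<equiv> frame_op (perp (nrm j))" and "t2 \<equiv> frame_op (nrm j)" and "b \<equiv> perp (nrm j)"
  shows "\<exists>u. \<exists>M::nat. infinitesimal_flex (tiling_framework \<Gamma> len) u \<and> M > 0 \<and>
     (\<forall>\<omega>\<in>sphere 0 1.
        infinitesimal_flex (tiling_framework \<Gamma> len) (modulation (phase_field 1 \<omega> t1 (real M *\<^sub>R t2)) u)) \<and>
     (\<forall>\<omega>\<in>sphere 0 1.
        mostly_close (range dp) \<epsilon>
          (modulation (phase_field 1 \<omega> t1 (real M *\<^sub>R t2)) u)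
          (modulation (phase_field 1 \<omega> t1 (real M *\<^sub>R t2)) (const_velocity b)))"
proof -
  have basis: "perp t1 \<bullet> t2 \<noteq> 0" unfolding t1_def t2_def by (rule frame_op_basis[OF j])
  \<comment> \<open>Scaled so that \<open>w \<bullet> p\<close> is the \<open>t2\<close> coordinate
    of \<open>p\<close> and \<open>w \<bullet> frame_op y\<close> equals
    \<open>y \<bullet> nrm j\<close>.\<close>
  define w where "w = (1 / (perp t1 \<bullet> t2)) *\<^sub>R perp t1"
  have "t1 \<noteq> 0" using basis by auto
  then have w0: "w \<noteq> 0" using basis by (simp add: w_def)
  have w_eq: "w \<bullet> p = perp t1 \<bullet> p / (perp t1 \<bullet> t2)" for p by (simp add: w_def)
  have w_frame: "w \<bullet> frame_op y = y \<bullet> nrm j" for y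
    using frame_op_coordinate[OF j, of y] basis by (simp add: w_eq t1_def t2_def)
  obtain E where E: "E > 0" "\<And>x. norm (dp x - frame_op x) \<le> E" using dp_near_frame_op by blast
  define s where "s = spacing \<Gamma> j"
  have s: "s > 0" using spacing_pos[OF j] by (simp add: s_def)
  \<comment> \<open>Three errors add up: the distance from \<open>dp\<close> to
    \<open>frame_op\<close>, the dropped shift, and the rounding of the level, worth one spacing
    \<open>s\<close>.\<close>
  define W where "W = norm w * E + \<bar>shift \<Gamma> j\<bar> + s"
  have W: "W \<ge> 0" unfolding W_def using E s by simp
  have near: "\<bar>w \<bullet> dp x - s * of_int \<lceil>level j x\<rceil>\<bar> \<le> W" for x
  proof -
    have "w \<bullet> dp x = w \<bullet> (dp x - frame_op x) + x \<bullet> nrm j" using w_frame[of x] by (simp add: inner_diff_right)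
    moreover have "\<bar>w \<bullet> (dp x - frame_op x)\<bar> \<le> norm w * norm (dp x - frame_op x)" by (rule Cauchy_Schwarz_ineq2)
    moreover have "norm w * norm (dp x - frame_op x) \<le> norm w * E" using E by (intro mult_left_mono) auto
    moreover have "s * level j x = x \<bullet> nrm j + shift \<Gamma> j" using s by (simp add: level_def s_def)
    moreover have "\<bar>s * of_int \<lceil>level j x\<rceil> - s * level j x\<bar> \<le> s"
    proof -
      have "\<bar>of_int \<lceil>level j x\<rceil> - level j x\<bar> \<le> 1" by linarith
      then have "s * \<bar>of_int \<lceil>level j x\<rceil> - level j x\<bar> \<le> s * 1" using s by (intro mult_left_mono) auto
      then show ?thesis using s by (simp add: abs_mult right_diff_distrib[symmetric])
    qed
    ultimately show ?thesis unfolding W_def by linarith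
  qed
  \<comment> \<open>A vertex is altered only if a cut lies within \<open>W\<close> of
    \<open>s\<close> times its rounded level; the vertex is within \<open>W\<close> of that value
    too, so it lies in a band of half-width \<open>2 * W\<close> around the cut.\<close>
  have "2 * W \<ge> 0" using W by simp
  obtain M :: nat and N0 where M: "M > 0" and sparse: "\<And>N c. N \<ge> N0 \<Longrightarrow>
      real (card {x \<in> range dp \<inter> (+) c ` cbox (vec (- N)) (vec N). \<exists>m::int. \<bar>w \<bullet> x - of_int m * real M\<bar> \<le> 2 * W})
        < \<epsilon> * real (card (range dp \<inter> (+) c ` cbox (vec (- N)) (vec N)))"
    by (rule Delone_sparse_bands[OF Delone_set_range_dp w0 \<open>2 * W \<ge> 0\<close> \<epsilon>]) (rule that)
  have M0: "real M > 0" using M by simp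
  \<comment> \<open>Bounds for the phase exponents of the vertices whose rounded level is
    \<open>k\<close>. If they agree, the phase depends on \<open>k\<close> alone; if not, a cut may
    run between such vertices and \<open>u\<close> is set to zero on all of them.\<close>
  define lo hi where "lo k = \<lfloor>(s * of_int k - W) / real M\<rfloor>" and "hi k = \<lfloor>(s * of_int k + W) / real M\<rfloor>" for k :: int
  \<comment> \<open>The level is recovered from the vertex; the choice of preimage is immaterial by
    \<open>dp_eq_imp_level_eq\<close>.\<close>
  define K where "K p = \<lceil>level j (SOME x. dp x = p)\<rceil>" for p
  have K: "K (dp x) = \<lceil>level j x\<rceil>" for x
    unfolding K_def using dp_eq_imp_level_eq[OF _ j] someI[of "\<lambda>y. dp y = dp x" x] by blast
  define \<beta> where "\<beta> = const_velocity b 0"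
  have \<beta>: "const_velocity b p = \<beta>" for p by (simp add: \<beta>_def const_velocity_def)
  have \<beta>0: "cdot \<beta> (nrm j) = 0" by (simp add: \<beta>_def const_velocity_def cdot_eq b_def algebra_simps)
  define u where "u p = (if lo (K p) = hi (K p) then \<beta> else 0)" for p
  have basis': "perp t1 \<bullet> (real M *\<^sub>R t2) \<noteq> 0" using basis M by simp
  have phase: "phase_field 1 \<omega> t1 (real M *\<^sub>R t2) p = \<omega> powi \<lfloor>w \<bullet> p / real M\<rfloor>" for \<omega> p
    unfolding phase_field_eq[OF basis'] by (simp add: w_eq mult.commute)
  have floor: "\<lfloor>w \<bullet> dp x / real M\<rfloor> = lo \<lceil>level j x\<rceil>" if "lo \<lceil>level j x\<rceil> = hi \<lceil>level j x\<rceil>" for x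
  proof -
    have "(s * of_int \<lceil>level j x\<rceil> - W) / real M \<le> w \<bullet> dp x / real M"
      "w \<bullet> dp x / real M \<le> (s * of_int \<lceil>level j x\<rceil> + W) / real M"
      using near[of x] M0 by (intro divide_right_mono; linarith)+
    then have "lo \<lceil>level j x\<rceil> \<le> \<lfloor>w \<bullet> dp x / real M\<rfloor>" "\<lfloor>w \<bullet> dp x / real M\<rfloor> \<le> hi \<lceil>level j x\<rceil>"
      unfolding lo_def hi_def by (auto intro: floor_mono)
    then show ?thesis using that by simp
  qed
  have mod_flex: "infinitesimal_flex (tiling_framework \<Gamma> len) (modulation (phase_field 1 \<omega> t1 (real M *\<^sub>R t2)) u)" for \<omega>
  proof (rule flex_of_level_function[OF j, of _ "\<lambda>k. if lo k = hi k then \<omega> powi lo k else 0" \<beta>])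
    fix x show "modulation (phase_field 1 \<omega> t1 (real M *\<^sub>R t2)) u (dp x) =
      (if lo \<lceil>level j x\<rceil> = hi \<lceil>level j x\<rceil> then \<omega> powi lo \<lceil>level j x\<rceil> else 0) *s \<beta>"
      using floor[of x] by (simp add: modulation_def phase u_def K)
  qed (rule \<beta>0)
  have "infinitesimal_flex (tiling_framework \<Gamma> len) u"
  proof (rule flex_of_level_function[OF j, of _ "\<lambda>k. if lo k = hi k then 1 else 0" \<beta>])
    fix x show "u (dp x) = (if lo \<lceil>level j x\<rceil> = hi \<lceil>level j x\<rceil> then 1 else 0) *s \<beta>"
      by (simp add: u_def K)
  qed (rule \<beta>0)
  moreover have "mostly_close (range dp) \<epsilon> (modulation (phase_field 1 \<omega> t1 (real M *\<^sub>R t2)) u)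
      (modulation (phase_field 1 \<omega> t1 (real M *\<^sub>R t2)) (const_velocity b))" for \<omega>
    unfolding mostly_close_def Let_def
  proof (intro exI[of _ N0] allI impI)
    fix N c assume N: "N0 \<le> N"
    let ?S = "range dp \<inter> (+) c ` cbox (vec (- N)) (vec N)"
    let ?v = "modulation (phase_field 1 \<omega> t1 (real M *\<^sub>R t2)) u"
    let ?z = "modulation (phase_field 1 \<omega> t1 (real M *\<^sub>R t2)) (const_velocity b)"
    let ?T = "{x \<in> ?S. \<exists>m::int. \<bar>w \<bullet> x - of_int m * real M\<bar> \<le> 2 * W}"
    have "{x \<in> ?S. norm (?v x - ?z x) > \<epsilon>} \<subseteq> ?T"
    proof
      fix p assume p: "p \<in> {x \<in> ?S. norm (?v x - ?z x) > \<epsilon>}"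
      then obtain x where x: "p = dp x" and n: "\<epsilon> < norm (?v (dp x) - ?z (dp x))" by blast
      let ?k = "\<lceil>level j x\<rceil>"
      have ne: "lo ?k \<noteq> hi ?k"
      proof
        assume "lo ?k = hi ?k"
        then have "?v (dp x) = ?z (dp x)" by (simp add: modulation_def u_def K \<beta>)
        then show False using n \<epsilon> by simp
      qed
      have "(s * of_int ?k - W) / real M \<le> (s * of_int ?k + W) / real M"
        using W M0 by (intro divide_right_mono) auto
      then have "lo ?k \<le> hi ?k" unfolding lo_def hi_def by (rule floor_mono)
      then have "lo ?k < hi ?k" using ne by simp
      then have "(s * of_int ?k - W) / real M < of_int (hi ?k)" unfolding lo_def by (simp add: floor_less_iff)
      moreover have "of_int (hi ?k) \<le> (s * of_int ?k + W) / real M" unfolding hi_def by (rule of_int_floor_le)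
      ultimately have "s * of_int ?k - W < of_int (hi ?k) * real M" "of_int (hi ?k) * real M \<le> s * of_int ?k + W"
        using M0 by (simp_all add: field_simps)
      then have "\<bar>w \<bullet> dp x - of_int (hi ?k) * real M\<bar> \<le> 2 * W" using near[of x] by linarith
      then show "p \<in> ?T" using p unfolding x by blast
    qed
    moreover have "finite ?T"
    proof -
      have "bounded ?S" by (intro bounded_Int disjI2 bounded_translation bounded_cbox)
      moreover have "uniform_discrete ?S" using uniform_discrete_range_dp unfolding uniform_discrete_def by blast
      ultimately have "finite ?S" using uniform_discrete_finite_iff by blast
      then show ?thesis by (rule finite_subset[rotated]) blast
    qed
    ultimately have "card {x \<in> ?S. norm (?v x - ?z x) > \<epsilon>} \<le> card ?T" by (intro card_mono)
    then show "real (card {x \<in> ?S. norm (?v x - ?z x) > \<epsilon>}) < \<epsilon> * real (card ?S)"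
      using sparse[OF N, of c] by linarith
  qed
  ultimately show ?thesis using mod_flex M by blast
qed

lemma ribbon_line_slippage:
  assumes j: "j < r"
  shows "periodic_slippage_line (tiling_framework \<Gamma> len) (ribbon_line j)"
  unfolding periodic_slippage_line_def joints_tiling_framework
proof (rule conjI[OF Delone_framework_tiling], rule exI[of _ "frame_op (perp (nrm j))"],
    rule exI[of _ "frame_op (nrm j)"], rule exI[of _ "perp (nrm j)"], intro conjI allI impI)
  show "ribbon_line j = span {frame_op (perp (nrm j))}" by (rule ribbon_line_def)
  show "plane_basis (frame_op (perp (nrm j))) (frame_op (nrm j))"
    using frame_op_basis[OF j] by (simp add: plane_basis_iff_perp)
  show "perp (nrm j) \<noteq> 0" using j normal_nonzero by simp
qed (rule slippage_flex[OF j])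

section \<open>Ribbons\<close>

lemma tile_at_parallelogram:
  assumes "i < r" "j < r" "i \<noteq> j" "on_grid i x" "on_grid j x"
  shows "tile_at \<Gamma> len x = parallelogram (dp x) (edge_vec i) (edge_vec j)"
  using tile_at_eq[OF assms] by (simp add: parallelogram_def)

text \<open>The base point \<open>z\<close> may be another corner of the tile, but in the grid of
  the edge it has the ceiling of the crossing \<open>x\<close>. This lets two tiles sharing an edge
  be compared.\<close>

lemma edge_of_tile:
  assumes ij: "i < r" "j < r" "i \<noteq> j" "on_grid i x" "on_grid j x"
    and e: "e edge_of tile_at \<Gamma> len x"
  obtains l z where "l < r" "on_grid l x" "e = closed_segment (dp z) (dp z + edge_vec l)"
    "\<lceil>level l z\<rceil> = \<lceil>level l x\<rceil>"
proof -
  have z: "\<exists>z. dp z = dp x + edge_vec k \<and> \<lceil>level l z\<rceil> = \<lceil>level l x\<rceil>"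
    if "k < r" "on_grid k x" "l < r" "l \<noteq> k" for k l
  proof (rule region_at_corner[of "{k}" x])
    fix y assume "\<forall>i<r. \<lceil>level i y\<rceil> = \<lceil>level i x\<rceil> + (if i \<in> {k} then 1 else 0)"
      "dp y = dp x + sum edge_vec {k}"
    then show ?thesis using that by (intro exI[of _ y]) simp
  qed (use that in auto)
  have "e \<in> {closed_segment (dp x) (dp x + edge_vec i), closed_segment (dp x + edge_vec j) (dp x + edge_vec j + edge_vec i),
    closed_segment (dp x) (dp x + edge_vec j), closed_segment (dp x + edge_vec i) (dp x + edge_vec i + edge_vec j)}"
    using e edge_of_parallelogramD[OF _ edge_vecs_not_parallel[OF ij(1-3)]]
    unfolding tile_at_parallelogram[OF ij] by blast
  then consider "e = closed_segment (dp x) (dp x + edge_vec i)"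
    | "e = closed_segment (dp x + edge_vec j) (dp x + edge_vec j + edge_vec i)"
    | "e = closed_segment (dp x) (dp x + edge_vec j)"
    | "e = closed_segment (dp x + edge_vec i) (dp x + edge_vec i + edge_vec j)" by blast
  then show ?thesis
  proof cases
    case 1
    then show ?thesis using that[of i x] ij by blast
  next
    case 2
    then show ?thesis using that[of i] z[of j i] ij by metis
  next
    case 3
    then show ?thesis using that[of j x] ij by blast
  next
    case 4
    then show ?thesis using that[of j] z[of i j] ij by metis
  qed
qed

lemma tiling_tilesE:
  assumes "P \<in> tiling_tiles \<Gamma> len"
  obtains x i j where "i < r" "j < r" "i \<noteq> j" "on_grid i x" "on_grid j x" "P = tile_at \<Gamma> len x"
proof -
  obtain x A B where P: "P = tile_at \<Gamma> len x" "A \<in> grid_lines \<Gamma>" "B \<in> grid_lines \<Gamma>" "A \<noteq> B" "x \<in> A" "x \<in> B"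
    using assms unfolding tiling_tiles_def by blast
  obtain i k j l where A: "i < r" "A = grid_line \<Gamma> i k" "j < r" "B = grid_line \<Gamma> j l"
    using P(2,3) unfolding grid_lines_def by blast
  have "i \<noteq> j"
  proof
    assume "i = j"
    then have "k = l" using P A by (simp add: in_grid_line_iff)
    then show False using P(4) A \<open>i = j\<close> by simp
  qed
  then show ?thesis using that P A on_grid_iff by blast
qed

lemma tile_at_in_tiling_tiles:
  assumes "i < r" "j < r" "i \<noteq> j" "on_grid i x" "on_grid j x"
  shows "tile_at \<Gamma> len x \<in> tiling_tiles \<Gamma> len"
proof -
  obtain k l where "x \<in> grid_line \<Gamma> i k" "x \<in> grid_line \<Gamma> j l" using assms by (auto simp: on_grid_iff)
  moreover have "grid_line \<Gamma> i k \<noteq> grid_line \<Gamma> j l" using grid_lines_distinct calculation assms by blast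
  moreover have "grid_line \<Gamma> i k \<in> grid_lines \<Gamma>" "grid_line \<Gamma> j l \<in> grid_lines \<Gamma>"
    using assms by (auto simp: grid_lines_def)
  ultimately show ?thesis unfolding tiling_tiles_def by blast
qed

text \<open>Shared edges are translates of one another, so they all belong to one grid
  \<open>j\<close>. The lower end of a shared edge determines the rounded level, which must
  therefore agree for the two tiles containing it; by induction the whole ribbon stays on one grid
  line.\<close>

lemma ribbon_on_grid_line:
  assumes "ribbon (tiling_tiles \<Gamma> len) T"
  obtains j k x where "j < r" "\<And>n. level j (x n) = of_int k"
    "\<And>n. \<exists>i<r. i \<noteq> j \<and> on_grid i (x n) \<and> T n = tile_at \<Gamma> len (x n)"
proof -
  obtain e where T: "range T \<subseteq> tiling_tiles \<Gamma> len"
    and e: "\<And>n. e n edge_of T n" "\<And>n. e n edge_of T (n + 1)" "\<And>n m. \<exists>c. e m = (+) c ` e n"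
    using assms unfolding ribbon_def by blast
  have "\<exists>x i j. i < r \<and> j < r \<and> i \<noteq> j \<and> on_grid i x \<and> on_grid j x \<and> T n = tile_at \<Gamma> len x" for n
    using T tiling_tilesE[of "T n"] by (metis rangeI subsetD)
  then obtain x where x: "\<And>n. \<exists>i j. i < r \<and> j < r \<and> i \<noteq> j \<and> on_grid i (x n) \<and> on_grid j (x n) \<and> T n = tile_at \<Gamma> len (x n)"
    by metis
  have edge: "\<exists>l z. l < r \<and> on_grid l (x n) \<and> d = closed_segment (dp z) (dp z + edge_vec l) \<and> \<lceil>level l z\<rceil> = \<lceil>level l (x n)\<rceil>"
    if "d edge_of T n" for d n
    using x[of n] edge_of_tile that by metis
  obtain j z0 where j: "j < r" "e 0 = closed_segment (dp z0) (dp z0 + edge_vec j)" using edge[OF e(1)] by blast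
  have same: "l = j" if l: "l < r" "e n = closed_segment (dp z) (dp z + edge_vec l)" for l z n
  proof (rule ccontr)
    assume "l \<noteq> j"
    then have np: "perp (edge_vec l) \<bullet> edge_vec j \<noteq> 0" using edge_vecs_not_parallel l j by blast
    obtain c where "e n = (+) c ` e 0" using e(3) by blast
    then have "closed_segment (dp z) (dp z + edge_vec l) = closed_segment (c + dp z0) (c + (dp z0 + edge_vec j))"
      unfolding l j closed_segment_translation .
    then have "{dp z, dp z + edge_vec l} = {c + dp z0, c + (dp z0 + edge_vec j)}" by simp
    then have "edge_vec l = edge_vec j \<or> edge_vec l = - edge_vec j"
      by (auto simp: doubleton_eq_iff algebra_simps add_eq_0_iff)
    then show False using np by (auto simp: inner_minus_right)
  qed
  have on: "on_grid j (x n)" for n using edge[OF e(1)[of n]] same by blast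
  have K: "\<lceil>level j (x n)\<rceil> = \<lceil>level j (x (n + 1))\<rceil>" for n
  proof -
    obtain z where z: "e n = closed_segment (dp z) (dp z + edge_vec j)" "\<lceil>level j z\<rceil> = \<lceil>level j (x n)\<rceil>"
      using edge[OF e(1)[of n]] same by blast
    obtain z' where z': "e n = closed_segment (dp z') (dp z' + edge_vec j)" "\<lceil>level j z'\<rceil> = \<lceil>level j (x (n + 1))\<rceil>"
      using edge[OF e(2)[of n]] same by blast
    have "{dp z, dp z + edge_vec j} = {dp z', dp z' + edge_vec j}" using z(1) z'(1) by simp
    then have "dp z = dp z' \<or> dp z' + edge_vec j + edge_vec j = dp z'" by (auto simp: doubleton_eq_iff)
    moreover have "dp z' + edge_vec j + edge_vec j = dp z' + 2 *\<^sub>R edge_vec j" by (simp add: scaleR_2)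
    ultimately have "dp z = dp z'" using edge_vec_nonzero[OF j(1)] by simp
    then show ?thesis using dp_eq_imp_level_eq[OF _ j(1)] z z' by metis
  qed
  have "\<lceil>level j (x n)\<rceil> = \<lceil>level j (x 0)\<rceil>" for n
  proof (induction n rule: int_induct[where k = 0])
    case (step2 i)
    then show ?case using K[of "i - 1"] by simp
  qed (use K in auto)
  moreover have "level j (x n) = of_int \<lceil>level j (x n)\<rceil>" for n using on[of n] by (auto simp: on_grid_def Ints_def)
  ultimately have "level j (x n) = of_int \<lceil>level j (x 0)\<rceil>" for n by metis
  moreover have "\<exists>i<r. i \<noteq> j \<and> on_grid i (x n) \<and> T n = tile_at \<Gamma> len (x n)" for n using x[of n] by metis
  ultimately show ?thesis using that j(1) by blast
qed

text \<open>If \<open>H\<close> were not parallel to the ribbon line, the distance from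
  \<open>H\<close> would grow linearly along the grid line, so all base points of the tiles would be
  bounded. By discreteness only finitely many tiles would remain, against the injectivity of
  \<open>T\<close>.\<close>

lemma ribbon_direction:
  assumes rib: "ribbon (tiling_tiles \<Gamma> len) T" and H: "origin_line H"
    and near: "\<forall>x\<in>\<Union> (range T). infdist x H \<le> R"
  shows "\<exists>j<r. H = ribbon_line j"
proof -
  obtain j k x where j: "j < r" and lev: "\<And>n. level j (x n) = of_int k"
    and tile: "\<And>n. \<exists>i<r. i \<noteq> j \<and> on_grid i (x n) \<and> T n = tile_at \<Gamma> len (x n)"
    using ribbon_on_grid_line[OF rib] by metis
  obtain v where v: "v \<noteq> 0" "H = span {v}" using H by (auto simp: origin_line_def)
  define t1 where "t1 = frame_op (perp (nrm j))"
  have t1: "t1 \<noteq> 0" unfolding t1_def using j normal_nonzero by (simp add: frame_op_eq_0_iff)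
  have on: "on_grid j (x n)" for n using lev by (simp add: on_grid_def)
  have pg: "\<exists>i<r. T n = parallelogram (dp (x n)) (edge_vec i) (edge_vec j)" for n
  proof -
    obtain i where i: "i < r" "i \<noteq> j" "on_grid i (x n)" "T n = tile_at \<Gamma> len (x n)" using tile by blast
    then show ?thesis using tile_at_parallelogram[OF i(1) j i(2,3) on] by auto
  qed
  have pT: "dp (x n) \<in> T n" for n
  proof -
    obtain i where "T n = parallelogram (dp (x n)) (edge_vec i) (edge_vec j)" using pg by blast
    then show ?thesis by (simp add: parallelogram_def hull_inc)
  qed
  have "perp v \<bullet> t1 = 0"
  proof (rule ccontr)
    assume n0: "perp v \<bullet> t1 \<noteq> 0"
    obtain E where E: "E > 0" "\<And>x. norm (dp x - frame_op x) \<le> E" using dp_near_frame_op by blast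
    \<comment> \<open>A bound for the position \<open>\<tau>\<close> of a crossing along the grid
      line, obtained by solving the distance bound for \<open>\<tau>\<close>.\<close>
    define C where "C = (norm v * R + norm v * E + \<bar>perp v \<bullet> frame_op (x 0)\<bar>) / \<bar>perp v \<bullet> t1\<bar>"
    have bound: "norm (dp (x n)) \<le> E + norm (frame_op (x 0)) + C * norm t1" for n
    proof -
      define \<tau> where "\<tau> = (x n - x 0) \<bullet> perp (nrm j)"
      have "(x n - x 0) \<bullet> nrm j = 0"
        using level_diff[of j "x n" "x 0"] lev spacing_pos[OF j] by simp
      then have "(x n - x 0 - \<tau> *\<^sub>R perp (nrm j)) \<bullet> nrm j = 0"
        "(x n - x 0 - \<tau> *\<^sub>R perp (nrm j)) \<bullet> perp (nrm j) = 0"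
        using j by (simp_all add: inner_diff_left \<tau>_def dot_square_norm)
      moreover have "perp (nrm j) \<bullet> perp (nrm j) \<noteq> 0" using normal_nonzero[OF j] by simp
      ultimately have "x n - x 0 - \<tau> *\<^sub>R perp (nrm j) = 0" using orthogonal_to_basis_imp_0 by blast
      then have "x n = x 0 + \<tau> *\<^sub>R perp (nrm j)" by (simp add: algebra_simps)
      then have fx: "frame_op (x n) = frame_op (x 0) + \<tau> *\<^sub>R t1"
        by (simp only: frame_op_add frame_op_scaleR t1_def)
      have "closed H" "H \<noteq> {}" using v by (auto simp: closed_span intro: span_0)
      then obtain h where h: "h \<in> H" "infdist (dp (x n)) H = dist (dp (x n)) h"
        using infdist_attains_inf by blast
      have "perp v \<bullet> h = 0" using h(1) v in_span_singleton_iff_perp by blast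
      then have "perp v \<bullet> dp (x n) = perp v \<bullet> (dp (x n) - h)" by (simp add: inner_diff_right)
      also have "\<bar>\<dots>\<bar> \<le> norm (perp v) * norm (dp (x n) - h)" by (rule Cauchy_Schwarz_ineq2)
      also have "\<dots> \<le> norm v * R"
      proof -
        have "dist (dp (x n)) h \<le> R" using near pT h(2) by (metis UN_I UNIV_I)
        then show ?thesis by (simp add: dist_norm mult_left_mono)
      qed
      finally have 1: "\<bar>perp v \<bullet> dp (x n)\<bar> \<le> norm v * R" .
      have 2: "\<bar>perp v \<bullet> (dp (x n) - frame_op (x n))\<bar> \<le> norm v * E"
        using Cauchy_Schwarz_ineq2[of "perp v" "dp (x n) - frame_op (x n)"]
          mult_left_mono[OF E(2)[of "x n"], of "norm v"] by simp
      have "\<tau> * (perp v \<bullet> t1) = perp v \<bullet> dp (x n) - perp v \<bullet> (dp (x n) - frame_op (x n)) - perp v \<bullet> frame_op (x 0)"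
        using fx by (simp add: inner_diff_right inner_add_right)
      then have "\<bar>\<tau> * (perp v \<bullet> t1)\<bar> \<le> norm v * R + norm v * E + \<bar>perp v \<bullet> frame_op (x 0)\<bar>" using 1 2 by linarith
      then have \<tau>: "\<bar>\<tau>\<bar> \<le> C" unfolding C_def using n0 by (simp add: abs_mult field_simps)
      have "dp (x n) = (dp (x n) - frame_op (x n)) + frame_op (x 0) + \<tau> *\<^sub>R t1" using fx by simp
      then have "norm (dp (x n)) \<le> norm (dp (x n) - frame_op (x n)) + norm (frame_op (x 0)) + norm (\<tau> *\<^sub>R t1)"
        by (metis norm_add_rule_thm norm_triangle_ineq order_refl)
      moreover have "norm (\<tau> *\<^sub>R t1) \<le> C * norm t1" using mult_right_mono[OF \<tau>, of "norm t1"] by simp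
      ultimately show ?thesis using E(2)[of "x n"] by linarith
    qed
    define F where "F = range dp \<inter> cball 0 (E + norm (frame_op (x 0)) + C * norm t1)"
    have "uniform_discrete F" using uniform_discrete_range_dp unfolding F_def uniform_discrete_def by blast
    moreover have "bounded F" unfolding F_def by (intro bounded_Int disjI2 bounded_cball)
    ultimately have "finite F" using uniform_discrete_finite_iff by blast
    then have "finite ((\<lambda>(p, i). parallelogram p (edge_vec i) (edge_vec j)) ` (F \<times> {..<r}))" by simp
    moreover have "range T \<subseteq> (\<lambda>(p, i). parallelogram p (edge_vec i) (edge_vec j)) ` (F \<times> {..<r})"
    proof (rule image_subsetI)
      fix n
      obtain i where i: "i < r" "T n = parallelogram (dp (x n)) (edge_vec i) (edge_vec j)" using pg by blast
      then show "T n \<in> (\<lambda>(p, i). parallelogram p (edge_vec i) (edge_vec j)) ` (F \<times> {..<r})"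
        using bound[of n] by (intro image_eqI[of _ _ "(dp (x n), i)"]) (auto simp: F_def)
    qed
    ultimately have "finite (range T)" by (rule finite_subset[rotated])
    moreover have "inj T" using rib by (simp add: ribbon_def)
    ultimately show False using finite_imageD infinite_UNIV_int by blast
  qed
  then have "H = ribbon_line j"
    unfolding ribbon_line_def v(2) t1_def[symmetric] using span_singleton_eq_iff_perp v t1 by blast
  then show ?thesis using j by blast
qed

section \<open>A ribbon along each grid direction\<close>

lemma dp_between_crossings:
  assumes j: "j < r" "on_grid j x0"
    and no_cross: "\<And>t i. a < t \<Longrightarrow> t < b \<Longrightarrow> i < r \<Longrightarrow> i \<noteq> j \<Longrightarrow> \<not> on_grid i (x0 + t *\<^sub>R perp (nrm j))"
    and st: "s \<in> {a<..<b}" "t \<in> {a<..<b}"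
  shows "dp (x0 + s *\<^sub>R perp (nrm j)) = dp (x0 + t *\<^sub>R perp (nrm j))"
proof (rule connected_local_const[of "{a<..<b}" s t "\<lambda>t. dp (x0 + t *\<^sub>R perp (nrm j))", OF connected_Ioo st], rule ballI)
  fix c assume c: "c \<in> {a<..<b}"
  let ?z = "x0 + c *\<^sub>R perp (nrm j)"
  have "((\<lambda>t. t - c) \<longlongrightarrow> c - c) (nhds c)" by (intro tendsto_intros filterlim_ident)
  then have "filterlim (\<lambda>t. t - c) (nhds 0) (nhds c)" by simp
  from eventually_compose_filterlim[OF dp_near_line[of ?z "perp (nrm j)"] this]
  have "\<forall>\<^sub>F t in nhds c. dp (?z + (t - c) *\<^sub>R perp (nrm j)) =
      dp ?z + sum edge_vec {i. i < r \<and> on_grid i ?z \<and> (t - c) * (perp (nrm j) \<bullet> nrm i) > 0}" .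
  then have "\<forall>\<^sub>F t in nhds c. dp ?z = dp (x0 + t *\<^sub>R perp (nrm j))"
  proof eventually_elim
    case (elim t)
    have S: "{i. i < r \<and> on_grid i ?z \<and> (t - c) * (perp (nrm j) \<bullet> nrm i) > 0} = {}"
    proof (rule ccontr)
      assume "\<not> ?thesis"
      then obtain i where i: "i < r" "on_grid i ?z" "(t - c) * (perp (nrm j) \<bullet> nrm i) > 0" by blast
      then have "i \<noteq> j" by auto
      then show False using i no_cross c by auto
    qed
    have eq: "?z + (t - c) *\<^sub>R perp (nrm j) = x0 + t *\<^sub>R perp (nrm j)" by (simp add: algebra_simps)
    show ?case using elim unfolding S eq by simp
  qed
  then show "\<forall>\<^sub>F t in at c within {a<..<b}. dp ?z = dp (x0 + t *\<^sub>R perp (nrm j))"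
    by (simp add: eventually_at_filter eventually_mono)
qed

lemma dp_beside_crossing:
  assumes ij: "i < r" "j < r" "i \<noteq> j" "on_grid i z" "on_grid j z"
  obtains \<delta> where "\<delta> > 0" "\<And>t. \<bar>t\<bar> < \<delta> \<Longrightarrow>
    dp (z + t *\<^sub>R perp (nrm j)) = dp z + (if t * (perp (nrm j) \<bullet> nrm i) > 0 then edge_vec i else 0)"
proof -
  obtain \<delta> where \<delta>: "\<delta> > 0" "\<And>t. dist t 0 < \<delta> \<Longrightarrow> dp (z + t *\<^sub>R perp (nrm j)) =
      dp z + sum edge_vec {l. l < r \<and> on_grid l z \<and> t * (perp (nrm j) \<bullet> nrm l) > 0}"
    using dp_near_line[of z "perp (nrm j)"] unfolding eventually_nhds_metric by blast
  have S: "{l. l < r \<and> on_grid l z \<and> t * (perp (nrm j) \<bullet> nrm l) > 0} =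
      (if t * (perp (nrm j) \<bullet> nrm i) > 0 then {i} else {})" (is "?A = _") for t
  proof -
    have "l = i" if "l < r" "on_grid l z" "t * (perp (nrm j) \<bullet> nrm l) > 0" for l
    proof -
      have "l \<noteq> j" using that(3) by auto
      then show ?thesis using at_most_two_grids[OF ij(1,2) that(1) ij(4,5) that(2) ij(3)] by blast
    qed
    then have "?A \<subseteq> {i}" by blast
    moreover have "i \<in> ?A \<longleftrightarrow> t * (perp (nrm j) \<bullet> nrm i) > 0" using ij by blast
    ultimately show ?thesis by (cases "i \<in> ?A") auto
  qed
  show ?thesis
  proof (rule that[OF \<delta>(1)])
    fix t :: real assume "\<bar>t\<bar> < \<delta>"
    then show "dp (z + t *\<^sub>R perp (nrm j)) = dp z + (if t * (perp (nrm j) \<bullet> nrm i) > 0 then edge_vec i else 0)"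
      using \<delta>(2)[of t] unfolding S by simp
  qed
qed

text \<open>The ribbon of the level 0 line: \<open>\<theta>\<close> lists its crossings with the
  other grids, \<open>q n\<close> is the lower vertex along the \<open>n\<close>th gap, and the tile
  of crossing \<open>n\<close> lies between the edges at \<open>q (n - 1)\<close> and
  \<open>q n\<close>.\<close>

lemma ribbon_along_grid_line:
  assumes j: "j < r"
  obtains T R where "ribbon (tiling_tiles \<Gamma> len) T" "\<forall>x\<in>\<Union> (range T). infdist x (ribbon_line j) \<le> R"
proof -
  define m where "m = perp (nrm j)"
  define x0 where "x0 = (- shift \<Gamma> j) *\<^sub>R nrm j"
  define y where "y t = x0 + t *\<^sub>R m" for t
  have lev: "level j (y t) = 0" for t
    using j by (simp add: level_def y_def x0_def m_def inner_add_left inner_diff_left dot_square_norm)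
  have on: "on_grid j (y t)" for t using lev by (simp add: on_grid_def)
  define X where "X = {t. \<exists>i<r. i \<noteq> j \<and> on_grid i (y t)}"
  have slope: "(m \<bullet> nrm i) / spacing \<Gamma> i \<noteq> 0" if "i < r" "i \<noteq> j" for i
    using normals_not_parallel[of j i] spacing_pos[of i] that j by (auto simp: m_def)
  have on_iff: "on_grid i (y t) \<longleftrightarrow> level i x0 + (m \<bullet> nrm i) / spacing \<Gamma> i * t \<in> \<int>" for i t
    by (simp add: on_grid_def y_def level_add mult.commute)
  define l where "l = (if j = 0 then 1 else 0 :: nat)"
  have l: "l < r" "l \<noteq> j" using two_grids by (auto simp: l_def)
  obtain \<theta> :: "int \<Rightarrow> real" where \<theta>: "\<And>n. \<theta> n \<in> X" "\<And>n. \<theta> n < \<theta> (n + 1)" "\<And>n. X \<inter> {\<theta> n<..<\<theta> (n + 1)} = {}"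
  proof (rule locally_finite_enumeration[of X])
    fix a b
    have "X \<inter> {a..b} \<subseteq> (\<Union>i\<in>{..<r} - {j}. {t \<in> {a..b}. level i x0 + (m \<bullet> nrm i) / spacing \<Gamma> i * t \<in> \<int>})"
      by (auto simp: X_def on_iff)
    moreover have "finite (\<Union>i\<in>{..<r} - {j}. {t \<in> {a..b}. level i x0 + (m \<bullet> nrm i) / spacing \<Gamma> i * t \<in> \<int>})"
      using finite_affine_in_Ints[OF slope] by blast
    ultimately show "finite (X \<inter> {a..b})" by (rule finite_subset)
  next
    fix a
    show "\<exists>x>a. x \<in> X" using ex_gt_affine_in_Ints[OF slope[OF l]] l unfolding X_def on_iff by blast
    show "\<exists>x<a. x \<in> X" using ex_lt_affine_in_Ints[OF slope[OF l]] l unfolding X_def on_iff by blast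
  qed (rule that)
  define q where "q n = dp (y ((\<theta> n + \<theta> (n + 1)) / 2))" for n
  have q: "dp (y t) = q n" if "\<theta> n < t" "t < \<theta> (n + 1)" for n t
    unfolding q_def y_def m_def
  proof (rule dp_between_crossings[of j x0 "\<theta> n" "\<theta> (n + 1)"])
    show "on_grid j x0" using on[of 0] by (simp add: y_def)
    fix s i assume "\<theta> n < s" "s < \<theta> (n + 1)" "i < r" "i \<noteq> j"
    then show "\<not> on_grid i (x0 + s *\<^sub>R perp (nrm j))"
      using \<theta>(3)[of n] unfolding X_def y_def m_def by auto
  qed (use j that \<theta>(2)[of n] in auto)
  define T where "T n = tile_at \<Gamma> len (y (\<theta> n))" for n
  have local: "\<exists>i<r. i \<noteq> j \<and> on_grid i (y (\<theta> n)) \<and>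
     (m \<bullet> nrm i > 0 \<and> q (n - 1) = dp (y (\<theta> n)) \<and> q n = dp (y (\<theta> n)) + edge_vec i \<or>
      m \<bullet> nrm i < 0 \<and> q n = dp (y (\<theta> n)) \<and> q (n - 1) = dp (y (\<theta> n)) + edge_vec i)" for n
  proof -
    obtain i where i: "i < r" "i \<noteq> j" "on_grid i (y (\<theta> n))" using \<theta>(1)[of n] unfolding X_def by blast
    obtain \<delta> where \<delta>: "\<delta> > 0" "\<And>t. \<bar>t\<bar> < \<delta> \<Longrightarrow>
        dp (y (\<theta> n) + t *\<^sub>R m) = dp (y (\<theta> n)) + (if t * (m \<bullet> nrm i) > 0 then edge_vec i else 0)"
      using dp_beside_crossing[OF i(1) j i(2,3) on] unfolding m_def by blast
    have sh: "y (\<theta> n) + t *\<^sub>R m = y (\<theta> n + t)" for t by (simp add: y_def algebra_simps)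
    \<comment> \<open>Half of the three constraints, so that moving by \<open>s\<close> to either
      side stays within \<open>\<delta>\<close> and inside the neighbouring gap.\<close>
    define s where "s = min \<delta> (min (\<theta> (n + 1) - \<theta> n) (\<theta> n - \<theta> (n - 1))) / 2"
    have \<theta>n: "\<theta> (n - 1) < \<theta> n" using \<theta>(2)[of "n - 1"] by simp
    have s: "0 < s" "s < \<delta>" "\<theta> n + s < \<theta> (n + 1)" "\<theta> (n - 1) < \<theta> n - s"
      using \<delta>(1) \<theta>(2)[of n] \<theta>n unfolding s_def by (auto simp: min_def field_simps)
    have "q n = dp (y (\<theta> n)) + (if s * (m \<bullet> nrm i) > 0 then edge_vec i else 0)"
      using q[of n "\<theta> n + s"] \<delta>(2)[of s] s unfolding sh by simp
    moreover have "q (n - 1) = dp (y (\<theta> n)) + (if - s * (m \<bullet> nrm i) > 0 then edge_vec i else 0)"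
      using q[of "n - 1" "\<theta> n + - s"] \<delta>(2)[of "- s"] s unfolding sh by simp
    moreover have "m \<bullet> nrm i > 0 \<or> m \<bullet> nrm i < 0" using slope[OF i(1,2)] by auto
    ultimately show ?thesis using i s(1)
      by (intro exI[of _ i]) (auto simp: zero_less_mult_iff mult_less_0_iff)
  qed
  have md: "m \<bullet> edge_vec j = 0" by (simp add: m_def edge_vec_def)
  \<comment> \<open>Crossing a line of grid \<open>i\<close> in direction \<open>m\<close> adds
    \<open>edge_vec i\<close> if \<open>m \<bullet> nrm i\<close> is positive and removes it if
    negative. Either way the \<open>m\<close> coordinate grows.\<close>
  have step: "\<exists>i<r. i \<noteq> j \<and> (q n - q (n - 1) = edge_vec i \<or> q n - q (n - 1) = - edge_vec i) \<and>
     m \<bullet> q (n - 1) < m \<bullet> q n \<and> T n = parallelogram (q (n - 1)) (edge_vec j) (q n - q (n - 1))" for n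
  proof -
    obtain i where i: "i < r" "i \<noteq> j" "on_grid i (y (\<theta> n))" and
      c: "m \<bullet> nrm i > 0 \<and> q (n - 1) = dp (y (\<theta> n)) \<and> q n = dp (y (\<theta> n)) + edge_vec i \<or>
      m \<bullet> nrm i < 0 \<and> q n = dp (y (\<theta> n)) \<and> q (n - 1) = dp (y (\<theta> n)) + edge_vec i"
      using local by blast
    have T: "T n = parallelogram (dp (y (\<theta> n))) (edge_vec j) (edge_vec i)"
      unfolding T_def using tile_at_parallelogram[OF j i(1) i(2)[symmetric] on i(3)] .
    have mi: "m \<bullet> edge_vec i = len i * (m \<bullet> nrm i)" "len i > 0" using i len_pos by (simp_all add: edge_vec_def)
    from c show ?thesis
    proof
      assume a: "m \<bullet> nrm i > 0 \<and> q (n - 1) = dp (y (\<theta> n)) \<and> q n = dp (y (\<theta> n)) + edge_vec i"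
      then have "m \<bullet> edge_vec i > 0" using mi by simp
      then show ?thesis using i a T by (intro exI[of _ i]) (auto simp: inner_add_right)
    next
      assume a: "m \<bullet> nrm i < 0 \<and> q n = dp (y (\<theta> n)) \<and> q (n - 1) = dp (y (\<theta> n)) + edge_vec i"
      then have "m \<bullet> edge_vec i < 0" using mi by (simp add: mult_pos_neg)
      then show ?thesis using i a T by (intro exI[of _ i]) (auto simp: inner_add_right parallelogram_shift)
    qed
  qed
  have incr: "m \<bullet> q n < m \<bullet> q (n + 1)" for n using step[of "n + 1"] by auto
  have mono: "m \<bullet> q n \<le> m \<bullet> q n'" if "n \<le> n'" for n n'
    using that by (induction n' rule: int_ge_induct) (auto intro: order_trans less_imp_le incr)
  have edges: "closed_segment (q n) (q n + edge_vec j) edge_of T n"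
    "closed_segment (q (n - 1)) (q (n - 1) + edge_vec j) edge_of T n" for n
  proof -
    obtain i where i: "i < r" "i \<noteq> j" "q n - q (n - 1) = edge_vec i \<or> q n - q (n - 1) = - edge_vec i"
      and T: "T n = parallelogram (q (n - 1)) (edge_vec j) (q n - q (n - 1))" using step[of n] by blast
    have np: "perp (edge_vec j) \<bullet> (q n - q (n - 1)) \<noteq> 0"
      using i edge_vecs_not_parallel[OF j i(1)] by (auto simp: inner_minus_right)
    show "closed_segment (q n) (q n + edge_vec j) edge_of T n"
      "closed_segment (q (n - 1)) (q (n - 1) + edge_vec j) edge_of T n"
      using edge_of_parallelogram[OF np, of "q (n - 1)"] unfolding T by simp_all
  qed
  \<comment> \<open>Since \<open>edge_vec j\<close> is orthogonal to \<open>m\<close>, a later tile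
    lies in a half plane beyond the corner \<open>q (n - 1)\<close> of an earlier one.\<close>
  have "inj T"
  proof (rule linorder_injI)
    fix n n' :: int assume "n < n'"
    have "T n = parallelogram (q (n - 1)) (edge_vec j) (q n - q (n - 1))" using step[of n] by blast
    then have "q (n - 1) \<in> T n" by (simp add: parallelogram_def hull_inc)
    moreover have "T n' \<subseteq> {x. m \<bullet> x \<ge> m \<bullet> q (n' - 1)}"
    proof -
      have "T n' = parallelogram (q (n' - 1)) (edge_vec j) (q n' - q (n' - 1))" "m \<bullet> q (n' - 1) < m \<bullet> q n'"
        using step[of n'] by blast+
      then show ?thesis unfolding parallelogram_def
        by (simp only:) (rule hull_minimal; auto simp: convex_halfspace_ge inner_add_right inner_diff_right md)
    qed
    moreover have "m \<bullet> q (n - 1) < m \<bullet> q (n' - 1)"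
      using incr[of "n - 1"] mono[of n "n' - 1"] \<open>n < n'\<close> by simp
    ultimately show "T n \<noteq> T n'" by auto
  qed
  moreover have "range T \<subseteq> tiling_tiles \<Gamma> len"
  proof (rule image_subsetI)
    fix n
    obtain i where "i < r" "i \<noteq> j" "on_grid i (y (\<theta> n))" using \<theta>(1)[of n] unfolding X_def by blast
    then show "T n \<in> tiling_tiles \<Gamma> len" unfolding T_def using tile_at_in_tiling_tiles j on by blast
  qed
  moreover have "\<exists>e. (\<forall>i. e i edge_of T i \<and> e i edge_of T (i + 1)) \<and> (\<forall>i j. \<exists>c. e j = (+) c ` e i)"
  proof (rule exI[of _ "\<lambda>n. closed_segment (q n) (q n + edge_vec j)"], intro conjI allI)
    fix n n'
    show "closed_segment (q n) (q n + edge_vec j) edge_of T n" by (rule edges)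
    show "closed_segment (q n) (q n + edge_vec j) edge_of T (n + 1)" using edges(2)[of "n + 1"] by simp
    have "closed_segment (q n') (q n' + edge_vec j) = (+) (q n' - q n) ` closed_segment (q n) (q n + edge_vec j)"
      unfolding closed_segment_translation[symmetric] by (simp add: algebra_simps)
    then show "\<exists>c. closed_segment (q n') (q n' + edge_vec j) = (+) c ` closed_segment (q n) (q n + edge_vec j)" by blast
  qed
  ultimately have rib: "ribbon (tiling_tiles \<Gamma> len) T" unfolding ribbon_def by blast
  obtain E where E: "E > 0" "\<And>x. norm (dp x - frame_op x) \<le> E" using dp_near_frame_op by blast
  \<comment> \<open>Rounding error, offset of the grid line from the origin, and at most two edges
    of the tile, each no longer than the sum of all lengths.\<close>
  define R where "R = E + norm (frame_op x0) + 2 * sum len {..<r}"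
  have "infdist x (ribbon_line j) \<le> R" if x: "x \<in> T n" for x n
  proof -
    define h where "h = \<theta> n *\<^sub>R frame_op m"
    have h: "h \<in> ribbon_line j" unfolding h_def ribbon_line_def m_def by (intro span_mul span_base) simp
    obtain i where i: "i < r" "i \<noteq> j" "on_grid i (y (\<theta> n))" using \<theta>(1)[of n] unfolding X_def by blast
    have T: "T n = parallelogram (dp (y (\<theta> n))) (edge_vec j) (edge_vec i)"
      unfolding T_def using tile_at_parallelogram[OF j i(1) i(2)[symmetric] on i(3)] .
    have len: "norm (edge_vec l) \<le> sum len {..<r}" if "l < r" for l
      using that len_pos member_le_sum[of l "{..<r}" len] by (auto simp: edge_vec_def less_imp_le)
    have "frame_op (y (\<theta> n)) = frame_op x0 + h" by (simp add: y_def frame_op_add frame_op_scaleR h_def)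
    then have dh: "dp (y (\<theta> n)) - h = (dp (y (\<theta> n)) - frame_op (y (\<theta> n))) + frame_op x0" by simp
    have d: "norm (dp (y (\<theta> n)) - h) \<le> E + norm (frame_op x0)"
      unfolding dh
      using norm_triangle_ineq[of "dp (y (\<theta> n)) - frame_op (y (\<theta> n))" "frame_op x0"] E(2)[of "y (\<theta> n)"] by linarith
    have corner: "dp (y (\<theta> n)) + a + b \<in> cball h R" if "norm a \<le> sum len {..<r}" "norm b \<le> sum len {..<r}" for a b
    proof -
      have "dp (y (\<theta> n)) + a + b - h = (dp (y (\<theta> n)) - h) + a + b" by simp
      moreover have "norm (dp (y (\<theta> n)) - h + a + b) \<le> norm (dp (y (\<theta> n)) - h) + norm a + norm b"
        using norm_triangle_ineq[of "dp (y (\<theta> n)) - h + a" b] norm_triangle_ineq[of "dp (y (\<theta> n)) - h" a] by linarith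
      ultimately have "norm (dp (y (\<theta> n)) + a + b - h) \<le> norm (dp (y (\<theta> n)) - h) + norm a + norm b"
        by (simp only:)
      then have "norm (dp (y (\<theta> n)) + a + b - h) \<le> R" using that d unfolding R_def by linarith
      then show ?thesis by (simp only: mem_cball dist_norm norm_minus_commute[of h])
    qed
    have l0: "norm (0::real^2) \<le> sum len {..<r}" using order_trans[OF norm_ge_zero len[OF j]] by simp
    have "T n \<subseteq> cball h R" unfolding T parallelogram_def
      using corner[OF l0 l0] corner[OF len[OF j] l0] corner[OF len[OF i(1)] l0] corner[OF len[OF j] len[OF i(1)]]
      by (intro hull_minimal convex_cball) simp
    then have "dist x h \<le> R" using x by (auto simp: dist_commute)
    then show ?thesis using infdist_le[OF h, of x] by linarith
  qed
  then show ?thesis using that[OF rib, of R] by blast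
qed

section \<open>The three line figures coincide\<close>

lemma ribbon_figure_eq: "ribbon_figure (tiling_tiles \<Gamma> len) = (\<Union>j<r. ribbon_line j)"
proof
  show "ribbon_figure (tiling_tiles \<Gamma> len) \<subseteq> (\<Union>j<r. ribbon_line j)"
  proof
    fix x assume "x \<in> ribbon_figure (tiling_tiles \<Gamma> len)"
    then obtain H T R where H: "origin_line H" "ribbon (tiling_tiles \<Gamma> len) T"
      "\<forall>x\<in>\<Union> (range T). infdist x H \<le> R" and x: "x \<in> H"
      unfolding ribbon_figure_def by auto
    obtain j where "j < r" "H = ribbon_line j" using ribbon_direction[OF H(2,1,3)] by blast
    then show "x \<in> (\<Union>j<r. ribbon_line j)" using x by blast
  qed
  show "(\<Union>j<r. ribbon_line j) \<subseteq> ribbon_figure (tiling_tiles \<Gamma> len)"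
  proof (rule UN_least)
    fix j assume "j \<in> {..<r}"
    then have j: "j < r" by simp
    have "origin_line (ribbon_line j)" unfolding origin_line_def ribbon_line_def
      using j normal_nonzero frame_op_eq_0_iff perp_eq_0_iff by metis
    moreover obtain T R where "ribbon (tiling_tiles \<Gamma> len) T" "\<forall>x\<in>\<Union> (range T). infdist x (ribbon_line j) \<le> R"
      using ribbon_along_grid_line[OF j] .
    ultimately show "ribbon_line j \<subseteq> ribbon_figure (tiling_tiles \<Gamma> len)" unfolding ribbon_figure_def by blast
  qed
qed

lemma PSF_eq: "PSF (tiling_framework \<Gamma> len) = (\<Union>j<r. ribbon_line j)"
  unfolding PSF_def
  using ribbon_line_slippage slippage_imp_localisation periodic_localisation_line_direction by blast

lemma PLLF_eq: "PLLF (tiling_framework \<Gamma> len) = (\<Union>j<r. ribbon_line j)"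
  unfolding PLLF_def
  using ribbon_line_slippage slippage_imp_localisation periodic_localisation_line_direction by blast

end

theorem theorem4p16:
  fixes \<Gamma> :: multigrid and len :: "nat \<Rightarrow> real" and a1 a2 :: "real^2"
  assumes "regular_multigrid \<Gamma>"
    and "\<forall>j<grid_count \<Gamma>. len j > 0"
    and "plane_basis a1 a2"
  shows "limit_spectrum (tiling_framework \<Gamma> len) a1 a2
           = slippage_spectrum (tiling_framework \<Gamma> len) a1 a2 \<and>
         slippage_spectrum (tiling_framework \<Gamma> len) a1 a2
           = reciprocal_figure a1 a2 (ribbon_figure (tiling_tiles \<Gamma> len))"
proof -
  interpret multigrid_tiling \<Gamma> len
    using assms by unfold_locales auto
  show ?thesis
    unfolding limit_spectrum_def slippage_spectrum_def PSF_eq PLLF_eq ribbon_figure_eq by simp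
qed

end
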